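(* Let $X$ be a connected quandle, let $A$ be an abelian group (used as a trivial coefficient module), and fix $x_0\in X$. Let $\ell$ be a prime number which is coprime to $\mathrm{Type}(X)$. Suppose that the localization $H^1_{\rm gr}(\mathrm{Stab}(x_0);A)_{(\ell)}$ is zero. Then the localization $\mathcal{T}_{(\ell)}$ at $\ell$ of the homomorphism $\mathcal{T}$ defined in the context is an isomorphism $$\mathcal{T}_{(\ell)}: H^2_Q(X;A)_{(\ell)}\stackrel{\sim}{\longrightarrow} H^2_{\rm gr}(\mathrm{Inn}(X),\mathrm{Stab}(x_0);A)_{(\ell)}.$$
   Context: **Quandles.** A quandle is a set $X$ with a binary operation $*$ such that: $a*a=a$ for all $a$; for each $b$ the map $\bullet*b:X\to X$, $x\mapsto x*b$, is bijective, with inverse denoted $\bullet*^{-1}b$; and $(a*b)*c=(a*c)*(b*c)$ for all $a,b,c$. $\mathrm{Inn}(X)$ is the group generated by the bijections $\bullet*x$ ($x\in X$), acting on $X$ from the right (in a product the left factor acts first). $\mathrm{Stab}(x_0)\subset\mathrm{Inn}(X)$ is the stabilizer of $x_0$. $X$ is connected if this action is transitive. $\mathrm{Type}(X)$ is the minimal $n\in\mathbb{N}$ such that $(\cdots(x*y)\cdots)*y=x$ ($n$ times $*y$) for all $x,y\in X$, or $\infty$ if there is none; the condition that a prime is coprime to $\mathrm{Type}(X)$ presupposes that $\mathrm{Type}(X)$ is finite. **Associated group.** $\mathrm{As}(X)=\langle e_x\ (x\in X)\mid e_xe_y=e_ye_{x*y}\ (x,y\in X)\rangle$. It acts on $X$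 from the right by letting $e_y$ send $x$ to $x*y$; $\widetilde{\mathrm{Stab}}(x_0)\subset \mathrm{As}(X)$ is the stabilizer of $x_0$. The homomorphism $\psi:\mathrm{As}(X)\to\mathrm{Inn}(X)$, $e_x\mapsto \bullet*x$, is surjective with central kernel; $\mathrm{Ker}(\psi)\subset\widetilde{\mathrm{Stab}}(x_0)$, and $\psi$ restricts to a central extension $0\to\mathrm{Ker}(\psi)\to\widetilde{\mathrm{Stab}}(x_0)\to\mathrm{Stab}(x_0)\to 0$. **Quandle (co)homology.** $C_n^R(X)=\mathbb{Z}\langle X^n\rangle$, $\partial_2^R(x,y)=(x)-(x*y)$, $\partial_3^R(x,y,z)=(x,z)-(x*y,z)-(x,y)+(x*z,y*z)$. $H_2^R(X;\mathbb Z)=\mathrm{Ker}(\partial_2^R)/\mathrm{Im}(\partial_3^R)$, and $H_2^Q(X;\mathbb{Z})$ is the quotient of $\mathrm{Ker}(\partial_2^R)$ by the subgroup generated by $\mathrm{Im}(\partial_3^R)$ and all $(a,a)$, $a\in X$. $H^2_Q(X;A)$ is the group of maps $f:X^2\to A$ with $f(a,a)=0$ and (linearly extended) $f\circ\partial_3^R=0$, modulo the maps $(x,y)\mapsto g(x)-g(x*y)$ with $g:X\to A$. For connected $X$, evaluation gives $H^2_Q(X;A)\cong\mathrm{Hom}(H_2^Q(X;\mathbb{Z}),A)$. **Group cohomology.** $H^*_{\rm gr}$ denotes group cohomology with trivial coefficients $A$. For $K\subset G$, the relative cohomology $H^n_{\rm gr}(G,K;A)$ is the cohomology of $C^n_{\rm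 gr}(G,K;A)=\mathrm{Map}(G^n,A)\oplus\mathrm{Map}(K^{n-1},A)$ with $\partial^n(h,k)(a,b)=(h(\partial_{n+1}a),\,h(b)-k(\partial_n b))$ for $(a,b)\in G^{n+1}\times K^n$, where $\partial_*$ is the inhomogeneous bar boundary. There is a long exact sequence $\cdots\to H^{1}_{\rm gr}(K;A)\to H^2_{\rm gr}(G,K;A)\xrightarrow{p^*}H^2_{\rm gr}(G;A)\to H^2_{\rm gr}(K;A)\to\cdots$. For a central extension $0\to K\to G\to\mathcal{G}\to0$, the map $\delta_1^*:\mathrm{Hom}(K,A)\to H^2_{\rm gr}(\mathcal{G};A)$ of the 5-term exact sequence $0\to H^1_{\rm gr}(\mathcal G;A)\to H^1_{\rm gr}(G;A)\to\mathrm{Hom}(K,A)\xrightarrow{\delta_1^*}H^2_{\rm gr}(\mathcal G;A)\to H^2_{\rm gr}(G;A)$ sends $F$ to the class of $(g,h)\mapsto F(\mathfrak{s}(g)\mathfrak{s}(h)\mathfrak{s}(gh)^{-1})$ for a set-theoretic section $\mathfrak{s}:\mathcal{G}\to G$. **The projection $\mathcal{P}$ and Eisermann's isomorphism.** Let $\iota:\widetilde{\mathrm{Stab}}(x_0)\hookrightarrow\mathrm{As}(X)$ be the inclusion and $\iota_*$ the induced map on $H_1(-;\mathbb{Z})$. Its image is $\mathbb{Z}$, detected by $\epsilon_X:\mathrm{As}(X)\to\mathbb{Z}$, $e_x\mapsto1$, and it is split by $e_{x_0}\in\widetilde{\mathrm{Stab}}(x_0)$; let $\mathcal{P}:H_1(\widetilde{\mathrm{Stab}}(x_0);\mathbb{Z})\to\mathrm{Ker}(\iota_*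 )$ be the corresponding projection, $\mathcal{P}(h)=h-\epsilon_X(h)[e_{x_0}]$. The assignment $$e_{y_1}^{\epsilon_1}\cdots e_{y_n}^{\epsilon_n}\mapsto\sum_{j=1}^n\epsilon_j\Bigl(\bigl((\cdots(x_0*^{\epsilon_1}y_1)*^{\epsilon_2}\cdots)*^{\epsilon_{j-1}}y_{j-1}\bigr)*^{\frac{\epsilon_j-1}{2}}y_j,\ y_j\Bigr)\qquad(\epsilon_j\in\{\pm1\},\ *^{1}=*,\ a*^0b=a)$$ induces an isomorphism $H_1(\widetilde{\mathrm{Stab}}(x_0);\mathbb{Z})\cong H_2^R(X;\mathbb{Z})$ and, compatibly with $\mathcal{P}$ and the projection $H_2^R\to H_2^Q$, an isomorphism $\mathrm{Ker}(\iota_* )\cong H_2^Q(X;\mathbb{Z})$ (Eisermann). Hence $H^2_Q(X;A)\cong\mathrm{Hom}(\mathrm{Ker}(\iota_* ),A)$, and $\mathcal{P}^*$ (composition with $\mathcal P$) maps $H^2_Q(X;A)$ into $H^1_{\rm gr}(\widetilde{\mathrm{Stab}}(x_0);A)$. **The map $\mathcal{T}$.** Let $\mathrm{res}\,\psi^*:H^1_{\rm gr}(\widetilde{\mathrm{Stab}}(x_0);A)\to\mathrm{Hom}(\mathrm{Ker}(\psi),A)$ be restriction to $\mathrm{Ker}(\psi)$, let $\delta_1^*:\mathrm{Hom}(\mathrm{Ker}(\psi),A)\to H^2_{\rm gr}(\mathrm{Inn}(X);A)$ be the map of the 5-term exact sequence of the central extension $0\to\mathrm{Ker}(\psi)\to\mathrm{As}(X)\to\mathrm{Inn}(X)\to0$,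 that is, the map sending $F$ to the class of $(g,h)\mapsto F(\mathfrak{s}(g)\mathfrak{s}(h)\mathfrak{s}(gh)^{-1})$ for a set-theoretic section $\mathfrak{s}:\mathrm{Inn}(X)\to\mathrm{As}(X)$ of $\psi$, and let $p^*:H^2_{\rm gr}(\mathrm{Inn}(X),\mathrm{Stab}(x_0);A)\to H^2_{\rm gr}(\mathrm{Inn}(X);A)$ be the map of the long exact sequence. Define $$\mathcal{T}:H^2_Q(X;A)\to\frac{H^2_{\rm gr}(\mathrm{Inn}(X),\mathrm{Stab}(x_0);A)}{H^1_{\rm gr}(\mathrm{Stab}(x_0);A)},\qquad \mathcal{T}(\phi)=(p^* )^{-1}\bigl(\delta_1^*\circ\mathrm{res}\,\psi^*\circ\mathcal{P}^*(\phi)\bigr),$$ where the denominator stands for the image of $H^1_{\rm gr}(\mathrm{Stab}(x_0);A)$ under the connecting map; this is well defined by diagram chasing. When $H^1_{\rm gr}(\mathrm{Stab}(x_0);A)_{(\ell)}=0$, the localization at $\ell$ of the target is $H^2_{\rm gr}(\mathrm{Inn}(X),\mathrm{Stab}(x_0);A)_{(\ell)}$. For an abelian group $M$, $M_{(\ell)}=M\otimes_{\mathbb Z}\mathbb{Z}_{(\ell)}$. *)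

theory Defs
  imports "HOL-Algebra.Bij" "HOL-Algebra.Generated_Groups" "HOL-Algebra.Free_Abelian_Groups"
    "HOL-Computational_Algebra.Primes" "HOL-Library.Extended_Nat"
begin

section \<open>Generalities on groups\<close>

text \<open>The common value of \<open>f\<close> on the members of an equivalence class (or coset) \<open>U\<close>: the map
  induced by \<open>f\<close> on a quotient, whenever \<open>f\<close> is constant on classes.\<close>

definition class_map :: "('a \<Rightarrow> 'b) \<Rightarrow> 'a set \<Rightarrow> 'b" where
  "class_map f U = the_elem (f ` U)"

definition opposite :: "('a, 'm) monoid_scheme \<Rightarrow> ('a, 'm) monoid_scheme" where
  "opposite G = G\<lparr>monoid.mult := (\<lambda>x y. y \<otimes>\<^bsub>G\<^esub> x)\<rparr>"

definition map_group :: "'s set \<Rightarrow> ('b, 'm) monoid_scheme \<Rightarrow> ('s \<Rightarrow> 'b) monoid" where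
  "map_group S A = product_group S (\<lambda>_. A)"

text \<open>The \<open>\<int>\<close>-linear extension of \<open>h\<close> to formal sums, with values in a (multiplicatively
  written) abelian group.\<close>

definition linear_ext :: "('b, 'm) monoid_scheme \<Rightarrow> ('s \<Rightarrow> 'b) \<Rightarrow> ('s \<Rightarrow>\<^sub>0 int) \<Rightarrow> 'b" where
  "linear_ext A h c = (\<Otimes>\<^bsub>A\<^esub>x\<in>Poly_Mapping.keys c. h x [^]\<^bsub>A\<^esub> Poly_Mapping.lookup c x)"

definition abelianization :: "('a, 'm) monoid_scheme \<Rightarrow> 'a set monoid" where
  "abelianization G = G Mod derived G (carrier G)"

definition ab_class :: "('a, 'm) monoid_scheme \<Rightarrow> 'a \<Rightarrow> 'a set" where
  "ab_class G g = derived G (carrier G) #>\<^bsub>G\<^esub> g"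


section \<open>Tensor products and localization of abelian groups\<close>

definition tensor_relations ::
    "('a, 'm) monoid_scheme \<Rightarrow> ('b, 'n) monoid_scheme \<Rightarrow> ('a \<times> 'b \<Rightarrow>\<^sub>0 int) set" where
  "tensor_relations M N = generate (free_Abelian_group (carrier M \<times> carrier N))
     ({frag_of (m \<otimes>\<^bsub>M\<^esub> m', n) - frag_of (m, n) - frag_of (m', n) | m m' n.
         m \<in> carrier M \<and> m' \<in> carrier M \<and> n \<in> carrier N} \<union>
      {frag_of (m, n \<otimes>\<^bsub>N\<^esub> n') - frag_of (m, n) - frag_of (m, n') | m n n'.
         m \<in> carrier M \<and> n \<in> carrier N \<and> n' \<in> carrier N})"

definition tensor_product ::
    "('a, 'm) monoid_scheme \<Rightarrow> ('b, 'n) monoid_scheme \<Rightarrow> ('a \<times> 'b \<Rightarrow>\<^sub>0 int) set monoid" where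
  "tensor_product M N =
     free_Abelian_group (carrier M \<times> carrier N) Mod tensor_relations M N"

text \<open>The homomorphism \<open>f \<otimes> g\<close> into the tensor product of \<open>M'\<close> and \<open>N'\<close>.\<close>

definition tensor_map ::
    "('c, 'm) monoid_scheme \<Rightarrow> ('d, 'n) monoid_scheme \<Rightarrow> ('a \<Rightarrow> 'c) \<Rightarrow> ('b \<Rightarrow> 'd) \<Rightarrow>
     ('a \<times> 'b \<Rightarrow>\<^sub>0 int) set \<Rightarrow> ('c \<times> 'd \<Rightarrow>\<^sub>0 int) set" where
  "tensor_map M' N' f g = class_map (\<lambda>c.
     tensor_relations M' N' #>\<^bsub>free_Abelian_group (carrier M' \<times> carrier N')\<^esub>
       frag_extend (\<lambda>(m, n). frag_of (f m, g n)) c)"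

text \<open>The additive group of \<open>\<int>\<^sub>(\<^sub>l\<^sub>)\<close>, the rationals with denominator prime to \<open>l\<close>
  (\<open>l\<close> a prime).\<close>

definition local_integers :: "nat \<Rightarrow> rat monoid" where
  "local_integers l =
     \<lparr>carrier = {of_int a / of_int b | a b. \<not> int l dvd b}, monoid.mult = (+), one = 0\<rparr>"

definition localization ::
    "nat \<Rightarrow> ('a, 'm) monoid_scheme \<Rightarrow> ('a \<times> rat \<Rightarrow>\<^sub>0 int) set monoid" where
  "localization l M = tensor_product M (local_integers l)"

definition localization_map ::
    "nat \<Rightarrow> ('c, 'm) monoid_scheme \<Rightarrow> ('a \<Rightarrow> 'c) \<Rightarrow>
     ('a \<times> rat \<Rightarrow>\<^sub>0 int) set \<Rightarrow> ('c \<times> rat \<Rightarrow>\<^sub>0 int) set" where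
  "localization_map l M' f = tensor_map M' (local_integers l) f id"


section \<open>Group presentations\<close>

text \<open>A letter \<open>(s, True)\<close> stands for the generator \<open>s\<close>, \<open>(s, False)\<close> for its inverse.\<close>

type_synonym 's word = "('s \<times> bool) list"

definition words :: "'s set \<Rightarrow> 's word set" where
  "words S = lists (S \<times> UNIV)"

text \<open>Equality of words in \<open>\<langle>S | u = v, (u, v) \<in> R\<rangle>\<close>.\<close>

inductive_set presentation_eq :: "'s set \<Rightarrow> ('s word \<times> 's word) set \<Rightarrow> ('s word \<times> 's word) set"
  for S :: "'s set" and R :: "('s word \<times> 's word) set" where
  refl: "w \<in> words S \<Longrightarrow> (w, w) \<in> presentation_eq S R"
| sym: "(v, w) \<in> presentation_eq S R \<Longrightarrow> (w, v) \<in> presentation_eq S R"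
| trans: "(u, v) \<in> presentation_eq S R \<Longrightarrow> (v, w) \<in> presentation_eq S R \<Longrightarrow>
    (u, w) \<in> presentation_eq S R"
| cancel: "u \<in> words S \<Longrightarrow> v \<in> words S \<Longrightarrow> s \<in> S \<Longrightarrow>
    (u @ [(s, b), (s, \<not> b)] @ v, u @ v) \<in> presentation_eq S R"
| relator: "u \<in> words S \<Longrightarrow> v \<in> words S \<Longrightarrow> (p, q) \<in> R \<Longrightarrow> p \<in> words S \<Longrightarrow> q \<in> words S \<Longrightarrow>
    (u @ p @ v, u @ q @ v) \<in> presentation_eq S R"

definition word_class :: "'s set \<Rightarrow> ('s word \<times> 's word) set \<Rightarrow> 's word \<Rightarrow> 's word set" where
  "word_class S R w = presentation_eq S R `` {w}"

definition presented_group :: "'s set \<Rightarrow> ('s word \<times> 's word) set \<Rightarrow> 's word set monoid" where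
  "presented_group S R =
     \<lparr>carrier = words S // presentation_eq S R,
      monoid.mult = (\<lambda>U V. \<Union>u\<in>U. \<Union>v\<in>V. word_class S R (u @ v)),
      one = word_class S R []\<rparr>"

definition word_eval :: "('b, 'm) monoid_scheme \<Rightarrow> ('s \<Rightarrow> 'b) \<Rightarrow> 's word \<Rightarrow> 'b" where
  "word_eval G g w =
     foldr (\<lambda>(s, b) r. (if b then g s else inv\<^bsub>G\<^esub> (g s)) \<otimes>\<^bsub>G\<^esub> r) w \<one>\<^bsub>G\<^esub>"

text \<open>The homomorphism from a presented group to \<open>G\<close> sending each generator \<open>s\<close> to \<open>g s\<close>.\<close>

definition presented_hom :: "('b, 'm) monoid_scheme \<Rightarrow> ('s \<Rightarrow> 'b) \<Rightarrow> 's word set \<Rightarrow> 'b" where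
  "presented_hom G g = class_map (word_eval G g)"


section \<open>Cohomology of cochain complexes\<close>

definition coboundaries :: "(nat \<Rightarrow> ('c, 'm) monoid_scheme) \<Rightarrow> (nat \<Rightarrow> 'c \<Rightarrow> 'c) \<Rightarrow> nat \<Rightarrow> 'c set" where
  "coboundaries C d n = (case n of 0 \<Rightarrow> {\<one>\<^bsub>C 0\<^esub>} | Suc m \<Rightarrow> d m ` carrier (C m))"

definition cohomology :: "(nat \<Rightarrow> ('c, 'm) monoid_scheme) \<Rightarrow> (nat \<Rightarrow> 'c \<Rightarrow> 'c) \<Rightarrow> nat \<Rightarrow> 'c set monoid" where
  "cohomology C d n =
     (C n)\<lparr>carrier := kernel (C n) (C (Suc n)) (d n)\<rparr> Mod coboundaries C d n"

definition cohomology_class ::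
    "(nat \<Rightarrow> ('c, 'm) monoid_scheme) \<Rightarrow> (nat \<Rightarrow> 'c \<Rightarrow> 'c) \<Rightarrow> nat \<Rightarrow> 'c \<Rightarrow> 'c set" where
  "cohomology_class C d n c = coboundaries C d n #>\<^bsub>C n\<^esub> c"


section \<open>Group cohomology with trivial coefficients\<close>

text \<open>Elements of \<open>G\<^sup>n\<close> are lists of length \<open>n\<close>.\<close>

definition tuples :: "'g set \<Rightarrow> nat \<Rightarrow> 'g list set" where
  "tuples S n = {gs. length gs = n \<and> set gs \<subseteq> S}"

definition bar_face :: "('g, 'm) monoid_scheme \<Rightarrow> nat \<Rightarrow> 'g list \<Rightarrow> 'g list" where
  "bar_face G i gs =
     (if i = 0 then tl gs
      else if i = length gs then butlast gs
      else take (i - 1) gs @ [gs ! (i - 1) \<otimes>\<^bsub>G\<^esub> gs ! i] @ drop (i + 1) gs)"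

text \<open>The inhomogeneous bar boundary, with \<open>\<partial>\<^sub>0 = 0\<close>.\<close>

definition bar_boundary :: "('g, 'm) monoid_scheme \<Rightarrow> 'g list \<Rightarrow> ('g list \<Rightarrow>\<^sub>0 int)" where
  "bar_boundary G gs =
     (if gs = [] then 0
      else \<Sum>i\<le>length gs. frag_cmul ((- 1) ^ i) (frag_of (bar_face G i gs)))"

definition bar_cochains ::
    "('g, 'm) monoid_scheme \<Rightarrow> ('b, 'n) monoid_scheme \<Rightarrow> nat \<Rightarrow> ('g list \<Rightarrow> 'b) monoid" where
  "bar_cochains G A n = map_group (tuples (carrier G) n) A"

definition bar_coboundary ::
    "('g, 'm) monoid_scheme \<Rightarrow> ('b, 'n) monoid_scheme \<Rightarrow> nat \<Rightarrow> ('g list \<Rightarrow> 'b) \<Rightarrow> ('g list \<Rightarrow> 'b)" where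
  "bar_coboundary G A n h =
     (\<lambda>a\<in>tuples (carrier G) (Suc n). linear_ext A h (bar_boundary G a))"

definition group_cohomology ::
    "('g, 'm) monoid_scheme \<Rightarrow> ('b, 'n) monoid_scheme \<Rightarrow> nat \<Rightarrow> ('g list \<Rightarrow> 'b) set monoid" where
  "group_cohomology G A n = cohomology (bar_cochains G A) (bar_coboundary G A) n"

text \<open>\<open>K\<^sup>n\<^sup>-\<^sup>1\<close>, understood to be empty for \<open>n = 0\<close>.\<close>

definition pred_tuples :: "'g set \<Rightarrow> nat \<Rightarrow> 'g list set" where
  "pred_tuples K n = (case n of 0 \<Rightarrow> {} | Suc m \<Rightarrow> tuples K m)"

definition rel_cochains ::
    "('g, 'm) monoid_scheme \<Rightarrow> 'g set \<Rightarrow> ('b, 'n) monoid_scheme \<Rightarrow> nat \<Rightarrow>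
     (('g list \<Rightarrow> 'b) \<times> ('g list \<Rightarrow> 'b)) monoid" where
  "rel_cochains G K A n = bar_cochains G A n \<times>\<times> map_group (pred_tuples K n) A"

definition rel_coboundary ::
    "('g, 'm) monoid_scheme \<Rightarrow> 'g set \<Rightarrow> ('b, 'n) monoid_scheme \<Rightarrow> nat \<Rightarrow>
     ('g list \<Rightarrow> 'b) \<times> ('g list \<Rightarrow> 'b) \<Rightarrow> ('g list \<Rightarrow> 'b) \<times> ('g list \<Rightarrow> 'b)" where
  "rel_coboundary G K A n = (\<lambda>(h, k).
     (bar_coboundary G A n h,
      \<lambda>b\<in>tuples K n. h b \<otimes>\<^bsub>A\<^esub> inv\<^bsub>A\<^esub> (linear_ext A k (bar_boundary G b))))"

definition rel_cohomology ::
    "('g, 'm) monoid_scheme \<Rightarrow> 'g set \<Rightarrow> ('b, 'n) monoid_scheme \<Rightarrow> nat \<Rightarrow>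
     (('g list \<Rightarrow> 'b) \<times> ('g list \<Rightarrow> 'b)) set monoid" where
  "rel_cohomology G K A n = cohomology (rel_cochains G K A) (rel_coboundary G K A) n"

text \<open>The maps \<open>H\<^sup>n(K) \<rightarrow> H\<^sup>n\<^sup>+\<^sup>1(G, K) \<rightarrow> H\<^sup>n\<^sup>+\<^sup>1(G)\<close> of the long exact sequence of the pair, induced
  by the inclusion \<open>k \<mapsto> (0, k)\<close> and the projection \<open>(h, k) \<mapsto> h\<close> of cochains.\<close>

definition connecting_map ::
    "('g, 'm) monoid_scheme \<Rightarrow> 'g set \<Rightarrow> ('b, 'n) monoid_scheme \<Rightarrow> nat \<Rightarrow>
     ('g list \<Rightarrow> 'b) set \<Rightarrow> (('g list \<Rightarrow> 'b) \<times> ('g list \<Rightarrow> 'b)) set" where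
  "connecting_map G K A n = class_map (\<lambda>k.
     cohomology_class (rel_cochains G K A) (rel_coboundary G K A) (Suc n)
       (\<one>\<^bsub>bar_cochains G A (Suc n)\<^esub>, k))"

definition rel_to_abs ::
    "('g, 'm) monoid_scheme \<Rightarrow> ('b, 'n) monoid_scheme \<Rightarrow> nat \<Rightarrow>
     (('g list \<Rightarrow> 'b) \<times> ('g list \<Rightarrow> 'b)) set \<Rightarrow> ('g list \<Rightarrow> 'b) set" where
  "rel_to_abs G A n = class_map (\<lambda>(h, k).
     cohomology_class (bar_cochains G A) (bar_coboundary G A) n h)"

text \<open>The map \<open>\<delta>\<^sub>1\<^sup>*\<close> of the 5-term exact sequence of a central extension \<open>\<pi>\<close> of \<open>Q\<close> by a subgroup of
  \<open>G\<close>.  The section \<open>s\<close> is an arbitrary but fixed one; the class does not depend on it.\<close>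

definition transgression ::
    "('g, 'm) monoid_scheme \<Rightarrow> ('q, 'k) monoid_scheme \<Rightarrow> ('g \<Rightarrow> 'q) \<Rightarrow> ('b, 'n) monoid_scheme \<Rightarrow>
     ('g \<Rightarrow> 'b) \<Rightarrow> ('q list \<Rightarrow> 'b) set" where
  "transgression G Q \<pi> A F =
     (let s = inv_into (carrier G) \<pi> in
      cohomology_class (bar_cochains Q A) (bar_coboundary Q A) 2
        (\<lambda>a\<in>tuples (carrier Q) 2.
           F (s (a ! 0) \<otimes>\<^bsub>G\<^esub> s (a ! 1) \<otimes>\<^bsub>G\<^esub> inv\<^bsub>G\<^esub> (s (a ! 0 \<otimes>\<^bsub>Q\<^esub> a ! 1)))))"


section \<open>Quandles\<close>

record 'a quandle_struct = "'a partial_object" +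
  qop :: "['a, 'a] \<Rightarrow> 'a" (infixl \<open>\<triangleright>\<index>\<close> 70)

locale quandle =
  fixes X :: "('a, 'z) quandle_struct_scheme" (structure)
  assumes idem: "a \<in> carrier X \<Longrightarrow> a \<triangleright> a = a"
    and bij: "b \<in> carrier X \<Longrightarrow> bij_betw (\<lambda>x. x \<triangleright> b) (carrier X) (carrier X)"
    and distrib: "\<lbrakk>a \<in> carrier X; b \<in> carrier X; c \<in> carrier X\<rbrakk> \<Longrightarrow>
      (a \<triangleright> b) \<triangleright> c = (a \<triangleright> c) \<triangleright> (b \<triangleright> c)"

definition qinv :: "('a, 'z) quandle_struct_scheme \<Rightarrow> 'a \<Rightarrow> 'a \<Rightarrow> 'a" where
  "qinv X x b = inv_into (carrier X) (\<lambda>y. y \<triangleright>\<^bsub>X\<^esub> b) x"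

definition translation :: "('a, 'z) quandle_struct_scheme \<Rightarrow> 'a \<Rightarrow> 'a \<Rightarrow> 'a" where
  "translation X b = (\<lambda>x\<in>carrier X. x \<triangleright>\<^bsub>X\<^esub> b)"

text \<open>In \<open>BijGroup\<close> the right factor of a product acts first, hence the opposite group.\<close>

definition Inn :: "('a, 'z) quandle_struct_scheme \<Rightarrow> ('a \<Rightarrow> 'a) monoid" where
  "Inn X = subgroup_generated (opposite (BijGroup (carrier X))) (translation X ` carrier X)"

definition connected_quandle :: "('a, 'z) quandle_struct_scheme \<Rightarrow> bool" where
  "connected_quandle X \<longleftrightarrow>
     quandle X \<and> (\<forall>x\<in>carrier X. \<forall>y\<in>carrier X. \<exists>\<sigma>\<in>carrier (Inn X). \<sigma> x = y)"

text \<open>The minimum is over positive \<open>n\<close>.\<close>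

definition quandle_type :: "('a, 'z) quandle_struct_scheme \<Rightarrow> enat" where
  "quandle_type X =
     Inf {enat n | n. 0 < n \<and>
       (\<forall>x\<in>carrier X. \<forall>y\<in>carrier X. ((\<lambda>z. z \<triangleright>\<^bsub>X\<^esub> y) ^^ n) x = x)}"

definition Stab :: "('a, 'z) quandle_struct_scheme \<Rightarrow> 'a \<Rightarrow> ('a \<Rightarrow> 'a) set" where
  "Stab X x0 = {\<sigma> \<in> carrier (Inn X). \<sigma> x0 = x0}"

definition Stab_group :: "('a, 'z) quandle_struct_scheme \<Rightarrow> 'a \<Rightarrow> ('a \<Rightarrow> 'a) monoid" where
  "Stab_group X x0 = (Inn X)\<lparr>carrier := Stab X x0\<rparr>"


subsection \<open>The associated group\<close>

definition As_relators :: "('a, 'z) quandle_struct_scheme \<Rightarrow> ('a word \<times> 'a word) set" where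
  "As_relators X =
     {([(x, True), (y, True)], [(y, True), (x \<triangleright>\<^bsub>X\<^esub> y, True)]) | x y.
        x \<in> carrier X \<and> y \<in> carrier X}"

definition As :: "('a, 'z) quandle_struct_scheme \<Rightarrow> 'a word set monoid" where
  "As X = presented_group (carrier X) (As_relators X)"

definition As_gen :: "('a, 'z) quandle_struct_scheme \<Rightarrow> 'a \<Rightarrow> 'a word set" where
  "As_gen X x = word_class (carrier X) (As_relators X) [(x, True)]"

definition psi :: "('a, 'z) quandle_struct_scheme \<Rightarrow> 'a word set \<Rightarrow> ('a \<Rightarrow> 'a)" where
  "psi X = presented_hom (Inn X) (translation X)"

definition eps :: "'a word set \<Rightarrow> int" where
  "eps = presented_hom integer_group (\<lambda>_. 1)"

text \<open>The action of \<open>As(X)\<close> on \<open>X\<close>, where the generator \<open>e\<^sub>y\<close> sends \<open>x\<close> to \<open>x \<triangleright> y\<close>, is the one through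
  \<open>\<psi>\<close>.\<close>

definition As_Stab_group :: "('a, 'z) quandle_struct_scheme \<Rightarrow> 'a \<Rightarrow> 'a word set monoid" where
  "As_Stab_group X x0 = (As X)\<lparr>carrier := {h \<in> carrier (As X). psi X h x0 = x0}\<rparr>"


subsection \<open>Second quandle cohomology\<close>

definition rack_boundary2 ::
    "('a, 'z) quandle_struct_scheme \<Rightarrow> 'a \<Rightarrow> 'a \<Rightarrow> ('a \<Rightarrow>\<^sub>0 int)" where
  "rack_boundary2 X x y = frag_of x - frag_of (x \<triangleright>\<^bsub>X\<^esub> y)"

definition rack_boundary3 ::
    "('a, 'z) quandle_struct_scheme \<Rightarrow> 'a \<Rightarrow> 'a \<Rightarrow> 'a \<Rightarrow> ('a \<times> 'a \<Rightarrow>\<^sub>0 int)" where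
  "rack_boundary3 X x y z =
     frag_of (x, z) - frag_of (x \<triangleright>\<^bsub>X\<^esub> y, z) - frag_of (x, y)
       + frag_of (x \<triangleright>\<^bsub>X\<^esub> z, y \<triangleright>\<^bsub>X\<^esub> z)"

definition quandle_cocycles2 ::
    "('a, 'z) quandle_struct_scheme \<Rightarrow> ('b, 'n) monoid_scheme \<Rightarrow> ('a \<times> 'a \<Rightarrow> 'b) set" where
  "quandle_cocycles2 X A =
     {f \<in> carrier (map_group (carrier X \<times> carrier X) A).
        (\<forall>a\<in>carrier X. f (a, a) = \<one>\<^bsub>A\<^esub>) \<and>
        (\<forall>x\<in>carrier X. \<forall>y\<in>carrier X. \<forall>z\<in>carrier X.
           linear_ext A f (rack_boundary3 X x y z) = \<one>\<^bsub>A\<^esub>)}"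

definition quandle_coboundaries2 ::
    "('a, 'z) quandle_struct_scheme \<Rightarrow> ('b, 'n) monoid_scheme \<Rightarrow> ('a \<times> 'a \<Rightarrow> 'b) set" where
  "quandle_coboundaries2 X A =
     (\<lambda>g. \<lambda>(x, y)\<in>carrier X \<times> carrier X. linear_ext A g (rack_boundary2 X x y))
       ` carrier (map_group (carrier X) A)"

definition quandle_cohomology2 ::
    "('a, 'z) quandle_struct_scheme \<Rightarrow> ('b, 'n) monoid_scheme \<Rightarrow> ('a \<times> 'a \<Rightarrow> 'b) set monoid" where
  "quandle_cohomology2 X A =
     (map_group (carrier X \<times> carrier X) A)\<lparr>carrier := quandle_cocycles2 X A\<rparr>
       Mod quandle_coboundaries2 X A"


subsection \<open>The projection \<open>\<P>\<close> and Eisermann's isomorphism\<close>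

primrec eisermann_chain ::
    "('a, 'z) quandle_struct_scheme \<Rightarrow> 'a \<Rightarrow> 'a word \<Rightarrow> ('a \<times> 'a \<Rightarrow>\<^sub>0 int)" where
  "eisermann_chain X a [] = 0"
| "eisermann_chain X a (l # w) = (case l of (y, b) \<Rightarrow>
     if b then frag_of (a, y) + eisermann_chain X (a \<triangleright>\<^bsub>X\<^esub> y) w
     else - frag_of (qinv X a y, y) + eisermann_chain X (qinv X a y) w)"

text \<open>The projection \<open>h \<mapsto> h - \<epsilon>(h)[e\<^sub>x\<^sub>0]\<close> of \<open>H\<^sub>1\<close> of the stabilizer in \<open>As(X)\<close> (its abelianization,
  written multiplicatively) onto the kernel of \<open>\<iota>\<^sub>*\<close>.\<close>

definition proj_P :: "('a, 'z) quandle_struct_scheme \<Rightarrow> 'a \<Rightarrow> 'a word set set \<Rightarrow> 'a word set set" where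
  "proj_P X x0 c =
     (let H1 = abelianization (As_Stab_group X x0) in
      c \<otimes>\<^bsub>H1\<^esub> ab_class (As_Stab_group X x0) (As_gen X x0) [^]\<^bsub>H1\<^esub> (- class_map eps c))"

text \<open>The homomorphism on \<open>Ker(\<iota>\<^sub>*)\<close> corresponding to a quandle 2-cocycle \<open>f\<close> under Eisermann's
  isomorphism, i.e. the evaluation of \<open>f\<close> on the chain of any word representing a class.\<close>

definition eisermann_eval ::
    "('a, 'z) quandle_struct_scheme \<Rightarrow> ('b, 'n) monoid_scheme \<Rightarrow> 'a \<Rightarrow>
     ('a \<times> 'a \<Rightarrow> 'b) \<Rightarrow> 'a word set set \<Rightarrow> 'b" where
  "eisermann_eval X A x0 f = class_map (class_map (\<lambda>w. linear_ext A f (eisermann_chain X x0 w)))"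

text \<open>With trivial coefficients \<open>H\<^sup>1(G; A) = Hom(G, A)\<close>; the values of \<open>\<P>\<^sup>*\<close> are homomorphisms.\<close>

definition P_star ::
    "('a, 'z) quandle_struct_scheme \<Rightarrow> ('b, 'n) monoid_scheme \<Rightarrow> 'a \<Rightarrow>
     ('a \<times> 'a \<Rightarrow> 'b) set \<Rightarrow> 'a word set \<Rightarrow> 'b" where
  "P_star X A x0 = class_map (\<lambda>f. \<lambda>h\<in>carrier (As_Stab_group X x0).
     eisermann_eval X A x0 f (proj_P X x0 (ab_class (As_Stab_group X x0) h)))"


subsection \<open>The map \<open>\<T>\<close>\<close>

definition connecting_image ::
    "('a, 'z) quandle_struct_scheme \<Rightarrow> ('b, 'n) monoid_scheme \<Rightarrow> 'a \<Rightarrow>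
     ((('a \<Rightarrow> 'a) list \<Rightarrow> 'b) \<times> (('a \<Rightarrow> 'a) list \<Rightarrow> 'b)) set set" where
  "connecting_image X A x0 =
     connecting_map (Inn X) (Stab X x0) A 1 ` carrier (group_cohomology (Stab_group X x0) A 1)"

definition T_target ::
    "('a, 'z) quandle_struct_scheme \<Rightarrow> ('b, 'n) monoid_scheme \<Rightarrow> 'a \<Rightarrow>
     ((('a \<Rightarrow> 'a) list \<Rightarrow> 'b) \<times> (('a \<Rightarrow> 'a) list \<Rightarrow> 'b)) set set monoid" where
  "T_target X A x0 = rel_cohomology (Inn X) (Stab X x0) A 2 Mod connecting_image X A x0"

text \<open>The preimage under \<open>p\<^sup>*\<close> of a single class is a coset of \<open>Ker(p\<^sup>*)\<close>, which by exactness is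
  \<open>connecting_image\<close>; so this set is an element of \<open>T_target\<close>.\<close>

definition map_T ::
    "('a, 'z) quandle_struct_scheme \<Rightarrow> ('b, 'n) monoid_scheme \<Rightarrow> 'a \<Rightarrow> ('a \<times> 'a \<Rightarrow> 'b) set \<Rightarrow>
     ((('a \<Rightarrow> 'a) list \<Rightarrow> 'b) \<times> (('a \<Rightarrow> 'a) list \<Rightarrow> 'b)) set set" where
  "map_T X A x0 \<phi> =
     {z \<in> carrier (rel_cohomology (Inn X) (Stab X x0) A 2).
        rel_to_abs (Inn X) A 2 z =
          transgression (As X) (Inn X) (psi X) A
            (restrict (P_star X A x0 \<phi>) (kernel (As X) (Inn X) (psi X)))}"

text \<open>When the localization of \<open>H\<^sup>1(Stab(x\<^sub>0); A)\<close> vanishes, the quotient map \<open>q\<close> onto \<open>T_target\<close> becomes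
  an isomorphism after localization; \<open>T_localized\<close> is the localization of \<open>\<T>\<close> followed by the
  inverse of this isomorphism.\<close>

definition T_localized ::
    "nat \<Rightarrow> ('a, 'z) quandle_struct_scheme \<Rightarrow> ('b, 'n) monoid_scheme \<Rightarrow> 'a \<Rightarrow>
     (('a \<times> 'a \<Rightarrow> 'b) set \<times> rat \<Rightarrow>\<^sub>0 int) set \<Rightarrow>
     (((('a \<Rightarrow> 'a) list \<Rightarrow> 'b) \<times> (('a \<Rightarrow> 'a) list \<Rightarrow> 'b)) set \<times> rat \<Rightarrow>\<^sub>0 int) set" where
  "T_localized l X A x0 =
     (let H = rel_cohomology (Inn X) (Stab X x0) A 2;
          q = (\<lambda>z. connecting_image X A x0 #>\<^bsub>H\<^esub> z)
      in inv_into (carrier (localization l H)) (localization_map l (T_target X A x0) q)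
           \<circ> localization_map l (T_target X A x0) (map_T X A x0))"

end

theory Submission
  imports Defs
begin

text \<open>
  Let \<open>S\<close> be the stabilizer of \<open>x0\<close> in \<open>Inn X\<close>, \<open>S'\<close> the one in \<open>As X\<close>, and \<open>t\<close> the type of \<open>X\<close>.
  Sending \<open>\<phi>\<close> to \<open>P_star \<phi>\<close> identifies \<open>H\<^sup>2\<^sub>Q(X; A)\<close> with the homomorphisms \<open>F\<close> from \<open>S'\<close> to \<open>A\<close> that are
  trivial on \<open>e x0\<close>: a cocycle is recovered from \<open>F\<close> by transporting generators to the base point.
  A morphism of abelian groups is an isomorphism after localization as soon as each element of its
  kernel and each class of its cokernel is annihilated by an integer prime to \<open>l\<close>, and for \<open>map_T\<close> this
  follows from the centrality of the \<open>t\<close>-th powers of the generators.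

  Kernel: if the transgression of \<open>F\<close> vanishes, the restriction of \<open>F\<close> to the kernel of \<open>psi\<close> extends
  to \<open>As X\<close>.  The extension takes one and the same value on all generators, and its \<open>t\<close>-th power is
  trivial on them.  So \<open>t F\<close> factors through \<open>S\<close>, and \<open>H\<^sup>1(S; A)\<close> is torsion prime to \<open>l\<close>.

  Cokernel: let \<open>(h, k)\<close> be a relative cocycle and \<open>E\<close> the central extension of \<open>Inn X\<close> by \<open>A\<close> given by
  \<open>t h\<close>.  The commutator of a lift of the translation by \<open>x0\<close> with a lift of an element of \<open>S\<close> is
  \<open>t\<close>-torsion in the extension given by \<open>h\<close>, hence trivial in \<open>E\<close>.  Conjugating one lift therefore
  gives compatible lifts of all translations, that is, a lift of \<open>psi\<close> to a homomorphism from
  \<open>As X\<close> to \<open>E\<close>.  Together with \<open>k\<close> it yields a homomorphism on \<open>S'\<close> whose image is \<open>t\<close> times the class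
  of \<open>(h, k)\<close>.
\<close>

section \<open>Quotients of abelian groups\<close>

text \<open>Eisermann's isomorphism enters in dual form. A quandle cocycle \<open>f\<close> is a
  function on the arrows from \<open>a\<close> to \<open>psi X g a\<close> of the action groupoid of
  \<open>As X\<close> on \<open>X\<close>. Since \<open>X\<close> is connected, such functions
  modulo coboundaries amount to homomorphisms on the one stabilizer at \<open>x0\<close>, and the
  condition on \<open>f (a, a)\<close> becomes triviality on \<open>e x0\<close>. The powers of
  \<open>e x0\<close> by which \<open>proj_P\<close> corrects an element are therefore invisible.

  The working tool is the conjugation rule \<open>As_gen_conj\<close>. It makes the kernel of
  \<open>psi X\<close> central and all generators conjugate, so a homomorphism from
  \<open>As X\<close> to \<open>A\<close> is constant on generators. The \<open>t\<close>-th power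
  of \<open>e x0\<close> acts trivially, hence lies in the kernel of \<open>psi X\<close>, where the
  extension built in the kernel argument agrees with \<open>F\<close>; this is how triviality of
  \<open>F\<close> on \<open>e x0\<close> bounds the common value.

  In the cokernel argument the second component \<open>k\<close> splits \<open>E\<close> over
  \<open>S\<close>. The lift of the translation by \<open>x0\<close> is taken on this splitting, so
  that the resulting homomorphism on \<open>S'\<close> is trivial on \<open>e x0\<close> and thus
  comes from a quandle cocycle.\<close>

lemma (in group) left_cancel:
  "x \<in> carrier G \<Longrightarrow> y \<in> carrier G \<Longrightarrow> z \<in> carrier G \<Longrightarrow> x \<otimes> y = x \<otimes> z \<longleftrightarrow> y = z"
  by (simp add: Units_eq)

lemmas group_hom_iff = group_hom_def group_hom_axioms_def

lemma class_map_eqI: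
  assumes "x \<in> U" "\<And>y. y \<in> U \<Longrightarrow> f y = f x"
  shows "class_map f U = f x"
proof -
  have "f ` U = {f x}" using assms by blast
  then show ?thesis unfolding class_map_def by (metis the_elem_eq)
qed

lemma (in group) rcos_eq_iff:
  assumes "subgroup N G" "x \<in> carrier G" "y \<in> carrier G"
  shows "N #> x = N #> y \<longleftrightarrow> x \<otimes> inv y \<in> N"
proof
  assume "N #> x = N #> y"
  then have "x \<in> N #> y" using rcos_self[OF assms(2,1)] by simp
  then show "x \<otimes> inv y \<in> N"
    using subgroup.rcos_module[OF assms(1) group_axioms assms(3,2)] by simp
next
  assume "x \<otimes> inv y \<in> N"
  then have "x \<in> N #> y"
    using subgroup.rcos_module[OF assms(1) group_axioms assms(3,2)] by simp
  then show "N #> x = N #> y" using repr_independence[OF _ assms(3,1)] by simp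
qed

lemma (in group) class_map_rcos:
  assumes "subgroup N G" "x \<in> carrier G"
    and "\<And>n. n \<in> N \<Longrightarrow> f (n \<otimes> x) = f x"
  shows "class_map f (N #> x) = f x"
  by (rule class_map_eqI[OF rcos_self[OF assms(2,1)]]) (auto simp: r_coset_def assms(3))

lemma (in comm_group) subgroup_comm_group:
  assumes "subgroup H G"
  shows "comm_group (G\<lparr>carrier := H\<rparr>)"
  by (rule group.group_comm_groupI[OF subgroup_imp_group[OF assms]])
     (use assms in \<open>auto intro: m_comm simp: subgroup.mem_carrier\<close>)

lemma (in comm_group) rcos_mult:
  assumes "subgroup N G" "x \<in> carrier G" "y \<in> carrier G"
  shows "(N #> x) \<otimes>\<^bsub>G Mod N\<^esub> (N #> y) = N #> (x \<otimes> y)"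
  using normal.rcos_sum[OF subgroup_imp_normal[OF assms(1)]] assms(2,3) by simp

lemma (in comm_group) rcos_hom:
  assumes "subgroup N G"
  shows "(\<lambda>x. N #> x) \<in> hom G (G Mod N)"
  using normal.r_coset_hom_Mod[OF subgroup_imp_normal[OF assms]] .

text \<open>Commutators die in a commutative target. This is what makes evaluation on classes of the
  abelianization single-valued.\<close>

lemma hom_into_comm_group_derived:
  assumes "group G" "comm_group H" "f \<in> hom G H" "x \<in> derived G (carrier G)"
  shows "f x = \<one>\<^bsub>H\<^esub>"
proof -
  interpret G: group G by fact
  interpret H: comm_group H by fact
  interpret f: group_hom G H f
    using assms by (simp add: group_hom_iff H.is_group)
  have "f (a \<otimes>\<^bsub>G\<^esub> b \<otimes>\<^bsub>G\<^esub> inv\<^bsub>G\<^esub> a \<otimes>\<^bsub>G\<^esub> inv\<^bsub>G\<^esub> b) = \<one>\<^bsub>H\<^esub>"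
    if "a \<in> carrier G" "b \<in> carrier G" for a b
  proof -
    have "f a \<otimes>\<^bsub>H\<^esub> f b \<otimes>\<^bsub>H\<^esub> inv\<^bsub>H\<^esub> (f a) \<otimes>\<^bsub>H\<^esub> inv\<^bsub>H\<^esub> (f b)
        = (f a \<otimes>\<^bsub>H\<^esub> f b) \<otimes>\<^bsub>H\<^esub> inv\<^bsub>H\<^esub> (f a \<otimes>\<^bsub>H\<^esub> f b)"
      using that by (simp add: H.inv_mult H.m_assoc)
    then show ?thesis using that by simp
  qed
  then have "derived_set G (carrier G) \<subseteq> kernel G H f"
    by (auto simp: kernel_def)
  then have "derived G (carrier G) \<subseteq> kernel G H f"
    unfolding derived_def using G.generate_subgroup_incl f.subgroup_kernel by blast
  then show ?thesis using assms(4) by (auto simp: kernel_def)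
qed

section \<open>Linear extension\<close>

abbreviation "keys \<equiv> Poly_Mapping.keys"
abbreviation "lookup \<equiv> Poly_Mapping.lookup"

context comm_group
begin

text \<open>The supports of \<open>c\<close>, \<open>d\<close> and \<open>c + d\<close> differ,
  since coefficients may cancel. Over a common finite superset the products can be compared factor
  by factor; the additional factors are zeroth powers.\<close>

lemma linear_ext_superset:
  assumes "finite S" "keys c \<subseteq> S" "h \<in> S \<rightarrow> carrier G"
  shows "linear_ext G h c = (\<Otimes>x\<in>S. h x [^] lookup c x)"
  unfolding linear_ext_def
  by (rule finprod_mono_neutral_cong_left)
     (use assms in \<open>auto simp: not_in_keys_iff_lookup_eq_zero Pi_iff\<close>)

lemma linear_ext_closed:
  assumes "h \<in> keys c \<rightarrow> carrier G"
  shows "linear_ext G h c \<in> carrier G"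
  unfolding linear_ext_def by (rule finprod_closed) (use assms in auto)

lemma linear_ext_zero [simp]: "linear_ext G h 0 = \<one>"
  by (simp add: linear_ext_def)

lemma linear_ext_of [simp]:
  assumes "h x \<in> carrier G"
  shows "linear_ext G h (frag_of x) = h x"
  unfolding linear_ext_def using assms by (simp add: finprod_singleton)

lemma linear_ext_add:
  assumes "h \<in> keys c \<rightarrow> carrier G" "h \<in> keys d \<rightarrow> carrier G"
  shows "linear_ext G h (c + d) = linear_ext G h c \<otimes> linear_ext G h d"
proof -
  let ?S = "keys c \<union> keys d"
  have h: "h \<in> ?S \<rightarrow> carrier G" using assms by auto
  have k: "keys (c + d) \<subseteq> ?S" by (rule keys_add)
  have "linear_ext G h (c + d) = (\<Otimes>x\<in>?S. h x [^] lookup c x \<otimes> h x [^] lookup d x)"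
    unfolding linear_ext_superset[OF finite_UnI[OF finite_keys finite_keys] k h]
    using h by (intro finprod_cong') (auto simp: lookup_add int_pow_mult Pi_iff)
  also have "\<dots> = (\<Otimes>x\<in>?S. h x [^] lookup c x) \<otimes> (\<Otimes>x\<in>?S. h x [^] lookup d x)"
    using h by (intro finprod_multf) auto
  finally show ?thesis
    using linear_ext_superset[of ?S c h] linear_ext_superset[of ?S d h] h by simp
qed

lemma linear_ext_minus:
  assumes "h \<in> keys c \<rightarrow> carrier G"
  shows "linear_ext G h (- c) = inv (linear_ext G h c)"
proof -
  have "linear_ext G h (c + - c) = linear_ext G h c \<otimes> linear_ext G h (- c)"
    by (rule linear_ext_add) (use assms in \<open>auto simp: keys_minus\<close>)
  then have "linear_ext G h c \<otimes> linear_ext G h (- c) = \<one>" by simp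
  moreover have "linear_ext G h c \<in> carrier G" "linear_ext G h (- c) \<in> carrier G"
    using assms by (auto intro!: linear_ext_closed simp: keys_minus)
  ultimately show ?thesis by (metis inv_equality m_comm)
qed

lemma linear_ext_diff:
  assumes "h \<in> keys c \<rightarrow> carrier G" "h \<in> keys d \<rightarrow> carrier G"
  shows "linear_ext G h (c - d) = linear_ext G h c \<otimes> inv (linear_ext G h d)"
  using linear_ext_add[of h c "- d"] linear_ext_minus[of h d] assms by (simp add: keys_minus)

lemma linear_ext_multf:
  assumes "h \<in> keys c \<rightarrow> carrier G" "k \<in> keys c \<rightarrow> carrier G"
    and "\<And>x. x \<in> keys c \<Longrightarrow> hk x = h x \<otimes> k x"
  shows "linear_ext G hk c = linear_ext G h c \<otimes> linear_ext G k c"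
proof -
  have "linear_ext G hk c = (\<Otimes>x\<in>keys c. h x [^] lookup c x \<otimes> k x [^] lookup c x)"
    unfolding linear_ext_def using assms by (intro finprod_cong') (auto simp: int_pow_distrib Pi_iff)
  also have "\<dots> = linear_ext G h c \<otimes> linear_ext G k c"
    unfolding linear_ext_def using assms by (intro finprod_multf) auto
  finally show ?thesis .
qed

end

section \<open>Tensor products and localization\<close>

definition tens ::
    "('a, 'm) monoid_scheme \<Rightarrow> ('b, 'n) monoid_scheme \<Rightarrow> 'a \<Rightarrow> 'b \<Rightarrow> ('a \<times> 'b \<Rightarrow>\<^sub>0 int) set" where
  "tens M N m n =
     tensor_relations M N #>\<^bsub>free_Abelian_group (carrier M \<times> carrier N)\<^esub> frag_of (m, n)"

definition tensor_generators ::
    "('a, 'm) monoid_scheme \<Rightarrow> ('b, 'n) monoid_scheme \<Rightarrow> ('a \<times> 'b \<Rightarrow>\<^sub>0 int) set" where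
  "tensor_generators M N =
     {frag_of (m \<otimes>\<^bsub>M\<^esub> m', n) - frag_of (m, n) - frag_of (m', n) | m m' n.
         m \<in> carrier M \<and> m' \<in> carrier M \<and> n \<in> carrier N} \<union>
      {frag_of (m, n \<otimes>\<^bsub>N\<^esub> n') - frag_of (m, n) - frag_of (m, n') | m n n'.
         m \<in> carrier M \<and> n \<in> carrier N \<and> n' \<in> carrier N}"

lemma keys_frag3:
  assumes "a \<in> S" "b \<in> S" "c \<in> S"
  shows "keys (frag_of a - frag_of b - frag_of c) \<subseteq> S"
  using keys_diff[of "frag_of a - frag_of b" "frag_of c"] keys_diff[of "frag_of a" "frag_of b"] assms
  by (auto simp: keys_frag_of)

locale comm_group_pair = M: comm_group M + N: comm_group N
  for M :: "('a, 'm) monoid_scheme" and N :: "('b, 'n) monoid_scheme"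
begin

abbreviation "F \<equiv> free_Abelian_group (carrier M \<times> carrier N)"

sublocale F: comm_group F by (rule abelian_free_Abelian_group)

lemma tensor_generators_cases:
  assumes "c \<in> tensor_generators M N"
  obtains m m' n where "c = frag_of (m \<otimes>\<^bsub>M\<^esub> m', n) - frag_of (m, n) - frag_of (m', n)"
      "m \<in> carrier M" "m' \<in> carrier M" "n \<in> carrier N"
    | m n n' where "c = frag_of (m, n \<otimes>\<^bsub>N\<^esub> n') - frag_of (m, n) - frag_of (m, n')"
      "m \<in> carrier M" "n \<in> carrier N" "n' \<in> carrier N"
  using assms unfolding tensor_generators_def by blast

lemma tensor_generators_subset: "tensor_generators M N \<subseteq> carrier F"
proof
  fix c assume "c \<in> tensor_generators M N"
  then show "c \<in> carrier F" by (cases rule: tensor_generators_cases) (simp_all add: keys_frag3)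
qed

lemma tensor_relations_eq: "tensor_relations M N = generate F (tensor_generators M N)"
  by (simp add: tensor_relations_def tensor_generators_def)

lemma subgroup_tensor_relations: "subgroup (tensor_relations M N) F"
  unfolding tensor_relations_eq by (rule F.generate_is_subgroup[OF tensor_generators_subset])

lemma tensor_relations_induct [consumes 1]:
  assumes "c \<in> tensor_relations M N" "\<And>c. c \<in> tensor_generators M N \<Longrightarrow> P c"
    "P 0" "\<And>c. keys c \<subseteq> carrier M \<times> carrier N \<Longrightarrow> P c \<Longrightarrow> P (- c)"
    "\<And>c d. keys c \<subseteq> carrier M \<times> carrier N \<Longrightarrow> keys d \<subseteq> carrier M \<times> carrier N \<Longrightarrow> P c \<Longrightarrow> P d \<Longrightarrow> P (c + d)"
  shows "P c"
proof -
  have "subgroup {c \<in> carrier F. P c} F"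
    by (rule F.subgroupI) (use assms(3-) in \<open>auto dest: subsetD[OF keys_add] simp: keys_minus\<close>)
  then have "tensor_relations M N \<subseteq> {c \<in> carrier F. P c}"
    unfolding tensor_relations_eq
    using F.generate_subgroup_incl tensor_generators_subset assms(2) by (smt (verit) mem_Collect_eq subsetD subsetI)
  then show ?thesis using assms(1) by auto
qed

sublocale T: comm_group "tensor_product M N"
  unfolding tensor_product_def by (rule F.abelian_FactGroup[OF subgroup_tensor_relations])

abbreviation "T \<equiv> tensor_product M N"
abbreviation "q c \<equiv> tensor_relations M N #>\<^bsub>F\<^esub> c"

lemma carrier_tensor_product:
  "carrier T = q ` carrier F"
  by (simp add: tensor_product_def carrier_FactGroup)

lemma tens_closed [simp]: "m \<in> carrier M \<Longrightarrow> n \<in> carrier N \<Longrightarrow> tens M N m n \<in> carrier T"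
  by (auto simp: carrier_tensor_product tens_def)

lemma tensor_eq_iff:
  assumes "c \<in> carrier F" "d \<in> carrier F"
  shows "q c = q d \<longleftrightarrow> c - d \<in> tensor_relations M N"
  using F.rcos_eq_iff[OF subgroup_tensor_relations assms] assms(2) by simp

lemma tensor_rcos_add:
  assumes "c \<in> carrier F" "d \<in> carrier F"
  shows "q (c + d) =
    (q c) \<otimes>\<^bsub>T\<^esub> (q d)"
  unfolding tensor_product_def F.rcos_mult[OF subgroup_tensor_relations assms] by simp

lemma tens_mult_left:
  assumes "m \<in> carrier M" "m' \<in> carrier M" "n \<in> carrier N"
  shows "tens M N (m \<otimes>\<^bsub>M\<^esub> m') n = tens M N m n \<otimes>\<^bsub>T\<^esub> tens M N m' n"
proof -
  have "frag_of (m \<otimes>\<^bsub>M\<^esub> m', n) - (frag_of (m, n) + frag_of (m', n)) \<in> tensor_relations M N"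
    unfolding tensor_relations_eq
    by (rule generate.incl) (use assms in \<open>auto simp: tensor_generators_def algebra_simps\<close>)
  then have "q (frag_of (m \<otimes>\<^bsub>M\<^esub> m', n)) =
      q (frag_of (m, n) + frag_of (m', n))"
    using assms keys_add[of "frag_of (m, n) :: _ \<Rightarrow>\<^sub>0 int" "frag_of (m', n)"]
    by (subst tensor_eq_iff) (auto simp: keys_frag_of)
  then show ?thesis using assms by (simp add: tens_def tensor_rcos_add)
qed

lemma tens_mult_right:
  assumes "m \<in> carrier M" "n \<in> carrier N" "n' \<in> carrier N"
  shows "tens M N m (n \<otimes>\<^bsub>N\<^esub> n') = tens M N m n \<otimes>\<^bsub>T\<^esub> tens M N m n'"
proof -
  have "frag_of (m, n \<otimes>\<^bsub>N\<^esub> n') - (frag_of (m, n) + frag_of (m, n')) \<in> tensor_relations M N"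
    unfolding tensor_relations_eq
    by (rule generate.incl) (use assms in \<open>auto simp: tensor_generators_def algebra_simps\<close>)
  then have "q (frag_of (m, n \<otimes>\<^bsub>N\<^esub> n')) =
      q (frag_of (m, n) + frag_of (m, n'))"
    using assms keys_add[of "frag_of (m, n) :: _ \<Rightarrow>\<^sub>0 int" "frag_of (m, n')"]
    by (subst tensor_eq_iff) (auto simp: keys_frag_of)
  then show ?thesis using assms by (simp add: tens_def tensor_rcos_add)
qed

lemma tens_hom_left: "n \<in> carrier N \<Longrightarrow> (\<lambda>m. tens M N m n) \<in> hom M (tensor_product M N)"
  by (rule homI) (auto simp: tens_mult_left)

lemma tens_hom_right: "m \<in> carrier M \<Longrightarrow> (\<lambda>n. tens M N m n) \<in> hom N (tensor_product M N)"
  by (rule homI) (auto simp: tens_mult_right)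

lemma tens_pow_left:
  assumes "m \<in> carrier M" "n \<in> carrier N"
  shows "tens M N (m [^]\<^bsub>M\<^esub> (k::int)) n = tens M N m n [^]\<^bsub>T\<^esub> k"
  using hom_int_pow[OF tens_hom_left[OF assms(2)] assms(1) M.is_group T.is_group] .

lemma tens_pow_right:
  assumes "m \<in> carrier M" "n \<in> carrier N"
  shows "tens M N m (n [^]\<^bsub>N\<^esub> (k::int)) = tens M N m n [^]\<^bsub>T\<^esub> k"
  using hom_int_pow[OF tens_hom_right[OF assms(1)] assms(2) N.is_group T.is_group] .

lemma tens_one_left: "n \<in> carrier N \<Longrightarrow> tens M N \<one>\<^bsub>M\<^esub> n = \<one>\<^bsub>T\<^esub>"
  using hom_one[OF tens_hom_left M.is_group T.is_group] .

text \<open>Closure under \<open>x \<otimes> inv y\<close> matches the induction rule for free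
  abelian groups, which proceeds by differences; the pure tensors are the classes of its
  generators.\<close>

lemma tensor_induct [consumes 1]:
  assumes "x \<in> carrier T"
    and "\<And>m n. m \<in> carrier M \<Longrightarrow> n \<in> carrier N \<Longrightarrow> P (tens M N m n)"
    and "P \<one>\<^bsub>T\<^esub>"
    and "\<And>x y. x \<in> carrier T \<Longrightarrow> y \<in> carrier T \<Longrightarrow>
      P x \<Longrightarrow> P y \<Longrightarrow> P (x \<otimes>\<^bsub>T\<^esub> inv\<^bsub>T\<^esub> y)"
  shows "P x"
proof -
  obtain c where c: "c \<in> carrier F" "x = q c" using assms(1) by (auto simp: carrier_tensor_product)
  interpret qh: group_hom F T q
    unfolding tensor_product_def
    by (simp add: F.is_group F.rcos_hom[OF subgroup_tensor_relations] group_hom_iff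
        T.is_group[unfolded tensor_product_def])
  from c(1) have "P (q c)" unfolding carrier_free_Abelian_group_iff
  proof (induction c rule: free_Abelian_group_induct[consumes 1, case_names 1 2 3])
    case 1 then show ?case using assms(3) qh.hom_one by simp
  next
    case (2 c d)
    then have cd: "c \<in> carrier F" "d \<in> carrier F" by simp_all
    have "q (c - d) = q (c \<otimes>\<^bsub>F\<^esub> inv\<^bsub>F\<^esub> d)" using 2 by simp
    also have "\<dots> = q c \<otimes>\<^bsub>T\<^esub> inv\<^bsub>T\<^esub> (q d)"
      using cd by (simp only: qh.hom_mult qh.hom_inv F.inv_closed)
    finally show ?case using assms(4)[of "q c" "q d"] 2 cd qh.hom_closed by simp
  next
    case (3 a) then show ?case using assms(2) by (cases a) (auto simp: tens_def)
  qed
  then show ?thesis using c(2) by simp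
qed

end

text \<open>Additivity of \<open>f\<close> and \<open>g\<close> sends each defining relation to one
  of the same shape. This is the well-definedness behind \<open>tensor_map\<close>.\<close>

lemma frag_extend_tensor_relations:
  assumes "comm_group M" "comm_group N" "comm_group M'" "comm_group N'"
    and f: "f \<in> hom M M'" and g: "g \<in> hom N N'" and c: "c \<in> tensor_relations M N"
  shows "frag_extend (\<lambda>(m, n). frag_of (f m, g n)) c \<in> tensor_relations M' N'"
proof -
  interpret P: comm_group_pair M N using assms by (simp add: comm_group_pair_def)
  interpret P': comm_group_pair M' N' using assms by (simp add: comm_group_pair_def)
  let ?e = "frag_extend (\<lambda>(m, n). frag_of (f m, g n)) :: _ \<Rightarrow> (_ \<Rightarrow>\<^sub>0 int)"
  note R' = P'.subgroup_tensor_relations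
  have fg: "f m \<in> carrier M'" "g n \<in> carrier N'" if "m \<in> carrier M" "n \<in> carrier N" for m n
    using f g that by (auto simp: hom_def)
  from c show ?thesis
  proof (induction c rule: P.tensor_relations_induct)
    case (1 c)
    then have "?e c \<in> tensor_generators M' N'"
    proof (cases rule: P.tensor_generators_cases)
      case (1 m m' n)
      then have "?e c = frag_of (f m \<otimes>\<^bsub>M'\<^esub> f m', g n) - frag_of (f m, g n) - frag_of (f m', g n)"
        by (simp add: frag_extend_diff hom_mult[OF f])
      then show ?thesis unfolding tensor_generators_def using 1 fg by blast
    next
      case (2 m n n')
      then have "?e c = frag_of (f m, g n \<otimes>\<^bsub>N'\<^esub> g n') - frag_of (f m, g n) - frag_of (f m, g n')"
        by (simp add: frag_extend_diff hom_mult[OF g])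
      then show ?thesis unfolding tensor_generators_def using 2 fg by blast
    qed
    then show ?case unfolding P'.tensor_relations_eq by (rule generate.incl)
  next
    case 2 then show ?case using subgroup.one_closed[OF R'] by simp
  next
    case (3 c)
    then show ?case using subgroup.m_inv_closed[OF R' 3(2)] subgroup.mem_carrier[OF R' 3(2)]
      by (simp add: frag_extend_minus)
  next
    case (4 c d)
    then show ?case using subgroup.m_closed[OF R' 4(3,4)] by (simp add: frag_extend_add)
  qed
qed

lemma
  assumes M: "comm_group M" and N: "comm_group N" and M': "comm_group M'" and N': "comm_group N'"
    and f: "f \<in> hom M M'" and g: "g \<in> hom N N'"
  shows tensor_map_hom: "tensor_map M' N' f g \<in> hom (tensor_product M N) (tensor_product M' N')"
    and tensor_map_tens: "\<And>m n. m \<in> carrier M \<Longrightarrow> n \<in> carrier N \<Longrightarrow>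
      tensor_map M' N' f g (tens M N m n) = tens M' N' (f m) (g n)"
proof -
  interpret P: comm_group_pair M N using M N by (simp add: comm_group_pair_def)
  interpret P': comm_group_pair M' N' using M' N' by (simp add: comm_group_pair_def)
  let ?e = "frag_extend (\<lambda>(m, n). frag_of (f m, g n)) :: _ \<Rightarrow> (_ \<Rightarrow>\<^sub>0 int)"
  let ?q = "\<lambda>c. tensor_relations M N #>\<^bsub>P.F\<^esub> c"
  let ?q' = "\<lambda>c. tensor_relations M' N' #>\<^bsub>P'.F\<^esub> c"
  have fg: "f m \<in> carrier M'" "g n \<in> carrier N'" if "m \<in> carrier M" "n \<in> carrier N" for m n
    using f g that by (auto simp: hom_def)
  have e: "?e c \<in> carrier P'.F" if "c \<in> carrier P.F" for c
  proof -
    have "keys (case x of (m, n) \<Rightarrow> frag_of (f m, g n)) \<subseteq> carrier M' \<times> carrier N'"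
      if "x \<in> keys c" for x
      using that \<open>c \<in> carrier P.F\<close> fg by (cases x) (auto simp: keys_frag_of)
    then show ?thesis
      using keys_frag_extend[of "\<lambda>(m, n). frag_of (f m, g n)" c]
      unfolding carrier_free_Abelian_group_iff by blast
  qed
  have map: "tensor_map M' N' f g (?q c) = ?q' (?e c)" if c: "c \<in> carrier P.F" for c
    unfolding tensor_map_def
  proof (rule P.F.class_map_rcos[OF P.subgroup_tensor_relations c])
    fix n assume n: "n \<in> tensor_relations M N"
    have nF: "n \<in> carrier P.F" using subgroup.mem_carrier[OF P.subgroup_tensor_relations n] .
    have eq: "?e (n \<otimes>\<^bsub>P.F\<^esub> c) - ?e c = ?e n" by (simp add: frag_extend_add)
    have "?e n \<in> tensor_relations M' N'"
      by (rule frag_extend_tensor_relations[OF M N M' N' f g n])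
    then show "?q' (?e (n \<otimes>\<^bsub>P.F\<^esub> c)) = ?q' (?e c)"
      using P'.tensor_eq_iff[OF e[OF P.F.m_closed[OF nF c]] e[OF c]] eq by simp
  qed
  show "tensor_map M' N' f g (tens M N m n) = tens M' N' (f m) (g n)"
    if "m \<in> carrier M" "n \<in> carrier N" for m n
    unfolding tens_def using that by (subst map) auto
  show "tensor_map M' N' f g \<in> hom (tensor_product M N) (tensor_product M' N')"
  proof (rule homI)
    fix x assume "x \<in> carrier (tensor_product M N)"
    then obtain c where c: "c \<in> carrier P.F" "x = ?q c" by (auto simp: P.carrier_tensor_product)
    then show "tensor_map M' N' f g x \<in> carrier (tensor_product M' N')"
      using map e[OF c(1)] unfolding P'.carrier_tensor_product by blast
    fix y assume "y \<in> carrier (tensor_product M N)"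
    then obtain d where d: "d \<in> carrier P.F" "y = ?q d" by (auto simp: P.carrier_tensor_product)
    have cd: "c + d \<in> carrier P.F" using P.F.m_closed[OF c(1) d(1)] by simp
    have "tensor_map M' N' f g (x \<otimes>\<^bsub>tensor_product M N\<^esub> y) = tensor_map M' N' f g (?q (c + d))"
      using P.tensor_rcos_add[OF c(1) d(1)] c d by simp
    also have "\<dots> = ?q' (?e c + ?e d)" using map[OF cd] by (simp add: frag_extend_add)
    also have "\<dots> = tensor_map M' N' f g x \<otimes>\<^bsub>tensor_product M' N'\<^esub> tensor_map M' N' f g y"
      using P'.tensor_rcos_add[OF e[OF c(1)] e[OF d(1)]] map[OF c(1)] map[OF d(1)] c(2) d(2) by simp
    finally show "tensor_map M' N' f g (x \<otimes>\<^bsub>tensor_product M N\<^esub> y) = \<dots>" .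
  qed
qed

lemma local_integers_comm_group:
  assumes "prime l"
  shows "comm_group (local_integers l)"
proof (rule comm_groupI)
  have mem: "x \<in> carrier (local_integers l) \<longleftrightarrow> (\<exists>a b. x = of_int a / of_int b \<and> \<not> int l dvd b)" for x
    by (simp add: local_integers_def)
  fix x y assume x: "x \<in> carrier (local_integers l)"
  then obtain a b where ab: "x = of_int a / of_int b" "\<not> int l dvd b" unfolding mem by blast
  then show "\<exists>y\<in>carrier (local_integers l). y \<otimes>\<^bsub>local_integers l\<^esub> x = \<one>\<^bsub>local_integers l\<^esub>"
    by (intro bexI[of _ "of_int (- a) / of_int b"]) (simp add: local_integers_def, unfold mem, blast)
  assume "y \<in> carrier (local_integers l)"
  then obtain c d where cd: "y = of_int c / of_int d" "\<not> int l dvd d" unfolding mem by blast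
  have "b \<noteq> 0" "d \<noteq> 0" using ab cd by auto
  then have "x + y = of_int (a * d + c * b) / of_int (b * d)" using ab cd by (simp add: field_simps)
  moreover have "\<not> int l dvd b * d" using ab cd assms by (simp add: prime_dvd_mult_iff)
  ultimately have "x + y \<in> carrier (local_integers l)" unfolding mem by blast
  then show "x \<otimes>\<^bsub>local_integers l\<^esub> y \<in> carrier (local_integers l)" by (simp add: local_integers_def)
next
  have "\<not> int l dvd 1" using assms by auto
  then have "\<exists>a b. 0 = rat_of_int a / rat_of_int b \<and> \<not> int l dvd b"
    by (intro exI[of _ 0] exI[of _ 1]) simp
  then show "\<one>\<^bsub>local_integers l\<^esub> \<in> carrier (local_integers l)"
    by (simp add: local_integers_def)
qed (simp_all add: local_integers_def)

section \<open>Localization at a prime as a group of fractions\<close>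

locale localized_group = comm_group M for M :: "('a, 'm) monoid_scheme" (structure) +
  fixes l :: nat
  assumes prime_l: "prime l"
begin

abbreviation "Z \<equiv> local_integers l"

sublocale Z: comm_group Z using local_integers_comm_group[OF prime_l] .

sublocale P: comm_group_pair M Z ..

lemma Z_pow: "x [^]\<^bsub>Z\<^esub> (k::int) = of_int k * x" if "x \<in> carrier Z"
proof -
  have n: "x [^]\<^bsub>Z\<^esub> (n::nat) = of_nat n * x" for n
    by (induction n) (simp_all add: local_integers_def algebra_simps)
  have "y = - x" if "y \<otimes>\<^bsub>Z\<^esub> x = \<one>\<^bsub>Z\<^esub>" for x y
    using that by (simp add: local_integers_def)
  then have i: "inv\<^bsub>Z\<^esub> y = - y" if "y \<in> carrier Z" for y
    using Z.l_inv[OF that] by simp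
  have "of_nat n * x \<in> carrier Z" for n using Z.nat_pow_closed[OF that] n by metis
  then have "inv\<^bsub>Z\<^esub> (of_nat n * x) = - (of_nat n * x)" for n using i by blast
  from this[of "nat (- k)"] show ?thesis unfolding int_pow_def2 n by auto
qed

lemma Z_inverse [simp]: "\<not> int l dvd b \<Longrightarrow> 1 / of_int b \<in> carrier Z"
proof -
  assume "\<not> int l dvd b"
  moreover have "1 / rat_of_int b = of_int 1 / of_int b" by simp
  ultimately show ?thesis unfolding local_integers_def partial_object.simps by blast
qed

lemma not_dvd_mult: "\<not> int l dvd a \<Longrightarrow> \<not> int l dvd b \<Longrightarrow> \<not> int l dvd a * b"
  using prime_l by (simp add: prime_dvd_mult_iff)

text \<open>In additive notation this expands a fraction, m/b = (k m)/(b k): bilinearity moves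
  \<open>k\<close> from the left factor to the right one, where it cancels.\<close>

lemma tens_expand:
  assumes "m \<in> carrier M" "\<not> int l dvd b" "\<not> int l dvd k"
  shows "tens M Z (m [^] k) (1 / of_int (b * k)) = tens M Z m (1 / of_int b)"
proof -
  have bk: "1 / rat_of_int (b * k) \<in> carrier Z" using assms not_dvd_mult Z_inverse by blast
  have "k \<noteq> 0" using assms by auto
  then have "(1 / of_int (b * k)) [^]\<^bsub>Z\<^esub> k = 1 / rat_of_int b"
    unfolding Z_pow[OF bk] by (simp add: field_simps)
  then show ?thesis
    using P.tens_pow_left[OF assms(1) bk, of k] P.tens_pow_right[OF assms(1) bk, of k] by simp
qed

text \<open>Numerators move into \<open>M\<close>, so a pure tensor is a fraction m/b, and a
  difference of fractions is brought to the common denominator \<open>b * b'\<close>. Primality of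
  \<open>l\<close> keeps that denominator admissible.\<close>

lemma localization_rep:
  assumes "x \<in> carrier (localization l M)"
  obtains m b where "m \<in> carrier M" "\<not> int l dvd b" "x = tens M Z m (1 / of_int b)"
proof -
  have "\<exists>m b. m \<in> carrier M \<and> \<not> int l dvd b \<and> x = tens M Z m (1 / of_int b)"
    using assms unfolding localization_def
  proof (induction x rule: P.tensor_induct)
    case (1 m q)
    obtain a b where q: "q = of_int a / of_int b" "\<not> int l dvd b"
      using 1(2) by (auto simp: local_integers_def)
    have "tens M Z m q = tens M Z (m [^] a) (1 / of_int b)"
      using P.tens_pow_left[OF 1(1) Z_inverse[OF q(2)], of a] P.tens_pow_right[OF 1(1) Z_inverse[OF q(2)], of a]
      by (simp add: q Z_pow[OF Z_inverse[OF q(2)]])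
    then show ?case using q 1 by blast
  next
    case 2
    have "\<not> int l dvd 1" using prime_l by auto
    then show ?case using P.tens_one_left[OF Z_inverse] by (metis one_closed)
  next
    case (3 x y)
    then obtain m b m' b' where *: "m \<in> carrier M" "\<not> int l dvd b" "x = tens M Z m (1 / of_int b)"
      "m' \<in> carrier M" "\<not> int l dvd b'" "y = tens M Z m' (1 / of_int b')" by blast
    let ?d = "1 / rat_of_int (b * b')"
    have bb: "\<not> int l dvd b * b'" "?d \<in> carrier Z" using * not_dvd_mult Z_inverse by blast+
    interpret t: group_hom M "tensor_product M Z" "\<lambda>m. tens M Z m ?d"
      by (simp add: group_hom_iff is_group P.T.is_group P.tens_hom_left[OF bb(2)] del: of_int_mult)
    have "x = tens M Z (m [^] b') ?d" using tens_expand[of m b b'] * by simp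
    moreover have "y = tens M Z (m' [^] b) ?d" using tens_expand[of m' b' b] * by (simp add: mult.commute)
    ultimately have "x \<otimes>\<^bsub>tensor_product M Z\<^esub> inv\<^bsub>tensor_product M Z\<^esub> y
        = tens M Z (m [^] b' \<otimes> inv (m' [^] b)) ?d"
      using * by (simp only: t.hom_mult t.hom_inv int_pow_closed inv_closed)
    then show ?case using bb * by (metis int_pow_closed inv_closed m_closed)
  qed
  then show ?thesis using that by blast
qed

text \<open>Clearing denominators: for each sufficiently divisible \<open>n\<close>, the map taking \<open>(m, q)\<close> to
  \<open>m [^] (n q)\<close> respects the relations of the tensor product; the floor is harmless there.\<close>

lemma cleared_relation:
  assumes "c \<in> tensor_relations M Z"
  shows "\<exists>n0. \<not> int l dvd n0 \<and>
    (\<forall>n. n0 dvd n \<longrightarrow> linear_ext M (\<lambda>(m, q). m [^] \<lfloor>rat_of_int n * q\<rfloor>) c = \<one>)"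
proof -
  let ?h = "\<lambda>n (m, q). m [^] \<lfloor>rat_of_int n * q\<rfloor>"
  have l1: "\<not> int l dvd 1" using prime_l by auto
  have h: "?h n \<in> keys c \<rightarrow> carrier M"
    if "keys c \<subseteq> carrier M \<times> carrier Z" for c :: "'a \<times> rat \<Rightarrow>\<^sub>0 int" and n
    using that by auto
  have d3: "linear_ext M (?h n) (frag_of x - frag_of y - frag_of z) = ?h n x \<otimes> inv (?h n y) \<otimes> inv (?h n z)"
    if "x \<in> carrier M \<times> carrier Z" "y \<in> carrier M \<times> carrier Z" "z \<in> carrier M \<times> carrier Z" for x y z n
  proof -
    have k: "keys (frag_of x - frag_of y) \<subseteq> carrier M \<times> carrier Z"
      using keys_diff[of "frag_of x" "frag_of y"] that by (auto simp: keys_frag_of)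
    have c: "?h n x \<in> carrier M" "?h n y \<in> carrier M" "?h n z \<in> carrier M" using that by auto
    show ?thesis
      using linear_ext_diff[OF h[OF k, of n], where d = "frag_of z"] linear_ext_diff[of "?h n" "frag_of x" "frag_of y"] c
      by (simp add: keys_frag_of)
  qed
  from assms show ?thesis
  proof (induction c rule: P.tensor_relations_induct)
    case (1 c)
    then show ?case
    proof (cases rule: P.tensor_generators_cases)
      case (1 m m' q)
      have "linear_ext M (?h n) c = \<one>" for n
        using 1 by (simp add: d3 int_pow_distrib inv_mult m_ac r_inv)
      then show ?thesis using l1 by blast
    next
      case (2 m q q')
      obtain a b a' b' where q: "q = of_int a / of_int b" "\<not> int l dvd b"
          "q' = of_int a' / of_int b'" "\<not> int l dvd b'"
        using 2(3,4) by (auto simp: local_integers_def)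
      then have nz: "b \<noteq> 0" "b' \<noteq> 0" by auto
      have "linear_ext M (?h n) c = \<one>" if "b * b' dvd n" for n
      proof -
        obtain j where n: "n = b * b' * j" using \<open>b * b' dvd n\<close> by (auto elim: dvdE)
        have "of_int n * q = of_int (a * b' * j)" "of_int n * q' = of_int (a' * b * j)"
          "of_int n * (q \<otimes>\<^bsub>Z\<^esub> q') = of_int (a * b' * j + a' * b * j)"
          using nz by (simp_all add: n q local_integers_def field_simps)
        then have "\<lfloor>of_int n * q\<rfloor> = a * b' * j" "\<lfloor>of_int n * q'\<rfloor> = a' * b * j"
          "\<lfloor>of_int n * (q \<otimes>\<^bsub>Z\<^esub> q')\<rfloor> = a * b' * j + a' * b * j"
          by (metis floor_of_int)+
        then show ?thesis
          using 2 by (simp add: d3 int_pow_mult inv_mult m_ac)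
      qed
      then show ?thesis using not_dvd_mult[OF q(2,4)] by blast
    qed
  next
    case 2 then show ?case using l1 by (intro exI[of _ 1]) simp
  next
    case (3 c) then show ?case by (auto simp: linear_ext_minus[OF h[OF 3(1)]])
  next
    case (4 c d)
    then obtain n0 n1 where "\<not> int l dvd n0" "\<not> int l dvd n1"
      "\<And>n. n0 dvd n \<Longrightarrow> linear_ext M (?h n) c = \<one>"
      "\<And>n. n1 dvd n \<Longrightarrow> linear_ext M (?h n) d = \<one>" by blast
    note n01 = this
    have "linear_ext M (?h n) (c + d) = \<one>" if "n0 * n1 dvd n" for n
      using n01(3)[of n] n01(4)[of n] dvd_mult_left[OF that] dvd_mult_right[OF that]
      by (simp add: linear_ext_add[OF h[OF 4(1)] h[OF 4(2)]])
    then show ?case using not_dvd_mult[OF n01(1,2)] by blast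
  qed
qed

text \<open>If \<open>k\<close> kills \<open>m\<close>, expanding m/b by \<open>k\<close> gives
  zero. Conversely, if m/b vanishes, its generator is itself a relation, and the functional of
  \<open>cleared_relation\<close> reads off a trivial power of \<open>m\<close> from it.\<close>

lemma tens_eq_one_iff:
  assumes m: "m \<in> carrier M" and b: "\<not> int l dvd b"
  shows "tens M Z m (1 / of_int b) = \<one>\<^bsub>localization l M\<^esub> \<longleftrightarrow> (\<exists>k. \<not> int l dvd k \<and> m [^] k = \<one>)"
proof
  assume "\<exists>k. \<not> int l dvd k \<and> m [^] k = \<one>"
  then obtain k where k: "\<not> int l dvd k" "m [^] k = \<one>" by blast
  then show "tens M Z m (1 / of_int b) = \<one>\<^bsub>localization l M\<^esub>"
    using tens_expand[OF m b k(1)] P.tens_one_left[OF Z_inverse[OF not_dvd_mult[OF b k(1)]]]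
    by (simp add: localization_def)
next
  assume *: "tens M Z m (1 / of_int b) = \<one>\<^bsub>localization l M\<^esub>"
  let ?q = "1 / rat_of_int b"
  let ?h = "\<lambda>n (m, q). m [^] \<lfloor>rat_of_int n * q\<rfloor>"
  have mF: "frag_of (m, ?q) \<in> carrier P.F" using m Z_inverse[OF b] by simp
  have "tensor_relations M Z #>\<^bsub>P.F\<^esub> frag_of (m, ?q) = tensor_relations M Z #>\<^bsub>P.F\<^esub> \<one>\<^bsub>P.F\<^esub>"
    using * P.F.coset_mult_one[OF subgroup.subset[OF P.subgroup_tensor_relations]]
    by (simp add: tens_def localization_def tensor_product_def)
  then have "frag_of (m, ?q) \<in> tensor_relations M Z"
    using P.tensor_eq_iff[OF mF P.F.one_closed] by simp
  then have "\<exists>n0. \<not> int l dvd n0 \<and> (\<forall>n. n0 dvd n \<longrightarrow> linear_ext M (?h n) (frag_of (m, ?q)) = \<one>)"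
    by (rule cleared_relation)
  then obtain k where k: "\<not> int l dvd k" "\<And>n. k dvd n \<Longrightarrow> linear_ext M (?h n) (frag_of (m, ?q)) = \<one>" by blast
  have "b \<noteq> 0" using b by auto
  \<comment> \<open>For \<open>n = k * b\<close> the product \<open>n * (1 / b)\<close> is
    \<open>k\<close>, so the functional returns \<open>m [^] k\<close>.\<close>
  then have "m [^] k = \<one>" using k(2)[of "k * b"] m by simp
  then show "\<exists>k. \<not> int l dvd k \<and> m [^] k = \<one>" using k by blast
qed

end

lemma trivial_localization:
  assumes "comm_group M" "prime l" "trivial_group (localization l M)" "m \<in> carrier M"
  shows "\<exists>k. \<not> int l dvd k \<and> m [^]\<^bsub>M\<^esub> (k::int) = \<one>\<^bsub>M\<^esub>"
proof -
  interpret localized_group M l using assms by (simp add: localized_group_def localized_group_axioms_def)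
  have l1: "\<not> int l dvd 1" using assms(2) by auto
  have "tens M Z m (1 / of_int 1) \<in> carrier (localization l M)"
    unfolding localization_def using P.tens_closed[OF assms(4) Z_inverse[OF l1]] .
  then have "tens M Z m (1 / of_int 1) = \<one>\<^bsub>localization l M\<^esub>"
    using assms(3) by (auto simp: trivial_group_def)
  then show ?thesis using tens_eq_one_iff[OF assms(4) l1] by simp
qed

lemma localization_map_iso:
  assumes M: "comm_group M" and M': "comm_group M'" and l: "prime l" and f: "f \<in> hom M M'"
    and ker: "\<And>m. m \<in> carrier M \<Longrightarrow> f m = \<one>\<^bsub>M'\<^esub> \<Longrightarrow> \<exists>k. \<not> int l dvd k \<and> m [^]\<^bsub>M\<^esub> (k::int) = \<one>\<^bsub>M\<^esub>"
    and coker: "\<And>m'. m' \<in> carrier M' \<Longrightarrow>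
      \<exists>k. \<not> int l dvd k \<and> m' [^]\<^bsub>M'\<^esub> (k::int) \<in> f ` carrier M"
  shows "localization_map l M' f \<in> iso (localization l M) (localization l M')"
proof -
  interpret L: localized_group M l using M l by (simp add: localized_group_def localized_group_axioms_def)
  interpret L': localized_group M' l using M' l by (simp add: localized_group_def localized_group_axioms_def)
  interpret f: group_hom M M' f using f by (simp add: group_hom_iff L.is_group L'.is_group)
  have id: "id \<in> hom (local_integers l) (local_integers l)" by (simp add: hom_def)
  note map = tensor_map_hom[OF M L.Z.comm_group_axioms M' L.Z.comm_group_axioms f id]
    and tens = tensor_map_tens[OF M L.Z.comm_group_axioms M' L.Z.comm_group_axioms f id]
  interpret g: group_hom "localization l M" "localization l M'" "localization_map l M' f"
    using map L.P.T.is_group L'.P.T.is_group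
    by (simp add: group_hom_iff localization_def localization_map_def)
  show ?thesis unfolding g.iso_iff
  proof (intro conjI subsetI ballI impI)
    fix y assume "y \<in> carrier (localization l M')"
    then obtain m b where y: "m \<in> carrier M'" "\<not> int l dvd b" "y = tens M' L'.Z m (1 / of_int b)"
      by (rule L'.localization_rep)
    obtain k n where k: "\<not> int l dvd k" "n \<in> carrier M" "m [^]\<^bsub>M'\<^esub> k = f n" using coker[OF y(1)] by (metis imageE)
    have bk: "1 / rat_of_int (b * k) \<in> carrier L.Z" using L.Z_inverse L.not_dvd_mult[OF y(2) k(1)] by blast
    \<comment> \<open>Since y = m/b and the \<open>k\<close>-th power of \<open>m\<close> is
      \<open>f n\<close>, the fraction n/(b k) is a preimage of \<open>y\<close>.\<close>
    have "localization_map l M' f (tens M L.Z n (1 / of_int (b * k))) = y"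
      using tens[OF k(2) bk] L'.tens_expand[OF y(1,2) k(1)] y(3) k(3) by (simp add: localization_map_def)
    then show "y \<in> localization_map l M' f ` carrier (localization l M)"
      using L.P.tens_closed[OF k(2) bk] unfolding localization_def by blast
  next
    fix x assume x: "x \<in> carrier (localization l M)" "localization_map l M' f x = \<one>\<^bsub>localization l M'\<^esub>"
    obtain m b where m: "m \<in> carrier M" "\<not> int l dvd b" "x = tens M L.Z m (1 / of_int b)"
      using L.localization_rep[OF x(1)] .
    have "tens M' L'.Z (f m) (1 / of_int b) = \<one>\<^bsub>localization l M'\<^esub>"
      using x(2) tens[OF m(1) L.Z_inverse[OF m(2)]] m(3) by (simp add: localization_map_def)
    \<comment> \<open>Some \<open>k\<close> prime to \<open>l\<close> kills \<open>f m\<close>. The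
      \<open>k\<close>-th power of \<open>m\<close> then lies in the kernel of \<open>f\<close>,
      where the hypothesis \<open>ker\<close> provides a second integer \<open>j\<close> prime to
      \<open>l\<close> that kills it.\<close>
    then obtain k where k: "\<not> int l dvd k" "f m [^]\<^bsub>M'\<^esub> k = \<one>\<^bsub>M'\<^esub>"
      using L'.tens_eq_one_iff[OF f.hom_closed[OF m(1)] m(2)] by blast
    then have "f (m [^]\<^bsub>M\<^esub> k) = \<one>\<^bsub>M'\<^esub>" using f.hom_int_pow[OF m(1)] by simp
    then obtain j where j: "\<not> int l dvd j" "(m [^]\<^bsub>M\<^esub> k) [^]\<^bsub>M\<^esub> j = \<one>\<^bsub>M\<^esub>"
      using ker[OF L.int_pow_closed[OF m(1)]] by blast
    then have "m [^]\<^bsub>M\<^esub> (k * j) = \<one>\<^bsub>M\<^esub>" using L.int_pow_pow[OF m(1)] by simp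
    then show "x = \<one>\<^bsub>localization l M\<^esub>"
      using L.tens_eq_one_iff[OF m(1,2)] L.not_dvd_mult[OF k(1) j(1)] m(3) by blast
  qed
qed

section \<open>Presented groups\<close>

lemma words_Nil [simp]: "[] \<in> words S"
  by (simp add: words_def)

lemma words_Cons [simp]: "(s, b) # w \<in> words S \<longleftrightarrow> s \<in> S \<and> w \<in> words S"
  by (auto simp: words_def)

lemma words_append [simp]: "u @ v \<in> words S \<longleftrightarrow> u \<in> words S \<and> v \<in> words S"
  by (auto simp: words_def)

lemma presentation_eq_words:
  "(u, v) \<in> presentation_eq S R \<Longrightarrow> u \<in> words S \<and> v \<in> words S"
  by (induction rule: presentation_eq.induct) auto

lemma equiv_presentation_eq: "equiv (words S) (presentation_eq S R)"
  by (rule equivI)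
     (auto simp: refl_on_def sym_def trans_def dest: presentation_eq_words
       intro: presentation_eq.refl presentation_eq.sym presentation_eq.trans)

lemma presentation_eq_append:
  assumes "(u, v) \<in> presentation_eq S R" "x \<in> words S" "y \<in> words S"
  shows "(x @ u @ y, x @ v @ y) \<in> presentation_eq S R"
  using assms
proof (induction rule: presentation_eq.induct)
  case (cancel u v s b)
  then show ?case using presentation_eq.cancel[of "x @ u" S "v @ y" s b R] by simp
next
  case (relator u v p q)
  then show ?case using presentation_eq.relator[of "x @ u" S "v @ y" p q R] by simp
qed (auto intro: presentation_eq.refl presentation_eq.sym presentation_eq.trans)

lemma presentation_eq_append2:
  assumes "(u, u') \<in> presentation_eq S R" "(v, v') \<in> presentation_eq S R"
  shows "(u @ v, u' @ v') \<in> presentation_eq S R"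
proof -
  have "(u @ v, u' @ v) \<in> presentation_eq S R"
    using presentation_eq_append[OF assms(1), of "[]" v] presentation_eq_words[OF assms(2)] by simp
  moreover have "(u' @ v, u' @ v') \<in> presentation_eq S R"
    using presentation_eq_append[OF assms(2), of u' "[]"] presentation_eq_words[OF assms(1)] by simp
  ultimately show ?thesis by (rule presentation_eq.trans)
qed

lemma word_class_eq_iff:
  assumes "u \<in> words S" "v \<in> words S"
  shows "word_class S R u = word_class S R v \<longleftrightarrow> (u, v) \<in> presentation_eq S R"
  unfolding word_class_def using eq_equiv_class_iff[OF equiv_presentation_eq assms] .

lemma mem_word_class: "v \<in> word_class S R u \<longleftrightarrow> (u, v) \<in> presentation_eq S R"
  by (simp add: word_class_def)

lemma carrier_presented_group: "carrier (presented_group S R) = word_class S R ` words S"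
  by (auto simp: presented_group_def quotient_def word_class_def)

lemma mult_presented_group:
  assumes "u \<in> words S" "v \<in> words S"
  shows "word_class S R u \<otimes>\<^bsub>presented_group S R\<^esub> word_class S R v = word_class S R (u @ v)"
proof -
  have "word_class S R (u' @ v') = word_class S R (u @ v)"
    if "u' \<in> word_class S R u" "v' \<in> word_class S R v" for u' v'
    using that presentation_eq_append2[of u u' S R v v'] presentation_eq_words[of _ _ S R]
    by (subst word_class_eq_iff) (auto simp: mem_word_class intro: presentation_eq.sym)
  moreover have "u \<in> word_class S R u" "v \<in> word_class S R v"
    using assms by (auto simp: mem_word_class presentation_eq.refl)
  ultimately show ?thesis unfolding presented_group_def monoid.simps by blast
qed

definition inv_word :: "'s word \<Rightarrow> 's word" where
  "inv_word w = rev (map (\<lambda>(s, b). (s, \<not> b)) w)"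

lemma inv_word_words [simp]: "w \<in> words S \<Longrightarrow> inv_word w \<in> words S"
  by (auto simp: inv_word_def words_def)

lemma inv_word_cancel:
  "w \<in> words S \<Longrightarrow> (inv_word w @ w, []) \<in> presentation_eq S R"
proof (induction w)
  case Nil then show ?case by (simp add: inv_word_def presentation_eq.refl)
next
  case (Cons a w)
  obtain s b where a: "a = (s, b)" by (cases a)
  have "(inv_word w @ [(s, \<not> b), (s, \<not> \<not> b)] @ w, inv_word w @ w) \<in> presentation_eq S R"
    using Cons.prems a by (intro presentation_eq.cancel) auto
  moreover have "inv_word (a # w) @ a # w = inv_word w @ [(s, \<not> b), (s, \<not> \<not> b)] @ w"
    by (simp add: inv_word_def a)
  ultimately show ?case using Cons a by (auto intro: presentation_eq.trans)
qed

lemma one_presented_group: "\<one>\<^bsub>presented_group S R\<^esub> = word_class S R []"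
  by (simp add: presented_group_def)

lemma group_presented_group: "group (presented_group S R)"
proof (rule groupI)
  fix x assume "x \<in> carrier (presented_group S R)"
  then obtain w where w: "w \<in> words S" "x = word_class S R w" by (auto simp: carrier_presented_group)
  then have "word_class S R (inv_word w) \<otimes>\<^bsub>presented_group S R\<^esub> x = \<one>\<^bsub>presented_group S R\<^esub>"
    using inv_word_cancel[of w S R]
    by (simp add: mult_presented_group one_presented_group word_class_eq_iff)
  then show "\<exists>y\<in>carrier (presented_group S R). y \<otimes>\<^bsub>presented_group S R\<^esub> x = \<one>\<^bsub>presented_group S R\<^esub>"
    using w by (auto simp: carrier_presented_group)
qed (auto simp: carrier_presented_group mult_presented_group one_presented_group)

lemma word_class_inverse_letter:
  assumes "s \<in> S"
  shows "word_class S R [(s, False)] = inv\<^bsub>presented_group S R\<^esub> (word_class S R [(s, True)])"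
proof -
  interpret group "presented_group S R" by (rule group_presented_group)
  have "([(s, False), (s, True)], []) \<in> presentation_eq S R"
    using presentation_eq.cancel[of "[]" S "[]" s False R] assms by simp
  then have "word_class S R [(s, False)] \<otimes>\<^bsub>presented_group S R\<^esub> word_class S R [(s, True)] = \<one>\<^bsub>presented_group S R\<^esub>"
    using assms by (simp add: mult_presented_group one_presented_group word_class_eq_iff)
  then show ?thesis
    using assms by (intro inv_equality[symmetric]) (auto simp: carrier_presented_group)
qed

lemma presented_group_generated:
  assumes H: "subgroup H (presented_group S R)"
    and gen: "\<And>s. s \<in> S \<Longrightarrow> word_class S R [(s, True)] \<in> H"
    and x: "x \<in> carrier (presented_group S R)"
  shows "x \<in> H"
proof -
  interpret group "presented_group S R" by (rule group_presented_group)
  have "w \<in> words S \<Longrightarrow> word_class S R w \<in> H" for w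
  proof (induction w)
    case Nil then show ?case using subgroup.one_closed[OF H] by (simp add: one_presented_group)
  next
    case (Cons a w)
    obtain s b where a: "a = (s, b)" by (cases a)
    have s: "s \<in> S" "w \<in> words S" using Cons a by auto
    have "word_class S R [a] \<in> H"
      using gen[OF s(1)] subgroup.m_inv_closed[OF H gen[OF s(1)]] word_class_inverse_letter[OF s(1), of R]
      by (cases b) (simp_all add: a)
    moreover have "word_class S R (a # w) = word_class S R [a] \<otimes>\<^bsub>presented_group S R\<^esub> word_class S R w"
      using mult_presented_group[of "[a]" S w R] s a by simp
    ultimately show ?case using subgroup.m_closed[OF H] Cons.IH[OF s(2)] by simp
  qed
  then show ?thesis using x by (auto simp: carrier_presented_group)
qed

context group
begin

lemma commute_inv:
  assumes "x \<in> carrier G" "y \<in> carrier G" "x \<otimes> y = y \<otimes> x"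
  shows "x \<otimes> inv y = inv y \<otimes> x"
  using assms by (metis inv_closed inv_solve_left inv_solve_right m_assoc m_closed)

lemma word_eval_Nil [simp]: "word_eval G g [] = \<one>"
  by (simp add: word_eval_def)

lemma word_eval_Cons [simp]:
  "word_eval G g ((s, b) # w) = (if b then g s else inv (g s)) \<otimes> word_eval G g w"
  by (simp add: word_eval_def)

lemma word_eval_closed [simp]:
  "g \<in> S \<rightarrow> carrier G \<Longrightarrow> w \<in> words S \<Longrightarrow> word_eval G g w \<in> carrier G"
  by (induction w) (auto simp: Pi_iff)

lemma word_eval_append:
  "g \<in> S \<rightarrow> carrier G \<Longrightarrow> u \<in> words S \<Longrightarrow> v \<in> words S \<Longrightarrow>
    word_eval G g (u @ v) = word_eval G g u \<otimes> word_eval G g v"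
proof (induction u)
  case (Cons a u)
  then show ?case
    by (cases a) (auto simp: m_assoc Pi_iff word_eval_closed[of g S])
qed (simp add: word_eval_closed[of g S])

lemma word_eval_presentation_eq:
  assumes g: "g \<in> S \<rightarrow> carrier G"
    and R: "\<And>p q. (p, q) \<in> R \<Longrightarrow> p \<in> words S \<Longrightarrow> q \<in> words S \<Longrightarrow> word_eval G g p = word_eval G g q"
    and uv: "(u, v) \<in> presentation_eq S R"
  shows "word_eval G g u = word_eval G g v"
  using uv
proof (induction rule: presentation_eq.induct)
  case (cancel u v s b)
  have gs: "g s \<in> carrier G" using g cancel by auto
  have "word_eval G g ([(s, b), (s, \<not> b)] @ v) = word_eval G g v"
    using gs word_eval_closed[OF g cancel(2)] by (cases b) (simp_all add: m_assoc[symmetric])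
  then show ?case using cancel by (simp only: word_eval_append[OF g] words_append words_Cons words_Nil simp_thms)
next
  case (relator u v p q)
  then show ?case using R[of p q] by (simp add: word_eval_append[OF g])
qed auto

lemma
  assumes g: "g \<in> S \<rightarrow> carrier G"
    and R: "\<And>p q. (p, q) \<in> R \<Longrightarrow> p \<in> words S \<Longrightarrow> q \<in> words S \<Longrightarrow> word_eval G g p = word_eval G g q"
  shows presented_hom_word_class:
      "\<And>w. w \<in> words S \<Longrightarrow> presented_hom G g (word_class S R w) = word_eval G g w"
    and presented_hom_hom: "presented_hom G g \<in> hom (presented_group S R) G"
proof -
  show eq: "presented_hom G g (word_class S R w) = word_eval G g w" if "w \<in> words S" for w
    unfolding presented_hom_def
    by (rule class_map_eqI)
       (use that word_eval_presentation_eq[OF g R] in \<open>auto simp: mem_word_class presentation_eq.refl\<close>)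
  show "presented_hom G g \<in> hom (presented_group S R) G"
    by (rule homI) (auto simp: carrier_presented_group eq mult_presented_group word_eval_append[OF g]
      word_eval_closed[OF g])
qed

end

section \<open>The associated group of a quandle\<close>

lemma group_opposite: "group G \<Longrightarrow> group (opposite G)"
proof -
  assume "group G"
  then interpret group G .
  show ?thesis
    by (rule groupI) (auto simp: opposite_def m_assoc intro: bexI[OF _ inv_closed])
qed

section \<open>Inner automorphisms acting from the right\<close>

context quandle
begin

lemma qop_closed [simp]: "a \<in> carrier X \<Longrightarrow> b \<in> carrier X \<Longrightarrow> a \<triangleright> b \<in> carrier X"
  using bij_betwE[OF bij] by auto

lemma qinv_closed [simp]: "a \<in> carrier X \<Longrightarrow> b \<in> carrier X \<Longrightarrow> qinv X a b \<in> carrier X"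
  unfolding qinv_def using bij[of b] by (metis bij_betw_imp_surj_on inv_into_into)

lemma qinv_qop [simp]: "a \<in> carrier X \<Longrightarrow> b \<in> carrier X \<Longrightarrow> qinv X (a \<triangleright> b) b = a"
  unfolding qinv_def using bij_betw_inv_into_left[OF bij] by auto

lemma qop_qinv [simp]: "a \<in> carrier X \<Longrightarrow> b \<in> carrier X \<Longrightarrow> qinv X a b \<triangleright> b = a"
  unfolding qinv_def using bij_betw_inv_into_right[OF bij, of b a] by simp

lemma translation_Bij: "b \<in> carrier X \<Longrightarrow> translation X b \<in> Bij (carrier X)"
  using bij[of b] by (auto simp: Bij_def translation_def bij_betw_restrict_eq)

abbreviation "OB \<equiv> opposite (BijGroup (carrier X))"

sublocale OB: group OB by (rule group_opposite[OF group_BijGroup])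

lemma carrier_OB: "carrier OB = Bij (carrier X)"
  by (simp add: opposite_def BijGroup_def)

sublocale Inn: group "Inn X" unfolding Inn_def by (rule OB.group_subgroup_generated)

abbreviation Inn_mult (infixl "\<bullet>" 70) where "\<sigma> \<bullet> \<tau> \<equiv> \<sigma> \<otimes>\<^bsub>Inn X\<^esub> \<tau>"

lemma Inn_Bij: "\<sigma> \<in> carrier (Inn X) \<Longrightarrow> \<sigma> \<in> Bij (carrier X)"
  using OB.carrier_subgroup_generated_subset[of "translation X ` carrier X"] carrier_OB
  by (auto simp: Inn_def)

lemma Inn_closed [simp]: "\<sigma> \<in> carrier (Inn X) \<Longrightarrow> x \<in> carrier X \<Longrightarrow> \<sigma> x \<in> carrier X"
  using Bij_imp_funcset[OF Inn_Bij] by auto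

lemma Inn_mult_eq:
  assumes "\<sigma> \<in> carrier (Inn X)" "\<tau> \<in> carrier (Inn X)"
  shows "\<sigma> \<bullet> \<tau> = compose (carrier X) \<tau> \<sigma>"
  using Inn_Bij[OF assms(1)] Inn_Bij[OF assms(2)] by (simp add: Inn_def opposite_def BijGroup_def)

lemma Inn_mult_apply [simp]:
  assumes "\<sigma> \<in> carrier (Inn X)" "\<tau> \<in> carrier (Inn X)" "x \<in> carrier X"
  shows "(\<sigma> \<bullet> \<tau>) x = \<tau> (\<sigma> x)"
  using assms by (simp add: Inn_mult_eq compose_def)

lemma Inn_one_apply [simp]: "x \<in> carrier X \<Longrightarrow> \<one>\<^bsub>Inn X\<^esub> x = x"
  by (simp add: Inn_def opposite_def BijGroup_def)

lemma Inn_eqI: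
  assumes "\<sigma> \<in> carrier (Inn X)" "\<tau> \<in> carrier (Inn X)" "\<And>x. x \<in> carrier X \<Longrightarrow> \<sigma> x = \<tau> x"
  shows "\<sigma> = \<tau>"
  using Bij_imp_extensional[OF Inn_Bij[OF assms(1)]] Bij_imp_extensional[OF Inn_Bij[OF assms(2)]] assms(3)
  by (rule extensionalityI)

lemma Inn_inv_apply [simp]:
  assumes "\<sigma> \<in> carrier (Inn X)" "x \<in> carrier X"
  shows "(inv\<^bsub>Inn X\<^esub> \<sigma>) (\<sigma> x) = x" "\<sigma> ((inv\<^bsub>Inn X\<^esub> \<sigma>) x) = x"
  using assms Inn_mult_apply[of \<sigma> "inv\<^bsub>Inn X\<^esub> \<sigma>" x] Inn_mult_apply[of "inv\<^bsub>Inn X\<^esub> \<sigma>" \<sigma> x] by simp_all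

lemma translation_Inn [simp]: "b \<in> carrier X \<Longrightarrow> translation X b \<in> carrier (Inn X)"
  unfolding Inn_def using OB.subgroup_generated_subset_carrier_subset[of "translation X ` carrier X"]
    translation_Bij carrier_OB by blast

lemma translation_apply [simp]: "x \<in> carrier X \<Longrightarrow> translation X b x = x \<triangleright> b"
  by (simp add: translation_def)

lemma inv_translation_apply [simp]:
  "x \<in> carrier X \<Longrightarrow> b \<in> carrier X \<Longrightarrow> (inv\<^bsub>Inn X\<^esub> (translation X b)) x = qinv X x b"
  using Inn_inv_apply(1)[of "translation X b" "qinv X x b"] by simp

text \<open>Evaluated at \<open>z\<close>, this is the self-distributivity \<open>(z
  \<triangleright> x) \<triangleright> y = (z \<triangleright> y) \<triangleright> (x
  \<triangleright> y)\<close>. It is the defining relation of \<open>As X\<close>, so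
  \<open>translation X\<close> induces \<open>psi X\<close>.\<close>

lemma translation_relation:
  assumes "x \<in> carrier X" "y \<in> carrier X"
  shows "translation X x \<bullet> translation X y = translation X y \<bullet> translation X (x \<triangleright> y)"
proof (rule Inn_eqI)
  fix z assume "z \<in> carrier X"
  then show "(translation X x \<bullet> translation X y) z = (translation X y \<bullet> translation X (x \<triangleright> y)) z"
    using assms distrib[of z x y] by simp
qed (use assms in simp_all)

lemma Inn_generated:
  assumes "subgroup H (Inn X)" "\<And>x. x \<in> carrier X \<Longrightarrow> translation X x \<in> H"
  shows "carrier (Inn X) \<subseteq> H"
proof -
  have "subgroup H OB"
    using OB.subgroup_of_subgroup_generated assms(1) unfolding Inn_def
    by (metis OB.subgroup_subgroup_generated_iff)
  then show ?thesis unfolding Inn_def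
    by (rule OB.subgroup_generated_minimal) (use assms(2) in auto)
qed

section \<open>The associated group and its central kernel over Inn(X)\<close>

sublocale As: group "As X" unfolding As_def by (rule group_presented_group)

abbreviation "e \<equiv> As_gen X"
abbreviation "wclass \<equiv> word_class (carrier X) (As_relators X)"
abbreviation As_mult (infixl "\<star>" 70) where "g \<star> h \<equiv> g \<otimes>\<^bsub>As X\<^esub> h"

lemma As_gen_closed [simp]: "x \<in> carrier X \<Longrightarrow> e x \<in> carrier (As X)"
  by (auto simp: As_gen_def As_def carrier_presented_group)

lemma As_gen_relation:
  assumes "x \<in> carrier X" "y \<in> carrier X"
  shows "e x \<star> e y = e y \<star> e (x \<triangleright> y)"
proof -
  have "([(x, True), (y, True)], [(y, True), (x \<triangleright> y, True)]) \<in> presentation_eq (carrier X) (As_relators X)"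
    using presentation_eq.relator[of "[]" "carrier X" "[]" _ _ "As_relators X"] assms
    by (auto simp: As_relators_def)
  then show ?thesis
    using assms by (simp add: As_gen_def As_def mult_presented_group word_class_eq_iff)
qed

lemma As_induct [consumes 1, case_names one gen inv mult]:
  assumes "g \<in> carrier (As X)" and "P \<one>\<^bsub>As X\<^esub>" and "\<And>x. x \<in> carrier X \<Longrightarrow> P (e x)"
    and "\<And>g. g \<in> carrier (As X) \<Longrightarrow> P g \<Longrightarrow> P (inv\<^bsub>As X\<^esub> g)"
    and "\<And>g h. g \<in> carrier (As X) \<Longrightarrow> h \<in> carrier (As X) \<Longrightarrow> P g \<Longrightarrow> P h \<Longrightarrow> P (g \<star> h)"
  shows "P g"
proof -
  have "subgroup {g \<in> carrier (As X). P g} (As X)"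
  proof (rule As.subgroupI)
    show "{g \<in> carrier (As X). P g} \<noteq> {}" using assms(2) As.one_closed by blast
  qed (use assms(4,5) in auto)
  from presented_group_generated[OF this[unfolded As_def], of g] show ?thesis
    using assms(1,3) As_gen_closed by (simp add: As_def As_gen_def)
qed

lemma As_universal:
  assumes "group G" "f \<in> carrier X \<rightarrow> carrier G"
    and "\<And>x y. x \<in> carrier X \<Longrightarrow> y \<in> carrier X \<Longrightarrow> f x \<otimes>\<^bsub>G\<^esub> f y = f y \<otimes>\<^bsub>G\<^esub> f (x \<triangleright> y)"
  shows "presented_hom G f \<in> hom (As X) G" "\<And>x. x \<in> carrier X \<Longrightarrow> presented_hom G f (e x) = f x"
    "\<And>w. w \<in> words (carrier X) \<Longrightarrow>
      presented_hom G f (wclass w) = word_eval G f w"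
proof -
  interpret G: group G by fact
  have R: "word_eval G f p = word_eval G f q"
    if pq: "(p, q) \<in> As_relators X" "p \<in> words (carrier X)" "q \<in> words (carrier X)" for p q
  proof -
    obtain x y where xy: "x \<in> carrier X" "y \<in> carrier X" "p = [(x, True), (y, True)]" "q = [(y, True), (x \<triangleright> y, True)]"
      using pq(1) unfolding As_relators_def by blast
    then have "f x \<in> carrier G" "f y \<in> carrier G" "f (x \<triangleright> y) \<in> carrier G" using assms(2) by auto
    then show ?thesis using assms(3)[OF xy(1,2)] xy(3,4) by simp
  qed
  show "presented_hom G f \<in> hom (As X) G"
    unfolding As_def by (rule G.presented_hom_hom[OF assms(2) R])
  show eq: "presented_hom G f (wclass w) = word_eval G f w"
    if "w \<in> words (carrier X)" for w
    by (rule G.presented_hom_word_class[OF assms(2) R that])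
  show "presented_hom G f (e x) = f x" if "x \<in> carrier X" for x
    unfolding As_gen_def using eq[of "[(x, True)]"] that assms(2) by (auto simp: Pi_iff)
qed

lemma psi_hom: "psi X \<in> hom (As X) (Inn X)"
  and psi_gen [simp]: "x \<in> carrier X \<Longrightarrow> psi X (e x) = translation X x"
  and psi_word_class: "w \<in> words (carrier X) \<Longrightarrow>
      psi X (wclass w) = word_eval (Inn X) (translation X) w"
proof -
  have "translation X \<in> carrier X \<rightarrow> carrier (Inn X)" by simp
  note * = As_universal[OF Inn.is_group this translation_relation]
  show "psi X \<in> hom (As X) (Inn X)" "x \<in> carrier X \<Longrightarrow> psi X (e x) = translation X x"
    "w \<in> words (carrier X) \<Longrightarrow>
      psi X (wclass w) = word_eval (Inn X) (translation X) w"
    unfolding psi_def by (simp_all only: *)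
qed

sublocale psi: group_hom "As X" "Inn X" "psi X"
  by (simp add: group_hom_iff psi_hom As.is_group Inn.is_group)

lemma psi_surj: "psi X ` carrier (As X) = carrier (Inn X)"
  using Inn_generated[OF psi.img_is_subgroup] psi_gen psi.hom_closed
  by (metis As_gen_closed image_eqI image_subsetI subset_antisym)

text \<open>For a generator \<open>g\<close> this is the defining relation, and it passes to
  products and inverses. Two consequences carry the proof: elements acting trivially commute with
  every \<open>e x\<close>, and for connected \<open>X\<close> all the \<open>e x\<close> are
  conjugate.\<close>

lemma As_gen_conj:
  assumes "g \<in> carrier (As X)" "x \<in> carrier X"
  shows "e x \<star> g = g \<star> e (psi X g x)"
  using assms
proof (induction g arbitrary: x rule: As_induct)
  case (gen y)
  then show ?case using As_gen_relation[of x y] by simp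
next
  case (inv g)
  \<comment> \<open>The induction hypothesis is needed at the preimage of \<open>x\<close> under
    \<open>g\<close>, hence the generalization over \<open>x\<close>.\<close>
  let ?y = "(inv\<^bsub>Inn X\<^esub> psi X g) x"
  have y: "?y \<in> carrier X" using inv by simp
  then have "e ?y \<star> g = g \<star> e x" using inv.IH[OF y] inv by simp
  then show ?case using inv y
    by (metis (no_types, lifting) As.inv_solve_left As.inv_solve_right As.inv_closed As.m_assoc As.m_closed As_gen_closed psi.hom_inv)
next
  case (mult g h)
  have y: "psi X g x \<in> carrier X" using mult by simp
  have "e x \<star> (g \<star> h) = (e x \<star> g) \<star> h" using As.m_assoc[of "e x" g h] mult by simp
  also have "\<dots> = g \<star> (e (psi X g x) \<star> h)" using As.m_assoc[of g "e (psi X g x)" h] mult.IH(1)[of x] mult y by simp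
  also have "\<dots> = g \<star> (h \<star> e (psi X h (psi X g x)))" using mult.IH(2)[OF y] by simp
  finally show ?case using As.m_assoc[of g h "e (psi X h (psi X g x))"] mult y by simp
qed simp

text \<open>For \<open>k\<close> acting trivially, \<open>As_gen_conj\<close> says that
  \<open>k\<close> commutes with every generator, and the elements commuting with \<open>k\<close>
  form a subgroup.\<close>

lemma kernel_psi_central:
  assumes "k \<in> kernel (As X) (Inn X) (psi X)" "g \<in> carrier (As X)"
  shows "k \<star> g = g \<star> k"
proof -
  have k: "k \<in> carrier (As X)" "psi X k = \<one>\<^bsub>Inn X\<^esub>" using assms(1) by (auto simp: kernel_def)
  from assms(2) show ?thesis
  proof (induction g rule: As_induct)
    case (gen x)
    then show ?case using As_gen_conj[OF k(1) gen] k(2) by simp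
  next
    case (inv g)
    then show ?case using As.commute_inv[of k g] k(1) by simp
  next
    case (mult g h)
    have "k \<star> (g \<star> h) = g \<star> (k \<star> h)"
      using As.m_assoc[of k g h] As.m_assoc[of g k h] mult k(1) by simp
    then show ?case using As.m_assoc[of g h k] mult k(1) by simp
  qed (use k(1) in simp)
qed

end

text \<open>A finite type excludes the empty set of periods, whose infimum is infinite; on a
  nonempty set the infimum in \<open>enat\<close> is a least element, hence itself a period.
  Iterated application of \<open>\<triangleright> y\<close> is the power of the translation in
  \<open>Inn X\<close>.\<close>

lemma quandle_type_pow:
  assumes "quandle_type X = enat n" "quandle X"
  shows "0 < n" "y \<in> carrier X \<Longrightarrow> translation X y [^]\<^bsub>Inn X\<^esub> n = \<one>\<^bsub>Inn X\<^esub>"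
proof -
  interpret quandle X by fact
  let ?A = "{enat n | n. 0 < n \<and>
       (\<forall>x\<in>carrier X. \<forall>y\<in>carrier X. ((\<lambda>z. z \<triangleright>\<^bsub>X\<^esub> y) ^^ n) x = x)}"
  have "?A \<noteq> {}"
  proof
    assume "?A = {}"
    then have "quandle_type X = \<infinity>" unfolding quandle_type_def Inf_enat_def by (simp only: simp_thms if_True)
    then show False using assms(1) by simp
  qed
  then obtain a where "a \<in> ?A" by blast
  then have "(LEAST x. x \<in> ?A) \<in> ?A" by (rule LeastI)
  then have "Inf ?A \<in> ?A" using \<open>?A \<noteq> {}\<close> unfolding Inf_enat_def by (simp only: if_False)
  then have "enat n \<in> ?A" using assms(1) unfolding quandle_type_def by simp
  then have n: "0 < n" "\<And>x y. x \<in> carrier X \<Longrightarrow> y \<in> carrier X \<Longrightarrow> ((\<lambda>z. z \<triangleright>\<^bsub>X\<^esub> y) ^^ n) x = x"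
    by auto
  show "0 < n" by fact
  assume y: "y \<in> carrier X"
  have pow: "(translation X y [^]\<^bsub>Inn X\<^esub> k) x = ((\<lambda>z. z \<triangleright>\<^bsub>X\<^esub> y) ^^ k) x" if "x \<in> carrier X" for x and k :: nat
  proof (induction k)
    case (Suc k)
    have "((\<lambda>z. z \<triangleright>\<^bsub>X\<^esub> y) ^^ k) x \<in> carrier X" using y that by (induction k) auto
    then show ?case using Suc that y by simp
  qed (use that in simp)
  show "translation X y [^]\<^bsub>Inn X\<^esub> n = \<one>\<^bsub>Inn X\<^esub>"
    by (rule Inn_eqI) (use y pow n in auto)
qed

section \<open>Subquotients and mapping groups\<close>

text \<open>All the cohomology groups below, absolute, relative and quandle, are cocycles modulo
  coboundaries inside a group of cochains. Cosets are written in the ambient \<open>G\<close>, so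
  that representatives can be computed with there.\<close>

locale subquotient = comm_group G for G :: "('a, 'm) monoid_scheme" (structure) +
  fixes K N
  assumes K: "subgroup K G" and N: "subgroup N G" and NK: "N \<subseteq> K"
begin

abbreviation "Q \<equiv> G\<lparr>carrier := K\<rparr> Mod N"

lemma comm_group_K: "comm_group (G\<lparr>carrier := K\<rparr>)"
  by (rule subgroup_comm_group[OF K])

lemma N_K: "subgroup N (G\<lparr>carrier := K\<rparr>)"
  using subgroup_incl[OF N K NK] .

sublocale Q: comm_group Q
  by (rule comm_group.abelian_FactGroup[OF comm_group_K N_K])

lemma carrier_Q: "carrier Q = (\<lambda>x. N #> x) ` K"
  by (simp add: carrier_FactGroup)

lemma K_carrier: "x \<in> K \<Longrightarrow> x \<in> carrier G"
  using subgroup.mem_carrier[OF K] .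

lemma cls_closed: "x \<in> K \<Longrightarrow> N #> x \<in> carrier Q"
  by (simp add: carrier_Q)

lemma cls_hom: "(\<lambda>x. N #> x) \<in> hom (G\<lparr>carrier := K\<rparr>) Q"
  using comm_group.rcos_hom[OF comm_group_K N_K] by simp

lemma cls_mult: "x \<in> K \<Longrightarrow> y \<in> K \<Longrightarrow> (N #> x) \<otimes>\<^bsub>Q\<^esub> (N #> y) = N #> (x \<otimes> y)"
  using hom_mult[OF cls_hom, of x y] by simp

lemma cls_pow: "x \<in> K \<Longrightarrow> (N #> x) [^]\<^bsub>Q\<^esub> (k::int) = N #> (x [^] k)"
  using hom_int_pow[OF cls_hom, of x k] comm_group.axioms(2)[OF comm_group_K] Q.is_group
    int_pow_consistent[OF K, of x k] by simp

lemma cls_eq_iff: "x \<in> K \<Longrightarrow> y \<in> K \<Longrightarrow> N #> x = N #> y \<longleftrightarrow> x \<otimes> inv y \<in> N"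
  using rcos_eq_iff[OF N] K_carrier by simp

lemma cls_eq_one_iff: "x \<in> K \<Longrightarrow> N #> x = \<one>\<^bsub>Q\<^esub> \<longleftrightarrow> x \<in> N"
  using cls_eq_iff[of x \<one>] subgroup.one_closed[OF K] coset_mult_one[OF subgroup.subset[OF N]] K_carrier[of x]
  by simp

lemma cls_absorb: "n \<in> N \<Longrightarrow> x \<in> K \<Longrightarrow> N #> (n \<otimes> x) = N #> x"
  using cls_eq_iff[of "n \<otimes> x" x] NK K_carrier subgroup.m_closed[OF K, of n x] m_assoc[of n x "inv x"]
  by (auto simp: subset_iff)

lemma class_map_cls:
  "x \<in> K \<Longrightarrow> (\<And>n. n \<in> N \<Longrightarrow> f (n \<otimes> x) = f x) \<Longrightarrow> class_map f (N #> x) = f x"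
  using class_map_rcos[OF N K_carrier] by blast

end

lemma (in group) mult_inv_eq_one_iff:
  "x \<in> carrier G \<Longrightarrow> y \<in> carrier G \<Longrightarrow> x \<otimes> inv y = \<one> \<longleftrightarrow> x = y"
  by (metis inv_equality inv_inv inv_closed r_inv)

lemma carrier_map_group [simp]: "carrier (map_group S A) = (\<Pi>\<^sub>E x\<in>S. carrier A)"
  by (simp add: map_group_def)

lemma mult_map_group [simp]: "f \<otimes>\<^bsub>map_group S A\<^esub> g = (\<lambda>x\<in>S. f x \<otimes>\<^bsub>A\<^esub> g x)"
  by (simp add: map_group_def)

lemma one_map_group [simp]: "\<one>\<^bsub>map_group S A\<^esub> = (\<lambda>x\<in>S. \<one>\<^bsub>A\<^esub>)"
  by (simp add: map_group_def)

lemma (in comm_group) map_group_comm_group: "comm_group (map_group S G)"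
  by (rule group.group_comm_groupI)
     (auto simp: map_group_def is_group PiE_iff m_comm restrict_def fun_eq_iff)

lemma (in comm_group) inv_map_group: "f \<in> carrier (map_group S G) \<Longrightarrow> inv\<^bsub>map_group S G\<^esub> f = (\<lambda>x\<in>S. inv (f x))"
  by (simp add: map_group_def is_group)

lemma (in comm_group) int_pow_map_group:
  assumes "f \<in> carrier (map_group S G)"
  shows "f [^]\<^bsub>map_group S G\<^esub> (k::int) = (\<lambda>x\<in>S. f x [^] k)"
proof -
  interpret M: comm_group "map_group S G" by (rule map_group_comm_group)
  have "(f [^]\<^bsub>map_group S G\<^esub> k) x = f x [^] k" if "x \<in> S" for x
  proof -
    have "(\<lambda>f. f x) \<in> hom (map_group S G) G" using that by (auto simp: hom_def)
    then show ?thesis using hom_int_pow[OF _ assms M.is_group is_group] by blast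
  qed
  moreover have "f [^]\<^bsub>map_group S G\<^esub> k \<in> carrier (map_group S G)" using assms M.int_pow_closed by blast
  ultimately show ?thesis by (intro PiE_ext[of _ S "\<lambda>_. carrier G"]) (use assms in auto)
qed

section \<open>Group cohomology in low degrees\<close>

lemma tuples_0 [simp]: "tuples S 0 = {[]}"
  by (auto simp: tuples_def)

lemma tuples_Suc_iff: "gs \<in> tuples S (Suc n) \<longleftrightarrow> (\<exists>a as. gs = a # as \<and> a \<in> S \<and> as \<in> tuples S n)"
  by (cases gs) (auto simp: tuples_def)

lemma tuples_1E: "gs \<in> tuples S (Suc 0) \<Longrightarrow> (\<And>a. gs = [a] \<Longrightarrow> a \<in> S \<Longrightarrow> P) \<Longrightarrow> P"
  by (auto simp: tuples_Suc_iff)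

lemma tuples_2E: "gs \<in> tuples S (Suc (Suc 0)) \<Longrightarrow> (\<And>a b. gs = [a, b] \<Longrightarrow> a \<in> S \<Longrightarrow> b \<in> S \<Longrightarrow> P) \<Longrightarrow> P"
  by (auto simp: tuples_Suc_iff)

lemma tuples_3E: "gs \<in> tuples S (Suc (Suc (Suc 0))) \<Longrightarrow>
    (\<And>a b c. gs = [a, b, c] \<Longrightarrow> a \<in> S \<Longrightarrow> b \<in> S \<Longrightarrow> c \<in> S \<Longrightarrow> P) \<Longrightarrow> P"
  by (auto simp: tuples_Suc_iff)

lemma tuples_Cons [simp]: "a # as \<in> tuples S (Suc n) \<longleftrightarrow> a \<in> S \<and> as \<in> tuples S n"
  by (auto simp: tuples_def)

lemma bar_boundary_0: "bar_boundary G [] = 0"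
  by (simp add: bar_boundary_def)

lemma bar_boundary_1: "bar_boundary G [a] = 0"
  by (simp add: bar_boundary_def bar_face_def)

lemma bar_boundary_2: "bar_boundary G [a, b] = frag_of [b] - frag_of [a \<otimes>\<^bsub>G\<^esub> b] + frag_of [a]"
  by (simp add: bar_boundary_def bar_face_def numeral_2_eq_2)

lemma bar_boundary_3:
  "bar_boundary G [a, b, c] =
    frag_of [b, c] - frag_of [a \<otimes>\<^bsub>G\<^esub> b, c] + frag_of [a, b \<otimes>\<^bsub>G\<^esub> c] - frag_of [a, b]"
  by (simp add: bar_boundary_def bar_face_def numeral_3_eq_3)

text \<open>Formulated for any \<open>K\<close> closed under the product, so as to serve the whole
  group and the subgroup alike.\<close>

lemma bar_face_tuples:
  assumes "\<And>a b. a \<in> K \<Longrightarrow> b \<in> K \<Longrightarrow> a \<otimes>\<^bsub>G\<^esub> b \<in> K" "gs \<in> tuples K (Suc n)" "i \<le> Suc n"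
  shows "bar_face G i gs \<in> tuples K n"
proof -
  have len: "length gs = Suc n" and sub: "set gs \<subseteq> K" using assms(2) by (auto simp: tuples_def)
  consider "i = 0" | "i = Suc n" | "0 < i" "i < Suc n" using assms(3) by linarith
  then show ?thesis
  proof cases
    case 1 then show ?thesis using len sub by (cases gs) (auto simp: tuples_def bar_face_def)
  next
    case 2 then show ?thesis using len sub by (auto simp: tuples_def bar_face_def dest: in_set_butlastD)
  next
    case 3
    then have "gs ! (i - 1) \<in> K" "gs ! i \<in> K" using len sub by (auto intro!: subsetD[OF sub] nth_mem)
    then have "gs ! (i - 1) \<otimes>\<^bsub>G\<^esub> gs ! i \<in> K" by (rule assms(1))
    then show ?thesis using 3 len sub
      by (auto simp: tuples_def bar_face_def dest: in_set_takeD in_set_dropD)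
  qed
qed

lemma keys_bar_boundary:
  assumes "\<And>a b. a \<in> K \<Longrightarrow> b \<in> K \<Longrightarrow> a \<otimes>\<^bsub>G\<^esub> b \<in> K" "gs \<in> tuples K (Suc n)"
  shows "keys (bar_boundary G gs) \<subseteq> tuples K n"
proof -
  have "bar_boundary G gs \<in> carrier (free_Abelian_group (tuples K n))"
  proof -
    have gs: "gs \<noteq> []" "length gs = Suc n" using assms(2) by (auto simp: tuples_def)
    have "frag_cmul ((- 1) ^ i) (frag_of (bar_face G i gs)) \<in> carrier (free_Abelian_group (tuples K n))"
      if "i \<in> {..length gs}" for i
      using bar_face_tuples[OF assms, of i] that gs keys_cmul[of "(- 1) ^ i" "frag_of (bar_face G i gs)"]
      by (auto simp: keys_frag_of)
    then show ?thesis unfolding bar_boundary_def using gs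
      by (simp only: if_False) (rule sum_closed_free_Abelian_group, blast)
  qed
  then show ?thesis by simp
qed

section \<open>Bar cochains of a group and of a pair\<close>

locale group_pair = G: group G + A: comm_group A + K: subgroup K G
  for G :: "('g, 'm) monoid_scheme" and A :: "('b, 'n) monoid_scheme" (structure) and K :: "'g set"
begin

abbreviation G_mult (infixl "\<cdot>" 70) where "a \<cdot> b \<equiv> a \<otimes>\<^bsub>G\<^esub> b"
abbreviation "C \<equiv> bar_cochains G A"
abbreviation "\<delta> \<equiv> bar_coboundary G A"
abbreviation "RC \<equiv> rel_cochains G K A"
abbreviation "R\<delta> \<equiv> rel_coboundary G K A"

lemma C_comm_group: "comm_group (C n)"
  unfolding bar_cochains_def by (rule A.map_group_comm_group)

lemma carrier_C: "carrier (C n) = (\<Pi>\<^sub>E x\<in>tuples (carrier G) n. carrier A)"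
  by (simp add: bar_cochains_def)

lemma keys_bar_boundary_K: "gs \<in> tuples K (Suc n) \<Longrightarrow> keys (bar_boundary G gs) \<subseteq> tuples K n"
  by (rule keys_bar_boundary) auto

lemma keys_bar_boundary_G:
  "gs \<in> tuples (carrier G) (Suc n) \<Longrightarrow> keys (bar_boundary G gs) \<subseteq> tuples (carrier G) n"
  by (rule keys_bar_boundary) auto

lemma \<delta>_hom: "\<delta> n \<in> hom (C n) (C (Suc n))"
proof (rule homI)
  fix h assume h: "h \<in> carrier (C n)"
  have lin: "k \<in> keys (bar_boundary G gs) \<rightarrow> carrier A"
    if "gs \<in> tuples (carrier G) (Suc n)" "k \<in> carrier (C n)" for gs k
    using keys_bar_boundary_G[OF that(1)] that(2) by (auto simp: carrier_C)
  show "\<delta> n h \<in> carrier (C (Suc n))"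
    unfolding carrier_C bar_coboundary_def using A.linear_ext_closed[OF lin] h by auto
  fix k assume k: "k \<in> carrier (C n)"
  have "linear_ext A (h \<otimes>\<^bsub>C n\<^esub> k) (bar_boundary G gs) =
      linear_ext A h (bar_boundary G gs) \<otimes> linear_ext A k (bar_boundary G gs)"
    if gs: "gs \<in> tuples (carrier G) (Suc n)" for gs
    by (rule A.linear_ext_multf[OF lin[OF gs h] lin[OF gs k]])
       (use keys_bar_boundary_G[OF gs] in \<open>auto simp: bar_cochains_def\<close>)
  then show "\<delta> n (h \<otimes>\<^bsub>C n\<^esub> k) = \<delta> n h \<otimes>\<^bsub>C (Suc n)\<^esub> \<delta> n k"
    unfolding bar_coboundary_def by (auto simp: bar_cochains_def intro!: restrict_ext)
qed

lemma \<delta>1_apply: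
  assumes "h \<in> carrier (C 1)" "a \<in> carrier G" "b \<in> carrier G"
  shows "\<delta> 1 h [a, b] = h [b] \<otimes> inv h [a \<cdot> b] \<otimes> h [a]"
proof -
  have v: "h [x] \<in> carrier A" if "x \<in> carrier G" for x using assms(1) that by (auto simp: carrier_C PiE_iff)
  have "linear_ext A h (frag_of [b] - frag_of [a \<cdot> b]) = h [b] \<otimes> inv h [a \<cdot> b]"
    using v assms by (subst A.linear_ext_diff) (auto simp: keys_frag_of)
  moreover have "h \<in> keys (frag_of [b] - frag_of [a \<cdot> b]) \<rightarrow> carrier A"
    using keys_diff[of "frag_of [b]" "frag_of [a \<cdot> b]"] v assms by (auto simp: keys_frag_of)
  ultimately show ?thesis
    using v assms by (simp add: bar_coboundary_def bar_boundary_2 A.linear_ext_add keys_frag_of)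
qed

lemma \<delta>2_apply:
  assumes "h \<in> carrier (C 2)" "a \<in> carrier G" "b \<in> carrier G" "c \<in> carrier G"
  shows "\<delta> 2 h [a, b, c] = h [b, c] \<otimes> inv h [a \<cdot> b, c] \<otimes>
    h [a, b \<cdot> c] \<otimes> inv h [a, b]"
proof -
  have v: "h [x, y] \<in> carrier A" if "x \<in> carrier G" "y \<in> carrier G" for x y
    using assms(1) that by (auto simp: carrier_C PiE_iff numeral_2_eq_2)
  let ?d1 = "frag_of [b, c] - frag_of [a \<cdot> b, c]"
  let ?d2 = "?d1 + frag_of [a, b \<cdot> c]"
  have k1: "h \<in> keys ?d1 \<rightarrow> carrier A"
    using keys_diff[of "frag_of [b, c]" "frag_of [a \<cdot> b, c]"] v assms by (auto simp: keys_frag_of)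
  have k2: "h \<in> keys ?d2 \<rightarrow> carrier A"
    using keys_add[of ?d1 "frag_of [a, b \<cdot> c]"] k1 v assms by (auto simp: keys_frag_of)
  have "linear_ext A h ?d1 = h [b, c] \<otimes> inv h [a \<cdot> b, c]"
    using v assms by (subst A.linear_ext_diff) (auto simp: keys_frag_of)
  then have "linear_ext A h ?d2 = h [b, c] \<otimes> inv h [a \<cdot> b, c] \<otimes> h [a, b \<cdot> c]"
    using v assms by (subst A.linear_ext_add[OF k1]) (auto simp: keys_frag_of)
  then show ?thesis
    using v assms k2
    by (simp add: bar_coboundary_def bar_boundary_3 A.linear_ext_diff keys_frag_of numeral_2_eq_2)
qed

lemma \<delta>2_\<delta>1:
  assumes "h \<in> carrier (C 1)"
  shows "\<delta> 2 (\<delta> 1 h) = \<one>\<^bsub>C 3\<^esub>"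
proof -
  have d1: "\<delta> 1 h \<in> carrier (C 2)" using hom_in_carrier[OF \<delta>_hom assms] by (simp add: numeral_2_eq_2)
  have v: "h [x] \<in> carrier A" if "x \<in> carrier G" for x using assms that by (auto simp: carrier_C PiE_iff)
  have "\<delta> 2 (\<delta> 1 h) gs = \<one>" if "gs \<in> tuples (carrier G) 3" for gs
  proof -
    obtain a b c where gs: "gs = [a, b, c]" "a \<in> carrier G" "b \<in> carrier G" "c \<in> carrier G"
      using \<open>gs \<in> tuples (carrier G) 3\<close> unfolding numeral_3_eq_3 by (elim tuples_3E)
    have grp: "x \<otimes> inv y \<otimes> z \<otimes> inv (x \<otimes> inv w \<otimes> u) \<otimes>
        (y \<otimes> inv w \<otimes> t) \<otimes> inv (z \<otimes> inv u \<otimes> t) = \<one>"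
      if "x \<in> carrier A" "y \<in> carrier A" "z \<in> carrier A" "w \<in> carrier A" "u \<in> carrier A" "t \<in> carrier A"
      for x y z w u t
    proof -
      \<comment> \<open>Each of the six values occurs once with either sign. The cancellation rules
        are switched off so that the normal forms of the two sides agree before anything
        cancels.\<close>
      have "x \<otimes> inv y \<otimes> z \<otimes> inv (x \<otimes> inv w \<otimes> u) \<otimes>
        (y \<otimes> inv w \<otimes> t) \<otimes> inv (z \<otimes> inv u \<otimes> t)
        = (t \<otimes> u \<otimes> w \<otimes> x \<otimes> y \<otimes> z) \<otimes> inv (t \<otimes> u \<otimes> w \<otimes> x \<otimes> y \<otimes> z)"
        using that by (simp add: A.inv_mult A.m_ac del: A.r_inv A.l_inv A.Units_r_inv A.Units_l_inv)
      then show ?thesis using that by simp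
    qed
    have "\<delta> 2 (\<delta> 1 h) gs = (h [c] \<otimes> inv h [b \<cdot> c] \<otimes> h [b]) \<otimes>
      inv (h [c] \<otimes> inv h [a \<cdot> b \<cdot> c] \<otimes> h [a \<cdot> b]) \<otimes>
      (h [b \<cdot> c] \<otimes> inv h [a \<cdot> b \<cdot> c] \<otimes> h [a]) \<otimes>
      inv (h [b] \<otimes> inv h [a \<cdot> b] \<otimes> h [a])"
      unfolding gs(1) using gs(2-) by (simp only: \<delta>2_apply[OF d1] \<delta>1_apply[OF assms] G.m_closed G.m_assoc)
    also have "\<dots> = \<one>" using v gs(2-) by (intro grp) simp_all
    finally show ?thesis .
  qed
  moreover have "\<delta> 2 (\<delta> 1 h) \<in> carrier (C 3)" using hom_in_carrier[OF \<delta>_hom d1] by (simp add: numeral_3_eq_3)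
  ultimately show ?thesis
    by (intro PiE_ext[of _ "tuples (carrier G) 3" "\<lambda>_. carrier A"]) (auto simp: carrier_C bar_cochains_def)
qed

lemma pred_tuples_Suc [simp]: "pred_tuples S (Suc n) = tuples S n"
  by (simp add: pred_tuples_def)

lemma carrier_RC: "carrier (RC n) = carrier (C n) \<times> (\<Pi>\<^sub>E x\<in>pred_tuples K n. carrier A)"
  by (simp add: rel_cochains_def)

lemma RC_comm_group: "comm_group (RC n)"
proof -
  interpret C: comm_group "C n" by (rule C_comm_group)
  interpret M: comm_group "map_group (pred_tuples K n) A" by (rule A.map_group_comm_group)
  show ?thesis unfolding rel_cochains_def
    by (rule group.group_comm_groupI[OF DirProd_group[OF C.is_group M.is_group]])
       (auto simp: mult_DirProd' C.m_comm M.m_comm simp del: mult_map_group carrier_map_group)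
qed

lemma keys_bar_boundary_pred:
  "gs \<in> tuples K n \<Longrightarrow> keys (bar_boundary G gs) \<subseteq> pred_tuples K n"
  using keys_bar_boundary_K by (cases n) (auto simp: bar_boundary_0)

lemma tuples_K_subset: "tuples K n \<subseteq> tuples (carrier G) n"
  using K.subset by (auto simp: tuples_def)

lemma R\<delta>_hom: "R\<delta> n \<in> hom (RC n) (RC (Suc n))"
proof -
  have lin: "k \<in> keys (bar_boundary G gs) \<rightarrow> carrier A"
    if "gs \<in> tuples K n" "k \<in> (\<Pi>\<^sub>E x\<in>pred_tuples K n. carrier A)" for gs k
    using keys_bar_boundary_pred[OF that(1)] that(2) by auto
  have hv: "h gs \<in> carrier A" if "h \<in> carrier (C n)" "gs \<in> tuples K n" for h gs
    using that tuples_K_subset by (auto simp: carrier_C)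
  show ?thesis
  proof (rule homI)
    fix z assume "z \<in> carrier (RC n)"
    then obtain h k where z: "z = (h, k)" "h \<in> carrier (C n)" "k \<in> (\<Pi>\<^sub>E x\<in>pred_tuples K n. carrier A)"
      by (auto simp: carrier_RC)
    show "R\<delta> n z \<in> carrier (RC (Suc n))"
      using hom_in_carrier[OF \<delta>_hom z(2)] A.linear_ext_closed[OF lin[OF _ z(3)]] hv[OF z(2)]
      by (auto simp: z(1) carrier_RC rel_coboundary_def)
    fix z' assume "z' \<in> carrier (RC n)"
    then obtain h' k' where z': "z' = (h', k')" "h' \<in> carrier (C n)" "k' \<in> (\<Pi>\<^sub>E x\<in>pred_tuples K n. carrier A)"
      by (auto simp: carrier_RC)
    have "linear_ext A (\<lambda>x\<in>pred_tuples K n. k x \<otimes> k' x) (bar_boundary G gs) =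
      linear_ext A k (bar_boundary G gs) \<otimes> linear_ext A k' (bar_boundary G gs)"
      if gs: "gs \<in> tuples K n" for gs
      by (rule A.linear_ext_multf[OF lin[OF gs z(3)] lin[OF gs z'(3)]])
         (use keys_bar_boundary_pred[OF gs] in auto)
    moreover have "(h \<otimes>\<^bsub>C n\<^esub> h') gs = h gs \<otimes> h' gs" if "gs \<in> tuples K n" for gs
      using that tuples_K_subset by (auto simp: bar_cochains_def)
    ultimately have "(h \<otimes>\<^bsub>C n\<^esub> h') gs \<otimes> inv linear_ext A (\<lambda>x\<in>pred_tuples K n. k x \<otimes> k' x) (bar_boundary G gs)
      = (h gs \<otimes> inv linear_ext A k (bar_boundary G gs)) \<otimes> (h' gs \<otimes> inv linear_ext A k' (bar_boundary G gs))"
      if gs: "gs \<in> tuples K n" for gs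
      using hv[OF z(2) gs] hv[OF z'(2) gs] A.linear_ext_closed[OF lin[OF gs z(3)]] A.linear_ext_closed[OF lin[OF gs z'(3)]] gs
      by (simp add: A.inv_mult A.m_ac)
    then show "R\<delta> n (z \<otimes>\<^bsub>RC n\<^esub> z') = R\<delta> n z \<otimes>\<^bsub>RC (Suc n)\<^esub> R\<delta> n z'"
      by (simp add: z(1) z'(1) rel_cochains_def rel_coboundary_def hom_mult[OF \<delta>_hom z(2) z'(2)] cong: restrict_cong)
  qed
qed

section \<open>Cocycles, coboundaries and cohomology in degrees one and two\<close>

definition "Z1 = kernel (C 1) (C (Suc 1)) (\<delta> 1)"
definition "B1 = coboundaries C \<delta> 1"
definition "Z2 = kernel (C 2) (C (Suc 2)) (\<delta> 2)"
definition "B2 = coboundaries C \<delta> 2"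
definition "RZ2 = kernel (RC 2) (RC (Suc 2)) (R\<delta> 2)"
definition "RB2 = coboundaries RC R\<delta> 2"

lemma C1_value: "v \<in> carrier (C 1) \<Longrightarrow> a \<in> carrier G \<Longrightarrow> v [a] \<in> carrier A"
  by (auto simp: carrier_C PiE_iff)

lemma C2_value: "h \<in> carrier (C 2) \<Longrightarrow> a \<in> carrier G \<Longrightarrow> b \<in> carrier G \<Longrightarrow> h [a, b] \<in> carrier A"
  by (auto simp: carrier_C PiE_iff numeral_2_eq_2)

lemma C2_eqI:
  assumes "h \<in> carrier (C 2)" "h' \<in> carrier (C 2)"
    "\<And>a b. a \<in> carrier G \<Longrightarrow> b \<in> carrier G \<Longrightarrow> h [a, b] = h' [a, b]"
  shows "h = h'"
proof (rule PiE_ext)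
  show "h \<in> (\<Pi>\<^sub>E x\<in>tuples (carrier G) 2. carrier A)" "h' \<in> (\<Pi>\<^sub>E x\<in>tuples (carrier G) 2. carrier A)"
    using assms by (simp_all add: carrier_C)
  fix gs assume "gs \<in> tuples (carrier G) 2"
  then show "h gs = h' gs" using assms(3) unfolding numeral_2_eq_2 by (elim tuples_2E) simp
qed

lemma \<delta>1_closed: "v \<in> carrier (C 1) \<Longrightarrow> \<delta> 1 v \<in> carrier (C 2)"
  using hom_in_carrier[OF \<delta>_hom, of v 1] by (simp add: numeral_2_eq_2)

lemma Z1_iff:
  "k \<in> Z1 \<longleftrightarrow> k \<in> carrier (C 1) \<and>
    (\<forall>a\<in>carrier G. \<forall>b\<in>carrier G. k [a \<cdot> b] = k [a] \<otimes> k [b])"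
proof -
  have "\<delta> 1 k = \<one>\<^bsub>C (Suc 1)\<^esub> \<longleftrightarrow> (\<forall>a\<in>carrier G. \<forall>b\<in>carrier G. k [a \<cdot> b] = k [a] \<otimes> k [b])"
    if k: "k \<in> carrier (C 1)"
  proof -
    interpret C2: comm_group "C 2" by (rule C_comm_group)
    have one: "\<one>\<^bsub>C 2\<^esub> [a, b] = \<one>" if "a \<in> carrier G" "b \<in> carrier G" for a b
      using that by (simp add: bar_cochains_def numeral_2_eq_2)
    have "\<delta> 1 k [a, b] = \<one> \<longleftrightarrow> k [a \<cdot> b] = k [a] \<otimes> k [b]" if ab: "a \<in> carrier G" "b \<in> carrier G" for a b
    proof -
      have "\<delta> 1 k [a, b] = k [a] \<otimes> k [b] \<otimes> inv k [a \<cdot> b]"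
        using \<delta>1_apply[OF k ab] C1_value[OF k] ab by (simp add: A.m_ac)
      then show ?thesis
        using C1_value[OF k] ab by (auto simp: A.mult_inv_eq_one_iff)
    qed
    then show ?thesis
      using C2_eqI[OF \<delta>1_closed[OF k] C2.one_closed] one by (auto simp: numeral_2_eq_2)
  qed
  then show ?thesis by (auto simp: Z1_def kernel_def)
qed

text \<open>The two faces of a 1-tuple coincide and cancel, the coefficients being trivial. Hence
  \<open>H\<^sup>1\<close> consists of homomorphisms and each of its classes is a singleton.\<close>

lemma B1_eq: "B1 = {\<one>\<^bsub>C 1\<^esub>}"
proof -
  interpret C0: comm_group "C 0" by (rule C_comm_group)
  have "\<delta> 0 h = \<one>\<^bsub>C 1\<^esub>" for h
    by (auto simp: bar_coboundary_def bar_cochains_def bar_boundary_1 elim!: tuples_1E intro!: restrict_ext)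
  then show ?thesis using C0.one_closed by (auto simp: B1_def coboundaries_def)
qed

lemma Z2_iff:
  "h \<in> Z2 \<longleftrightarrow> h \<in> carrier (C 2) \<and>
    (\<forall>a\<in>carrier G. \<forall>b\<in>carrier G. \<forall>c\<in>carrier G.
      h [b, c] \<otimes> h [a, b \<cdot> c] = h [a \<cdot> b, c] \<otimes> h [a, b])"
proof -
  have "\<delta> 2 h = \<one>\<^bsub>C (Suc 2)\<^esub> \<longleftrightarrow> (\<forall>a\<in>carrier G. \<forall>b\<in>carrier G. \<forall>c\<in>carrier G.
      h [b, c] \<otimes> h [a, b \<cdot> c] = h [a \<cdot> b, c] \<otimes> h [a, b])"
    if h: "h \<in> carrier (C 2)"
  proof -
    have *: "\<delta> 2 h [a, b, c] = \<one> \<longleftrightarrow>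
      h [b, c] \<otimes> h [a, b \<cdot> c] = h [a \<cdot> b, c] \<otimes> h [a, b]"
      if abc: "a \<in> carrier G" "b \<in> carrier G" "c \<in> carrier G" for a b c
    proof -
      note v = C2_value[OF h]
      have "\<delta> 2 h [a, b, c] = h [b, c] \<otimes> h [a, b \<cdot> c] \<otimes> inv (h [a \<cdot> b, c] \<otimes> h [a, b])"
        using \<delta>2_apply[OF h abc] v abc by (simp add: A.inv_mult A.m_ac)
      then show ?thesis
        using v abc by (simp add: A.mult_inv_eq_one_iff)
    qed
    have "\<delta> 2 h \<in> (\<Pi>\<^sub>E x\<in>tuples (carrier G) 3. carrier A)"
      using hom_in_carrier[OF \<delta>_hom h] by (simp add: carrier_C)
    then have "\<delta> 2 h = \<one>\<^bsub>C 3\<^esub> \<longleftrightarrow> (\<forall>gs\<in>tuples (carrier G) 3. \<delta> 2 h gs = \<one>)"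
      by (auto simp: bar_cochains_def PiE_iff extensional_def fun_eq_iff)
    also have "\<dots> \<longleftrightarrow> (\<forall>a\<in>carrier G. \<forall>b\<in>carrier G. \<forall>c\<in>carrier G. \<delta> 2 h [a, b, c] = \<one>)"
      unfolding numeral_3_eq_3 by (auto elim!: tuples_3E)
    finally show ?thesis using * by simp
  qed
  then show ?thesis by (auto simp: Z2_def kernel_def)
qed

lemma B2_eq: "B2 = \<delta> 1 ` carrier (C 1)"
  by (simp add: B2_def coboundaries_def numeral_2_eq_2)

lemma carrier_RC2: "carrier (RC 2) = carrier (C 2) \<times> (\<Pi>\<^sub>E x\<in>tuples K 1. carrier A)"
  by (simp add: carrier_RC pred_tuples_def numeral_2_eq_2)

text \<open>Additively, the last condition says that the coboundary of \<open>k\<close> is the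
  restriction of \<open>h\<close> to \<open>K\<close>. In other words, \<open>k\<close> splits over
  \<open>K\<close> the central extension defined by \<open>h\<close>.\<close>

lemma RZ2_iff:
  "(h, k) \<in> RZ2 \<longleftrightarrow> h \<in> Z2 \<and> k \<in> (\<Pi>\<^sub>E x\<in>tuples K 1. carrier A) \<and>
    (\<forall>a\<in>K. \<forall>b\<in>K. h [a, b] \<otimes> k [a \<cdot> b] = k [a] \<otimes> k [b])"
proof -
  have "(\<lambda>b\<in>tuples K 2. h b \<otimes> inv (linear_ext A k (bar_boundary G b))) = (\<lambda>b\<in>tuples K 2. \<one>) \<longleftrightarrow>
    (\<forall>a\<in>K. \<forall>b\<in>K. h [a, b] \<otimes> k [a \<cdot> b] = k [a] \<otimes> k [b])"
    if h: "h \<in> carrier (C 2)" and k: "k \<in> (\<Pi>\<^sub>E x\<in>tuples K 1. carrier A)"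
  proof -
    have kv: "k [a] \<in> carrier A" if "a \<in> K" for a using k that by (auto simp: PiE_iff)
    have "h [a, b] \<otimes> inv (linear_ext A k (bar_boundary G [a, b])) = \<one> \<longleftrightarrow>
        h [a, b] \<otimes> k [a \<cdot> b] = k [a] \<otimes> k [b]" if ab: "a \<in> K" "b \<in> K" for a b
    proof -
      have abG: "a \<in> carrier G" "b \<in> carrier G" using ab K.subset by auto
      have "k \<in> keys (frag_of [b] - frag_of [a \<cdot> b]) \<rightarrow> carrier A"
        using keys_diff[of "frag_of [b]" "frag_of [a \<cdot> b]"] kv ab by (auto simp: keys_frag_of)
      then have "linear_ext A k (bar_boundary G [a, b]) = k [b] \<otimes> inv k [a \<cdot> b] \<otimes> k [a]"
        using kv ab by (simp add: bar_boundary_2 A.linear_ext_add A.linear_ext_diff keys_frag_of)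
      then have "h [a, b] \<otimes> inv (linear_ext A k (bar_boundary G [a, b])) =
          h [a, b] \<otimes> k [a \<cdot> b] \<otimes> inv (k [a] \<otimes> k [b])"
        using kv ab C2_value[OF h abG] by (simp add: A.inv_mult A.m_ac)
      then show ?thesis
        using kv ab C2_value[OF h abG] by (simp add: A.mult_inv_eq_one_iff)
    qed
    moreover have "(\<lambda>b\<in>tuples K 2. h b \<otimes> inv (linear_ext A k (bar_boundary G b))) = (\<lambda>b\<in>tuples K 2. \<one>) \<longleftrightarrow>
       (\<forall>gs\<in>tuples K 2. h gs \<otimes> inv (linear_ext A k (bar_boundary G gs)) = \<one>)"
      by (auto simp: fun_eq_iff restrict_def)
    moreover have "\<dots> \<longleftrightarrow> (\<forall>a\<in>K. \<forall>b\<in>K. h [a, b] \<otimes> inv (linear_ext A k (bar_boundary G [a, b])) = \<one>)"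
      unfolding numeral_2_eq_2 by (auto elim!: tuples_2E)
    ultimately show ?thesis by simp
  qed
  then show ?thesis
    unfolding RZ2_def Z2_def
    by (auto simp: kernel_def carrier_RC2 rel_coboundary_def rel_cochains_def pred_tuples_def)
qed

text \<open>\<open>bar_boundary\<close> of a 1-tuple vanishes, so the value of
  \<open>R\<delta> 1\<close> at \<open>(v, k)\<close> is determined by \<open>v\<close>.\<close>

lemma RB2_eq: "RB2 = (\<lambda>v. (\<delta> 1 v, restrict v (tuples K 1))) ` carrier (C 1)"
proof -
  have R1: "R\<delta> 1 (v, k) = (\<delta> 1 v, restrict v (tuples K 1))" if v: "v \<in> carrier (C 1)" for v k
  proof -
    have "v b \<otimes> inv (linear_ext A k (bar_boundary G b)) = v b" if "b \<in> tuples K (Suc 0)" for b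
      using that C1_value[OF v] K.subset by (elim tuples_1E) (auto simp: bar_boundary_1)
    then show ?thesis unfolding rel_coboundary_def by (auto intro: restrict_ext)
  qed
  have ne: "(\<lambda>x\<in>pred_tuples K 1. \<one>) \<in> (\<Pi>\<^sub>E x\<in>pred_tuples K 1. carrier A)" by auto
  have "RB2 = R\<delta> 1 ` (carrier (C 1) \<times> (\<Pi>\<^sub>E x\<in>pred_tuples K 1. carrier A))"
    by (simp add: RB2_def coboundaries_def numeral_2_eq_2 carrier_RC)
  also have "\<dots> = (\<lambda>v. (\<delta> 1 v, restrict v (tuples K 1))) ` carrier (C 1)"
  proof (intro subset_antisym subsetI)
    fix z assume "z \<in> R\<delta> 1 ` (carrier (C 1) \<times> (\<Pi>\<^sub>E x\<in>pred_tuples K 1. carrier A))"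
    then obtain v k where "v \<in> carrier (C 1)" "z = R\<delta> 1 (v, k)" by blast
    then show "z \<in> (\<lambda>v. (\<delta> 1 v, restrict v (tuples K 1))) ` carrier (C 1)" using R1 by blast
  next
    fix z assume "z \<in> (\<lambda>v. (\<delta> 1 v, restrict v (tuples K 1))) ` carrier (C 1)"
    then obtain v where v: "v \<in> carrier (C 1)" "z = (\<delta> 1 v, restrict v (tuples K 1))" by blast
    then show "z \<in> R\<delta> 1 ` (carrier (C 1) \<times> (\<Pi>\<^sub>E x\<in>pred_tuples K 1. carrier A))"
      using R1[OF v(1), of "\<lambda>x\<in>pred_tuples K 1. \<one>"] ne by (metis SigmaI imageI)
  qed
  finally show ?thesis .
qed

lemma B2_subset: "B2 \<subseteq> Z2"
  using \<delta>2_\<delta>1 \<delta>1_closed unfolding B2_eq Z2_def by (auto simp: kernel_def)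

lemma RB2_subset: "RB2 \<subseteq> RZ2"
proof
  fix z assume "z \<in> RB2"
  then obtain v where v: "v \<in> carrier (C 1)" "z = (\<delta> 1 v, restrict v (tuples K 1))" by (auto simp: RB2_eq)
  have "\<delta> 1 v [a, b] \<otimes> v [a \<cdot> b] = v [a] \<otimes> v [b]" if "a \<in> K" "b \<in> K" for a b
  proof -
    have ab: "a \<in> carrier G" "b \<in> carrier G" using that K.subset by auto
    then have c: "v [a] \<in> carrier A" "v [b] \<in> carrier A" "v [a \<cdot> b] \<in> carrier A" using C1_value[OF v(1)] by auto
    have "\<delta> 1 v [a, b] \<otimes> v [a \<cdot> b] = v [a] \<otimes> v [b] \<otimes> (inv v [a \<cdot> b] \<otimes> v [a \<cdot> b])"
      using \<delta>1_apply[OF v(1) ab] c by (simp add: A.m_ac del: A.l_inv A.r_inv A.Units_l_inv A.Units_r_inv)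
    then show ?thesis using c by simp
  qed
  moreover have "\<delta> 1 v \<in> Z2" using B2_subset v(1) by (auto simp: B2_eq)
  moreover have "v [a] \<in> carrier A" if "a \<in> K" for a using C1_value[OF v(1)] that K.subset by auto
  ultimately show "z \<in> RZ2"
    using K.m_closed by (auto simp: v(2) RZ2_iff elim!: tuples_1E)
qed

sublocale H1: subquotient "C 1" Z1 B1
proof -
  interpret c: comm_group "C 1" by (rule C_comm_group)
  interpret d: group_hom "C 1" "C (Suc 1)" "\<delta> 1"
    using \<delta>_hom[of 1] C_comm_group by (simp add: group_hom_iff comm_group.axioms(2))
  show "subquotient (C 1) Z1 B1"
  proof (intro subquotient.intro subquotient_axioms.intro c.comm_group_axioms)
    show "subgroup Z1 (C 1)" unfolding Z1_def by (rule d.subgroup_kernel)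
    then show "B1 \<subseteq> Z1" unfolding B1_eq using subgroup.one_closed by blast
    show "subgroup B1 (C 1)" unfolding B1_eq by (rule c.triv_subgroup)
  qed
qed

sublocale H2: subquotient "C 2" Z2 B2
proof -
  interpret c: comm_group "C 2" by (rule C_comm_group)
  interpret d: group_hom "C 2" "C (Suc 2)" "\<delta> 2"
    using \<delta>_hom[of 2] C_comm_group by (simp add: group_hom_iff comm_group.axioms(2))
  interpret d1: group_hom "C 1" "C 2" "\<delta> 1"
    using \<delta>_hom[of 1] C_comm_group by (simp add: group_hom_iff comm_group.axioms(2) numeral_2_eq_2)
  show "subquotient (C 2) Z2 B2"
  proof (intro subquotient.intro subquotient_axioms.intro c.comm_group_axioms)
    show "subgroup Z2 (C 2)" unfolding Z2_def by (rule d.subgroup_kernel)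
    show "B2 \<subseteq> Z2" by (rule B2_subset)
    show "subgroup B2 (C 2)" unfolding B2_eq by (rule d1.img_is_subgroup)
  qed
qed

sublocale R2: subquotient "RC 2" RZ2 RB2
proof -
  interpret c: comm_group "RC 2" by (rule RC_comm_group)
  interpret d: group_hom "RC 2" "RC (Suc 2)" "R\<delta> 2"
    using R\<delta>_hom[of 2] RC_comm_group by (simp add: group_hom_iff comm_group.axioms(2))
  interpret d1: group_hom "RC 1" "RC 2" "R\<delta> 1"
    using R\<delta>_hom[of 1] RC_comm_group by (simp add: group_hom_iff comm_group.axioms(2) numeral_2_eq_2)
  show "subquotient (RC 2) RZ2 RB2"
  proof (intro subquotient.intro subquotient_axioms.intro c.comm_group_axioms)
    show "subgroup RZ2 (RC 2)" unfolding RZ2_def by (rule d.subgroup_kernel)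
    show "RB2 \<subseteq> RZ2" by (rule RB2_subset)
    have "RB2 = R\<delta> 1 ` carrier (RC 1)" by (simp add: RB2_def coboundaries_def numeral_2_eq_2)
    then show "subgroup RB2 (RC 2)" using d1.img_is_subgroup by simp
  qed
qed

lemma group_cohomology_1: "group_cohomology G A 1 = H1.Q"
  by (simp add: group_cohomology_def cohomology_def Z1_def B1_def)

lemma rel_cohomology_2: "rel_cohomology G K A 2 = R2.Q"
  by (simp add: rel_cohomology_def cohomology_def RZ2_def RB2_def)

lemma rel_to_abs_cls:
  assumes "(h, k) \<in> RZ2"
  shows "rel_to_abs G A 2 (RB2 #>\<^bsub>RC 2\<^esub> (h, k)) = B2 #>\<^bsub>C 2\<^esub> h"
proof -
  let ?f = "\<lambda>(h, k). cohomology_class C \<delta> 2 h"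
  have h: "h \<in> Z2" using assms by (simp add: RZ2_iff)
  have "?f (n \<otimes>\<^bsub>RC 2\<^esub> (h, k)) = ?f (h, k)" if n: "n \<in> RB2" for n
  proof -
    obtain v where v: "v \<in> carrier (C 1)" "n = (\<delta> 1 v, restrict v (tuples K 1))"
      using n by (auto simp: RB2_eq)
    have "\<delta> 1 v \<in> B2" using v(1) by (auto simp: B2_eq)
    from H2.cls_absorb[OF this h] show ?thesis
      by (simp add: v(2) rel_cochains_def cohomology_class_def B2_def)
  qed
  then have "class_map ?f (RB2 #>\<^bsub>RC 2\<^esub> (h, k)) = ?f (h, k)" by (rule R2.class_map_cls[OF assms])
  then show ?thesis by (simp add: rel_to_abs_def cohomology_class_def B2_def)
qed

lemma rel_to_abs_hom: "rel_to_abs G A 2 \<in> hom R2.Q H2.Q"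
proof (rule homI)
  fix x assume "x \<in> carrier R2.Q"
  then obtain h k where x: "(h, k) \<in> RZ2" "x = RB2 #>\<^bsub>RC 2\<^esub> (h, k)" by (auto simp: R2.carrier_Q)
  then have h: "h \<in> Z2" by (simp add: RZ2_iff)
  show "rel_to_abs G A 2 x \<in> carrier H2.Q" using H2.cls_closed[OF h] by (simp add: x rel_to_abs_cls)
  fix y assume "y \<in> carrier R2.Q"
  then obtain h' k' where y: "(h', k') \<in> RZ2" "y = RB2 #>\<^bsub>RC 2\<^esub> (h', k')" by (auto simp: R2.carrier_Q)
  then have h': "h' \<in> Z2" by (simp add: RZ2_iff)
  have m: "(h, k) \<otimes>\<^bsub>RC 2\<^esub> (h', k') \<in> RZ2" using subgroup.m_closed[OF R2.K x(1) y(1)] .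
  have e: "(h, k) \<otimes>\<^bsub>RC 2\<^esub> (h', k') = (h \<otimes>\<^bsub>C 2\<^esub> h', k \<otimes>\<^bsub>map_group (pred_tuples K 2) A\<^esub> k')"
    by (simp add: rel_cochains_def)
  have "rel_to_abs G A 2 (x \<otimes>\<^bsub>R2.Q\<^esub> y) = B2 #>\<^bsub>C 2\<^esub> (h \<otimes>\<^bsub>C 2\<^esub> h')"
    unfolding x(2) y(2) R2.cls_mult[OF x(1) y(1)] using rel_to_abs_cls m unfolding e by blast
  then show "rel_to_abs G A 2 (x \<otimes>\<^bsub>R2.Q\<^esub> y) = rel_to_abs G A 2 x \<otimes>\<^bsub>H2.Q\<^esub> rel_to_abs G A 2 y"
    unfolding H2.cls_mult[OF h h', symmetric] x(2) y(2) rel_to_abs_cls[OF x(1)] rel_to_abs_cls[OF y(1)] .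
qed

section \<open>The long exact sequence at the relative group\<close>

lemma group_pair_K: "group_pair (G\<lparr>carrier := K\<rparr>) A K"
proof (intro group_pair.intro)
  show g: "group (G\<lparr>carrier := K\<rparr>)" by (rule G.subgroup_imp_group) unfold_locales
  show "comm_group A" by unfold_locales
  show "subgroup K (G\<lparr>carrier := K\<rparr>)" using group.subgroup_self[OF g] by simp
qed

text \<open>This is Hom(K, A), encoded on lists of length one so that its elements are literally the
  1-cocycles of the subgroup.\<close>

definition "homs1 = {k \<in> (\<Pi>\<^sub>E x\<in>tuples K 1. carrier A). \<forall>a\<in>K. \<forall>b\<in>K. k [a \<cdot> b] = k [a] \<otimes> k [b]}"

lemma carrier_H1_K:
  "carrier (group_cohomology (G\<lparr>carrier := K\<rparr>) A 1) = (\<lambda>k. {k}) ` homs1"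
proof -
  interpret K': group_pair "G\<lparr>carrier := K\<rparr>" A K by (rule group_pair_K)
  have Z: "K'.Z1 = homs1" by (auto simp: K'.Z1_iff homs1_def K'.carrier_C)
  have "K'.B1 #>\<^bsub>K'.C 1\<^esub> k = {k}" if "k \<in> K'.Z1" for k
    using K'.H1.K_carrier[OF that] comm_group.axioms(2)[OF K'.C_comm_group]
    by (simp add: K'.B1_eq r_coset_def group.is_monoid)
  then have "(\<lambda>k. K'.B1 #>\<^bsub>K'.C 1\<^esub> k) ` K'.Z1 = (\<lambda>k. {k}) ` homs1" unfolding Z by (intro image_cong) auto
  then show ?thesis by (simp only: K'.group_cohomology_1 K'.H1.carrier_Q)
qed

lemma int_pow_H1_K:
  assumes "k \<in> homs1" "{k} [^]\<^bsub>group_cohomology (G\<lparr>carrier := K\<rparr>) A 1\<^esub> (m::int) =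
      \<one>\<^bsub>group_cohomology (G\<lparr>carrier := K\<rparr>) A 1\<^esub>" "a \<in> K"
  shows "k [a] [^] m = \<one>"
proof -
  interpret K': group_pair "G\<lparr>carrier := K\<rparr>" A K by (rule group_pair_K)
  have k: "k \<in> K'.Z1" using assms(1) by (auto simp: K'.Z1_iff homs1_def K'.carrier_C)
  have c: "k \<in> carrier (map_group (tuples K 1) A)" using assms(1) by (simp add: homs1_def)
  have "K'.B1 #>\<^bsub>K'.C 1\<^esub> k = {k}"
    using K'.H1.K_carrier[OF k] comm_group.axioms(2)[OF K'.C_comm_group]
    by (simp add: K'.B1_eq r_coset_def group.is_monoid)
  then have "K'.B1 #>\<^bsub>K'.C 1\<^esub> (k [^]\<^bsub>K'.C 1\<^esub> m) = \<one>\<^bsub>K'.H1.Q\<^esub>"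
    using assms(2) unfolding K'.group_cohomology_1 by (metis K'.H1.cls_pow k)
  then have "k [^]\<^bsub>K'.C 1\<^esub> m \<in> K'.B1"
    using K'.H1.cls_eq_one_iff[OF K'.H1.subgroup_int_pow_closed[OF K'.H1.K k]] by simp
  then have "k [^]\<^bsub>map_group (tuples K 1) A\<^esub> m = (\<lambda>x\<in>tuples K 1. \<one>)"
    by (simp add: K'.B1_eq bar_cochains_def)
  then have "(\<lambda>x\<in>tuples K 1. k x [^] m) [a] = (\<lambda>x\<in>tuples K 1. \<one>) [a]"
    unfolding A.int_pow_map_group[OF c] by simp
  then show ?thesis using assms(3) by simp
qed

lemma connecting_map_cls:
  assumes "k \<in> homs1"
  shows "connecting_map G K A 1 {k} = RB2 #>\<^bsub>RC 2\<^esub> (\<one>\<^bsub>C 2\<^esub>, k)"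
  by (simp add: connecting_map_def class_map_def cohomology_class_def RB2_def numeral_2_eq_2)

abbreviation "CI \<equiv> connecting_map G K A 1 ` carrier (group_cohomology (G\<lparr>carrier := K\<rparr>) A 1)"

lemma CI_eq: "CI = (\<lambda>k. RB2 #>\<^bsub>RC 2\<^esub> (\<one>\<^bsub>C 2\<^esub>, k)) ` homs1"
  unfolding carrier_H1_K image_image using connecting_map_cls by simp

lemma one_homs1_RZ2: "k \<in> homs1 \<Longrightarrow> (\<one>\<^bsub>C 2\<^esub>, k) \<in> RZ2"
proof -
  assume k: "k \<in> homs1"
  interpret c: comm_group "C 2" by (rule C_comm_group)
  have "\<one>\<^bsub>C 2\<^esub> \<in> Z2" using subgroup.one_closed[OF H2.K] .
  moreover have "\<one>\<^bsub>C 2\<^esub> [a, b] = \<one>" if "a \<in> K" "b \<in> K" for a b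
    using that K.subset by (auto simp: bar_cochains_def numeral_2_eq_2)
  moreover have "k [a] \<in> carrier A" if "a \<in> K" for a using k that by (auto simp: homs1_def PiE_iff)
  ultimately show ?thesis using k by (simp add: RZ2_iff homs1_def)
qed

text \<open>Exactness at the relative group. If \<open>h\<close> is the coboundary of
  \<open>v\<close>, then subtracting the relative coboundary of \<open>v\<close> from
  \<open>(h, k)\<close> leaves, additively, the pair \<open>(0, k - v)\<close>, and the relative
  cocycle condition turns \<open>k - v\<close> into a homomorphism on \<open>K\<close>.\<close>

lemma CI_kernel: "CI = kernel R2.Q H2.Q (rel_to_abs G A 2)"
proof (intro subset_antisym subsetI)
  fix z assume "z \<in> CI"
  then obtain k where k: "k \<in> homs1" "z = RB2 #>\<^bsub>RC 2\<^esub> (\<one>\<^bsub>C 2\<^esub>, k)" unfolding CI_eq by blast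
  have "rel_to_abs G A 2 z = B2 #>\<^bsub>C 2\<^esub> \<one>\<^bsub>C 2\<^esub>" using rel_to_abs_cls[OF one_homs1_RZ2[OF k(1)]] k(2) by simp
  also have "\<dots> = \<one>\<^bsub>H2.Q\<^esub>"
    using H2.cls_eq_one_iff[OF subgroup.one_closed[OF H2.K]] subgroup.one_closed[OF H2.N] by simp
  finally show "z \<in> kernel R2.Q H2.Q (rel_to_abs G A 2)"
    using R2.cls_closed[OF one_homs1_RZ2[OF k(1)]] k(2) by (simp add: kernel_def)
next
  fix z assume z: "z \<in> kernel R2.Q H2.Q (rel_to_abs G A 2)"
  then obtain h k where hk: "(h, k) \<in> RZ2" "z = RB2 #>\<^bsub>RC 2\<^esub> (h, k)" by (auto simp: kernel_def R2.carrier_Q)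
  then have h: "h \<in> Z2" and k: "k \<in> (\<Pi>\<^sub>E x\<in>tuples K 1. carrier A)" by (simp_all add: RZ2_iff)
  have "B2 #>\<^bsub>C 2\<^esub> h = \<one>\<^bsub>H2.Q\<^esub>" using z rel_to_abs_cls[OF hk(1)] hk(2) by (simp add: kernel_def)
  then have "h \<in> B2" using H2.cls_eq_one_iff[OF h] by simp
  then obtain v where v: "v \<in> carrier (C 1)" "h = \<delta> 1 v" by (auto simp: B2_eq)
  let ?k' = "\<lambda>x\<in>tuples K 1. k x \<otimes> inv v x"
  have vK: "v [a] \<in> carrier A" "k [a] \<in> carrier A" if "a \<in> K" for a
    using C1_value[OF v(1)] that K.subset k by (auto simp: PiE_iff)
  have "k [a \<cdot> b] \<otimes> inv v [a \<cdot> b] =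
      (k [a] \<otimes> inv v [a]) \<otimes> (k [b] \<otimes> inv v [b])" if ab: "a \<in> K" "b \<in> K" for a b
  proof -
    have abG: "a \<in> carrier G" "b \<in> carrier G" using ab K.subset by auto
    have "(v [b] \<otimes> inv v [a \<cdot> b] \<otimes> v [a]) \<otimes> k [a \<cdot> b] = k [a] \<otimes> k [b]"
      using hk(1) ab unfolding RZ2_iff v(2) \<delta>1_apply[OF v(1) abG, symmetric] by blast
    then have "(k [a] \<otimes> k [b]) \<otimes> inv (v [a] \<otimes> v [b]) =
        (v [b] \<otimes> inv v [a \<cdot> b] \<otimes> v [a]) \<otimes> k [a \<cdot> b] \<otimes> inv (v [a] \<otimes> v [b])" by simp
    also have "\<dots> = k [a \<cdot> b] \<otimes> inv v [a \<cdot> b] \<otimes> ((v [a] \<otimes> v [b]) \<otimes> inv (v [a] \<otimes> v [b]))"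
      using vK ab by (simp add: A.m_ac A.inv_mult del: A.l_inv A.r_inv A.Units_l_inv A.Units_r_inv)
    also have "\<dots> = k [a \<cdot> b] \<otimes> inv v [a \<cdot> b]" using vK ab by simp
    finally show ?thesis using vK ab by (simp add: A.m_ac A.inv_mult)
  qed
  then have k': "?k' \<in> homs1" using vK K.m_closed by (auto simp: homs1_def elim!: tuples_1E)
  have "k x = v x \<otimes> (k x \<otimes> inv v x)" if "x \<in> tuples K 1" for x
    using that vK unfolding One_nat_def
    by (elim tuples_1E) (simp add: A.m_lcomm)
  then have "k = (\<lambda>x\<in>tuples K 1. v x \<otimes> ?k' x)" using k by (auto simp: fun_eq_iff PiE_iff extensional_def)
  moreover have "h = \<delta> 1 v \<otimes>\<^bsub>C 2\<^esub> \<one>\<^bsub>C 2\<^esub>"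
    using monoid.r_one[OF group.is_monoid[OF comm_group.axioms(2)[OF C_comm_group]] \<delta>1_closed[OF v(1)]] v(2) by simp
  ultimately have "(h, k) = (\<delta> 1 v, restrict v (tuples K 1)) \<otimes>\<^bsub>RC 2\<^esub> (\<one>\<^bsub>C 2\<^esub>, ?k')"
    by (simp add: rel_cochains_def pred_tuples_def numeral_2_eq_2 cong: restrict_cong)
  moreover have "(\<delta> 1 v, restrict v (tuples K 1)) \<in> RB2" using v(1) by (auto simp: RB2_eq)
  ultimately have "z = RB2 #>\<^bsub>RC 2\<^esub> (\<one>\<^bsub>C 2\<^esub>, ?k')"
    using R2.cls_absorb[OF _ one_homs1_RZ2[OF k']] hk(2) by simp
  then show "z \<in> CI" unfolding CI_eq using k' by blast
qed

text \<open>The first component is neutral and the second is torsion value by value. This transfers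
  torsion from \<open>H\<^sup>1\<close> of the stabilizer to the kernel of the quotient map onto
  \<open>T_target\<close>.\<close>

lemma connecting_pow_trivial:
  assumes k: "k \<in> homs1" and m: "\<And>a. a \<in> K \<Longrightarrow> k [a] [^] (m::int) = \<one>"
  shows "(RB2 #>\<^bsub>RC 2\<^esub> (\<one>\<^bsub>C 2\<^esub>, k)) [^]\<^bsub>R2.Q\<^esub> m = \<one>\<^bsub>R2.Q\<^esub>"
proof -
  let ?M = "map_group (pred_tuples K 2) A"
  have pt: "pred_tuples K 2 = tuples K 1" by (simp add: pred_tuples_def numeral_2_eq_2)
  note grp = comm_group.axioms(2)[OF C_comm_group] comm_group.axioms(2)[OF A.map_group_comm_group]
  have RC: "RC 2 = C 2 \<times>\<times> ?M" by (simp add: rel_cochains_def)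
  have z: "(\<one>\<^bsub>C 2\<^esub>, k) \<in> carrier (RC 2)" using R2.K_carrier[OF one_homs1_RZ2[OF k]] .
  have kM: "k \<in> carrier (map_group (tuples K 1) A)" using k by (simp add: homs1_def)
  have fst: "fst \<in> hom (RC 2) (C 2)" and snd: "snd \<in> hom (RC 2) ?M"
    unfolding RC by (auto simp: hom_def mult_DirProd' simp del: mult_map_group carrier_map_group)
  have "fst ((\<one>\<^bsub>C 2\<^esub>, k) [^]\<^bsub>RC 2\<^esub> m) = \<one>\<^bsub>C 2\<^esub>"
    using hom_int_pow[OF fst z R2.is_group grp(1), of m] group.int_pow_one[OF grp(1)] by simp
  moreover have "snd ((\<one>\<^bsub>C 2\<^esub>, k) [^]\<^bsub>RC 2\<^esub> m) = \<one>\<^bsub>?M\<^esub>"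
  proof -
    have "snd ((\<one>\<^bsub>C 2\<^esub>, k) [^]\<^bsub>RC 2\<^esub> m) = (\<lambda>x\<in>tuples K 1. k x [^] m)"
      using hom_int_pow[OF snd z R2.is_group grp(2), of m] A.int_pow_map_group[OF kM] by (simp add: pt)
    also have "\<dots> = (\<lambda>x\<in>tuples K 1. \<one>)"
      unfolding One_nat_def using m by (intro restrict_ext) (auto elim!: tuples_1E)
    finally show ?thesis by (simp add: pt)
  qed
  ultimately have "(\<one>\<^bsub>C 2\<^esub>, k) [^]\<^bsub>RC 2\<^esub> m = \<one>\<^bsub>RC 2\<^esub>" by (simp add: RC prod_eq_iff)
  then show ?thesis
    unfolding R2.cls_pow[OF one_homs1_RZ2[OF k]]
    using R2.cls_eq_one_iff[OF subgroup.one_closed[OF R2.K]] subgroup.one_closed[OF R2.N] by simp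
qed

end

section \<open>Quandle cocycles and homomorphisms on the stabilizer\<close>

locale pointed_quandle = quandle X + A: comm_group A
  for X :: "('a, 'z) quandle_struct_scheme" and A :: "('b, 'm) monoid_scheme" (structure) +
  fixes x0 :: 'a
  assumes base [simp]: "x0 \<in> carrier X"
    and transitive: "\<And>x y. x \<in> carrier X \<Longrightarrow> y \<in> carrier X \<Longrightarrow> \<exists>\<sigma>\<in>carrier (Inn X). \<sigma> x = y"
begin

abbreviation op (infixl "\<rhd>" 70) where "x \<rhd> y \<equiv> x \<triangleright>\<^bsub>X\<^esub> y"

lemma subgroup_Stab: "subgroup (Stab X x0) (Inn X)"
proof (rule Inn.subgroupI)
  show "Stab X x0 \<subseteq> carrier (Inn X)" by (auto simp: Stab_def)
  have "\<one>\<^bsub>Inn X\<^esub> \<in> Stab X x0" by (simp add: Stab_def)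
  then show "Stab X x0 \<noteq> {}" by blast
next
  fix \<sigma> assume "\<sigma> \<in> Stab X x0"
  then show "inv\<^bsub>Inn X\<^esub> \<sigma> \<in> Stab X x0" using Inn_inv_apply(1)[of \<sigma> x0] by (simp add: Stab_def)
next
  fix \<sigma> \<tau> assume "\<sigma> \<in> Stab X x0" "\<tau> \<in> Stab X x0"
  then show "\<sigma> \<bullet> \<tau> \<in> Stab X x0" by (simp add: Stab_def)
qed

sublocale GP: group_pair "Inn X" A "Stab X x0"
  by (rule group_pair.intro[OF Inn.is_group A.comm_group_axioms subgroup_Stab])

abbreviation "AS \<equiv> {h \<in> carrier (As X). psi X h x0 = x0}"

lemma AS_Stab: "h \<in> AS \<longleftrightarrow> h \<in> carrier (As X) \<and> psi X h \<in> Stab X x0"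
  unfolding Stab_def using psi.hom_closed by blast

lemma subgroup_AS: "subgroup AS (As X)"
proof (rule As.subgroupI)
  have "\<one>\<^bsub>As X\<^esub> \<in> AS" by simp
  then show "AS \<noteq> {}" by blast
next
  fix h assume "h \<in> AS"
  then show "inv\<^bsub>As X\<^esub> h \<in> AS" using Inn_inv_apply(1)[of "psi X h" x0] by simp
qed auto

lemma kernel_psi_AS: "k \<in> kernel (As X) (Inn X) (psi X) \<Longrightarrow> k \<in> AS"
  by (simp add: kernel_def)

abbreviation "AG \<equiv> As_Stab_group X x0"

lemma carrier_AG [simp]: "carrier AG = AS"
  by (simp add: As_Stab_group_def)

lemma mult_AG [simp]: "g \<otimes>\<^bsub>AG\<^esub> h = g \<star> h"
  by (simp add: As_Stab_group_def)

lemma group_AG: "group AG"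
  unfolding As_Stab_group_def by (rule As.subgroup_imp_group[OF subgroup_AS])

lemma base_AS: "e x0 \<in> AS"
  by (simp add: idem)

text \<open>These are the multiplicative functions on the action groupoid of \<open>As X\<close> on
  \<open>X\<close>, with \<open>\<Phi> a g\<close> the value on the arrow from \<open>a\<close> to
  \<open>psi X g a\<close>. Restricted to loops at \<open>x0\<close> they are homomorphisms on the
  stabilizer.\<close>

definition crossed :: "('a \<Rightarrow> 'a word set \<Rightarrow> 'b) \<Rightarrow> bool" where
  "crossed \<Phi> \<longleftrightarrow> (\<forall>a\<in>carrier X. \<forall>g\<in>carrier (As X). \<Phi> a g \<in> carrier A \<and>
     (\<forall>h\<in>carrier (As X). \<Phi> a (g \<star> h) = \<Phi> a g \<otimes> \<Phi> (psi X g a) h))"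

lemma crossed_closed: "crossed \<Phi> \<Longrightarrow> a \<in> carrier X \<Longrightarrow> g \<in> carrier (As X) \<Longrightarrow> \<Phi> a g \<in> carrier A"
  by (simp add: crossed_def)

lemma crossed_mult: "crossed \<Phi> \<Longrightarrow> a \<in> carrier X \<Longrightarrow> g \<in> carrier (As X) \<Longrightarrow> h \<in> carrier (As X) \<Longrightarrow>
    \<Phi> a (g \<star> h) = \<Phi> a g \<otimes> \<Phi> (psi X g a) h"
  by (simp add: crossed_def)

lemma crossed_one:
  assumes "crossed \<Phi>" "a \<in> carrier X"
  shows "\<Phi> a \<one>\<^bsub>As X\<^esub> = \<one>"
proof -
  have "\<Phi> a \<one>\<^bsub>As X\<^esub> = \<Phi> a \<one>\<^bsub>As X\<^esub> \<otimes> \<Phi> a \<one>\<^bsub>As X\<^esub>"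
    using crossed_mult[OF assms As.one_closed As.one_closed] assms(2) by simp
  then show ?thesis using crossed_closed[OF assms As.one_closed] A.l_cancel_one' by metis
qed

lemma crossed_inv:
  assumes "crossed \<Phi>" "a \<in> carrier X" "g \<in> carrier (As X)"
  shows "\<Phi> a (inv\<^bsub>As X\<^esub> g) = inv \<Phi> ((inv\<^bsub>Inn X\<^esub> psi X g) a) g"
proof -
  have "\<Phi> a (inv\<^bsub>As X\<^esub> g) \<otimes> \<Phi> ((inv\<^bsub>Inn X\<^esub> psi X g) a) g = \<one>"
    using crossed_mult[OF assms(1,2) As.inv_closed[OF assms(3)] assms(3)] crossed_one[OF assms(1,2)] assms(3)
    by simp
  then show ?thesis
    using crossed_closed[OF assms(1)] assms by (intro A.inv_equality[symmetric]) auto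
qed

lemma crossed_hom:
  assumes "crossed \<Phi>"
  shows "\<Phi> x0 \<in> hom AG A"
  by (rule homI) (use crossed_closed[OF assms] crossed_mult[OF assms] in auto)

text \<open>Identities between evaluations of cocycles reduce by this to their values on generators,
  without computing with chains.\<close>

lemma crossed_unique:
  assumes \<Phi>: "crossed \<Phi>" and \<Psi>: "crossed \<Psi>"
    and gen: "\<And>a y. a \<in> carrier X \<Longrightarrow> y \<in> carrier X \<Longrightarrow> \<Phi> a (e y) = \<Psi> a (e y)"
    and "a \<in> carrier X" "g \<in> carrier (As X)"
  shows "\<Phi> a g = \<Psi> a g"
  using assms(5,4)
  by (induction g arbitrary: a rule: As_induct)
     (simp_all add: gen crossed_one crossed_inv crossed_mult \<Phi> \<Psi>)

section \<open>Quandle 2-cocycles and their evaluation along words\<close>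

abbreviation "ZQ \<equiv> quandle_cocycles2 X A"
abbreviation "BQ \<equiv> quandle_coboundaries2 X A"
abbreviation "MQ \<equiv> map_group (carrier X \<times> carrier X) A"

lemma MQ_value: "f \<in> carrier MQ \<Longrightarrow> x \<in> carrier X \<Longrightarrow> y \<in> carrier X \<Longrightarrow> f (x, y) \<in> carrier A"
  by (auto simp: PiE_iff)

lemma cocycle_iff:
  "f \<in> ZQ \<longleftrightarrow> f \<in> carrier MQ \<and> (\<forall>a\<in>carrier X. f (a, a) = \<one>) \<and>
    (\<forall>x\<in>carrier X. \<forall>y\<in>carrier X. \<forall>z\<in>carrier X.
      f (x, z) \<otimes> f (x \<rhd> z, y \<rhd> z) = f (x, y) \<otimes> f (x \<rhd> y, z))"
proof -
  have "linear_ext A f (rack_boundary3 X x y z) = \<one> \<longleftrightarrow>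
      f (x, z) \<otimes> f (x \<rhd> z, y \<rhd> z) = f (x, y) \<otimes> f (x \<rhd> y, z)"
    if f: "f \<in> carrier MQ" and xyz: "x \<in> carrier X" "y \<in> carrier X" "z \<in> carrier X" for x y z
  proof -
    note v = MQ_value[OF f]
    let ?c = "frag_of (x, z) - frag_of (x \<rhd> y, z) - frag_of (x, y)"
    let ?S = "carrier X \<times> carrier X"
    have S: "f \<in> keys d \<rightarrow> carrier A" if "keys d \<subseteq> ?S" for d :: "'a \<times> 'a \<Rightarrow>\<^sub>0 int"
      using that f by auto
    have k1: "keys (frag_of (x, z) - frag_of (x \<rhd> y, z)) \<subseteq> ?S"
      using keys_diff[of "frag_of (x, z)" "frag_of (x \<rhd> y, z)"] xyz by (auto simp: keys_frag_of)
    have k2: "keys ?c \<subseteq> ?S" by (rule keys_frag3) (use xyz in auto)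
    have "linear_ext A f (rack_boundary3 X x y z) =
      f (x, z) \<otimes> inv f (x \<rhd> y, z) \<otimes> inv f (x, y) \<otimes> f (x \<rhd> z, y \<rhd> z)"
      unfolding rack_boundary3_def using xyz v
      by (simp add: A.linear_ext_add[OF S[OF k2]] A.linear_ext_diff[OF S[OF k1]] A.linear_ext_diff keys_frag_of)
    also have "\<dots> = (f (x, z) \<otimes> f (x \<rhd> z, y \<rhd> z)) \<otimes> inv (f (x, y) \<otimes> f (x \<rhd> y, z))"
      using xyz v by (simp add: A.m_ac A.inv_mult)
    finally show ?thesis using xyz v by (simp add: A.mult_inv_eq_one_iff)
  qed
  then show ?thesis unfolding quandle_cocycles2_def by blast
qed

definition cobound :: "('a \<Rightarrow> 'b) \<Rightarrow> 'a \<times> 'a \<Rightarrow> 'b" where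
  "cobound g = (\<lambda>(x, y)\<in>carrier X \<times> carrier X. g x \<otimes> inv g (x \<rhd> y))"

lemma BQ_eq: "BQ = cobound ` carrier (map_group (carrier X) A)"
proof -
  have "(\<lambda>(x, y)\<in>carrier X \<times> carrier X. linear_ext A g (rack_boundary2 X x y)) = cobound g"
    if g: "g \<in> carrier (map_group (carrier X) A)" for g
  proof -
    have v: "g x \<in> carrier A" if "x \<in> carrier X" for x using g that by auto
    have "linear_ext A g (rack_boundary2 X x y) = g x \<otimes> inv g (x \<rhd> y)" if "x \<in> carrier X" "y \<in> carrier X" for x y
      unfolding rack_boundary2_def using that v by (subst A.linear_ext_diff) (auto simp: keys_frag_of)
    then show ?thesis unfolding cobound_def by (auto intro!: restrict_ext)
  qed
  then show ?thesis unfolding quandle_coboundaries2_def by (auto intro!: image_cong)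
qed

text \<open>The inner map of \<open>eisermann_eval\<close>, with the starting point left free: after
  a prefix of a word has been read, the rest is evaluated from the point reached.\<close>

definition EV :: "('a \<times> 'a \<Rightarrow> 'b) \<Rightarrow> 'a \<Rightarrow> 'a word set \<Rightarrow> 'b" where
  "EV f a = class_map (\<lambda>w. linear_ext A f (eisermann_chain X a w))"

abbreviation "W \<equiv> words (carrier X)"
abbreviation "wact w \<equiv> word_eval (Inn X) (translation X) w"

lemma wact_closed [simp]: "w \<in> W \<Longrightarrow> wact w \<in> carrier (Inn X)"
  by (rule Inn.word_eval_closed) auto

lemma wact_append: "u \<in> W \<Longrightarrow> v \<in> W \<Longrightarrow> wact (u @ v) = wact u \<bullet> wact v"
  by (rule Inn.word_eval_append) auto

lemma keys_chain: "w \<in> W \<Longrightarrow> a \<in> carrier X \<Longrightarrow>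
    keys (eisermann_chain X a w) \<subseteq> carrier X \<times> carrier X"
proof (induction w arbitrary: a)
  case (Cons l w)
  obtain y b where l: "l = (y, b)" by (cases l)
  then have y: "y \<in> carrier X" "w \<in> W" using Cons.prems by auto
  show ?case
    using Cons.IH[OF y(2), of "a \<rhd> y"] Cons.IH[OF y(2), of "qinv X a y"] Cons.prems y
      keys_add[of "frag_of (a, y)" "eisermann_chain X (a \<rhd> y) w"]
      keys_diff[of "eisermann_chain X (qinv X a y) w" "frag_of (qinv X a y, y)"]
    by (cases b) (auto simp: l keys_frag_of)
qed simp

lemma chain_append: "u \<in> W \<Longrightarrow> a \<in> carrier X \<Longrightarrow>
    eisermann_chain X a (u @ v) = eisermann_chain X a u + eisermann_chain X (wact u a) v"
proof (induction u arbitrary: a)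
  case (Cons l u)
  obtain y b where l: "l = (y, b)" by (cases l)
  then have "y \<in> carrier X" "u \<in> W" using Cons.prems by auto
  then show ?case using Cons by (cases b) (auto simp: l)
qed simp

lemma ev_closed:
  assumes "f \<in> carrier MQ" "w \<in> W" "a \<in> carrier X"
  shows "linear_ext A f (eisermann_chain X a w) \<in> carrier A"
  by (rule A.linear_ext_closed) (use keys_chain[OF assms(2,3)] assms(1) in auto)

lemma ev_append:
  assumes "f \<in> carrier MQ" "u \<in> W" "v \<in> W" "a \<in> carrier X"
  shows "linear_ext A f (eisermann_chain X a (u @ v)) =
    linear_ext A f (eisermann_chain X a u) \<otimes> linear_ext A f (eisermann_chain X (wact u a) v)"
  unfolding chain_append[OF assms(2,4)]
  by (rule A.linear_ext_add)
     (use keys_chain[OF assms(2,4)] keys_chain[OF assms(3), of "wact u a"] assms in auto)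

text \<open>A relator inside a word is read from the point to which its prefix leads, and what
  follows is read from the point reached after it. The induction therefore carries all starting
  points and the equality of the two actions.\<close>

lemma ev_presentation_eq:
  assumes f: "f \<in> ZQ" and uv: "(u, v) \<in> presentation_eq (carrier X) (As_relators X)" and a: "a \<in> carrier X"
  shows "linear_ext A f (eisermann_chain X a u) = linear_ext A f (eisermann_chain X a v)"
proof -
  have fM: "f \<in> carrier MQ" using f by (simp add: cocycle_iff)
  note v = MQ_value[OF fM]
  have "wact u = wact v \<and> (\<forall>a\<in>carrier X. linear_ext A f (eisermann_chain X a u) = linear_ext A f (eisermann_chain X a v))"
    using uv
  proof (induction rule: presentation_eq.induct)
    case (cancel u v s b)
    have w: "wact [(s, b), (s, \<not> b)] = \<one>\<^bsub>Inn X\<^esub>" using cancel by (cases b) simp_all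
    have c: "eisermann_chain X a [(s, b), (s, \<not> b)] = 0" if "a \<in> carrier X" for a
      using cancel that by (cases b) simp_all
    have e: "eisermann_chain X a ([(s, b), (s, \<not> b)] @ v) = eisermann_chain X a v" if "a \<in> carrier X" for a
      using chain_append[of "[(s, b), (s, \<not> b)]" a v] cancel that by (simp only: w c) simp
    have "wact ([(s, b), (s, \<not> b)] @ v) = wact v"
      using wact_append[of "[(s, b), (s, \<not> b)]" v] cancel by (simp only: w) simp
    then have "wact (u @ [(s, b), (s, \<not> b)] @ v) = wact (u @ v)"
      using wact_append[of u "[(s, b), (s, \<not> b)] @ v"] wact_append[of u v] cancel by simp
    moreover have "eisermann_chain X a (u @ [(s, b), (s, \<not> b)] @ v) = eisermann_chain X a (u @ v)"
      if "a \<in> carrier X" for a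
      using that cancel e[of "wact u a"] chain_append[of u a "[(s, b), (s, \<not> b)] @ v"] chain_append[of u a v] by simp
    ultimately show ?case by simp
  next
    case (relator u v p q)
    obtain x y where xy: "x \<in> carrier X" "y \<in> carrier X" "p = [(x, True), (y, True)]" "q = [(y, True), (x \<rhd> y, True)]"
      using relator(3) unfolding As_relators_def by blast
    have w: "wact p = wact q" using translation_relation[OF xy(1,2)] xy by simp
    have pq: "linear_ext A f (eisermann_chain X a p) = linear_ext A f (eisermann_chain X a q)" if a: "a \<in> carrier X" for a
    proof -
      have "linear_ext A f (frag_of (b, c) + frag_of (b', c')) = f (b, c) \<otimes> f (b', c')"
        if "b \<in> carrier X" "c \<in> carrier X" "b' \<in> carrier X" "c' \<in> carrier X" for b c b' c'
        using that v by (simp add: A.linear_ext_add keys_frag_of)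
      \<comment> \<open>Read from \<open>a\<close>, the relation between \<open>x\<close> and
        \<open>y\<close> in \<open>As X\<close> is the cocycle equation for the triple
        \<open>a\<close>, \<open>x\<close>, \<open>y\<close>.\<close>
      moreover have "f (a, y) \<otimes> f (a \<rhd> y, x \<rhd> y) = f (a, x) \<otimes> f (a \<rhd> x, y)"
        using f a xy(1,2) unfolding cocycle_iff by blast
      ultimately show ?thesis using xy a by simp
    qed
    have W: "p @ v \<in> W" "q @ v \<in> W" using relator by auto
    have "linear_ext A f (eisermann_chain X a (p @ v)) = linear_ext A f (eisermann_chain X a (q @ v))"
      if "a \<in> carrier X" for a
      using that ev_append[OF fM relator(4,2) that] ev_append[OF fM relator(5,2) that] pq[OF that] w by simp
    then have "linear_ext A f (eisermann_chain X a (u @ p @ v)) = linear_ext A f (eisermann_chain X a (u @ q @ v))"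
      if "a \<in> carrier X" for a
      using that ev_append[OF fM relator(1) W(1) that] ev_append[OF fM relator(1) W(2) that] relator(1) by simp
    moreover have "wact (u @ p @ v) = wact (u @ q @ v)" using relator w by (simp add: wact_append)
    ultimately show ?case by blast
  qed auto
  then show ?thesis using a by blast
qed

lemma EV_word_class:
  assumes "f \<in> ZQ" "a \<in> carrier X" "w \<in> W"
  shows "EV f a (wclass w) = linear_ext A f (eisermann_chain X a w)"
  unfolding EV_def
proof (rule class_map_eqI)
  show "w \<in> wclass w" using assms(3) by (simp add: mem_word_class presentation_eq.refl)
  fix u assume "u \<in> wclass w"
  then show "linear_ext A f (eisermann_chain X a u) = linear_ext A f (eisermann_chain X a w)"
    using ev_presentation_eq[OF assms(1) _ assms(2)] by (simp add: mem_word_class)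
qed

lemma carrier_As_word: 
  assumes "g \<in> carrier (As X)"
  obtains w where "w \<in> W" "g = wclass w"
  using assms by (auto simp: As_def carrier_presented_group)

lemma EV_crossed:
  assumes f: "f \<in> ZQ"
  shows "crossed (EV f)"
  unfolding crossed_def
proof (intro ballI conjI)
  have fM: "f \<in> carrier MQ" using f by (simp add: cocycle_iff)
  fix a g assume a: "a \<in> carrier X" and "g \<in> carrier (As X)"
  then obtain u where u: "u \<in> W" "g = wclass u" by (elim carrier_As_word)
  show "EV f a g \<in> carrier A" using EV_word_class[OF f a u(1)] ev_closed[OF fM u(1) a] u(2) by simp
  fix h assume "h \<in> carrier (As X)"
  then obtain v where v: "v \<in> W" "h = wclass v" by (elim carrier_As_word)
  have "g \<star> h = wclass (u @ v)"
    using u v by (simp add: As_def mult_presented_group)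
  then show "EV f a (g \<star> h) = EV f a g \<otimes> EV f (psi X g a) h"
    using EV_word_class[OF f a, of "u @ v"] EV_word_class[OF f a u(1)] EV_word_class[OF f _ v(1), of "wact u a"]
      ev_append[OF fM u(1) v(1) a] u v a by (simp add: psi_word_class)
qed

lemma EV_gen:
  assumes "f \<in> ZQ" "a \<in> carrier X" "y \<in> carrier X"
  shows "EV f a (e y) = f (a, y)"
proof -
  have "f \<in> carrier MQ" using assms(1) by (simp add: cocycle_iff)
  from MQ_value[OF this] show ?thesis
    unfolding As_gen_def using EV_word_class[OF assms(1,2), of "[(y, True)]"] assms by simp
qed

lemma EV_mult:
  assumes f: "f \<in> ZQ" and f': "f' \<in> ZQ" and ff: "f \<otimes>\<^bsub>MQ\<^esub> f' \<in> ZQ" and "a \<in> carrier X" "g \<in> carrier (As X)"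
  shows "EV (f \<otimes>\<^bsub>MQ\<^esub> f') a g = EV f a g \<otimes> EV f' a g"
proof (rule crossed_unique[OF EV_crossed[OF ff] _ _ assms(4,5)])
  show "crossed (\<lambda>a g. EV f a g \<otimes> EV f' a g)"
    unfolding crossed_def using EV_crossed[OF f] EV_crossed[OF f']
    by (auto simp: crossed_closed crossed_mult A.m_ac)
  show "EV (f \<otimes>\<^bsub>MQ\<^esub> f') a (e y) = EV f a (e y) \<otimes> EV f' a (e y)"
    if "a \<in> carrier X" "y \<in> carrier X" for a y
    unfolding EV_gen[OF ff that] EV_gen[OF f that] EV_gen[OF f' that] using that by simp
qed

lemma subgroup_ZQ: "subgroup ZQ MQ"
proof -
  interpret M: comm_group MQ by (rule A.map_group_comm_group)
  show ?thesis
  proof (rule M.subgroupI)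
    show "ZQ \<subseteq> carrier MQ" using cocycle_iff by blast
    have "\<one>\<^bsub>MQ\<^esub> \<in> ZQ" unfolding cocycle_iff by auto
    then show "ZQ \<noteq> {}" by blast
  next
    fix f assume f: "f \<in> ZQ"
    then have fM: "f \<in> carrier MQ" by (simp add: cocycle_iff)
    have i: "inv\<^bsub>MQ\<^esub> f = (\<lambda>x\<in>carrier X \<times> carrier X. inv f x)" using A.inv_map_group[OF fM] .
    have "inv f (x, z) \<otimes> inv f (x \<rhd> z, y \<rhd> z) = inv f (x, y) \<otimes> inv f (x \<rhd> y, z)"
      if "x \<in> carrier X" "y \<in> carrier X" "z \<in> carrier X" for x y z
    proof -
      have "f (x, z) \<otimes> f (x \<rhd> z, y \<rhd> z) = f (x, y) \<otimes> f (x \<rhd> y, z)"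
        using f that unfolding cocycle_iff by blast
      from arg_cong[OF this, of "m_inv A"] show ?thesis using that MQ_value[OF fM] by (simp add: A.inv_mult)
    qed
    moreover have "inv\<^bsub>MQ\<^esub> f \<in> carrier MQ" using M.inv_closed[OF fM] .
    ultimately show "inv\<^bsub>MQ\<^esub> f \<in> ZQ" using f unfolding cocycle_iff i by auto
  next
    fix f f' assume f: "f \<in> ZQ" "f' \<in> ZQ"
    then have fM: "f \<in> carrier MQ" "f' \<in> carrier MQ" by (simp_all add: cocycle_iff)
    note v = MQ_value[OF fM(1)] MQ_value[OF fM(2)]
    have "(f (x, z) \<otimes> f' (x, z)) \<otimes> (f (x \<rhd> z, y \<rhd> z) \<otimes> f' (x \<rhd> z, y \<rhd> z)) =
      (f (x, y) \<otimes> f' (x, y)) \<otimes> (f (x \<rhd> y, z) \<otimes> f' (x \<rhd> y, z))"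
      if "x \<in> carrier X" "y \<in> carrier X" "z \<in> carrier X" for x y z
    proof -
      have "f (x, z) \<otimes> f (x \<rhd> z, y \<rhd> z) = f (x, y) \<otimes> f (x \<rhd> y, z)"
        "f' (x, z) \<otimes> f' (x \<rhd> z, y \<rhd> z) = f' (x, y) \<otimes> f' (x \<rhd> y, z)"
        using f that unfolding cocycle_iff by blast+
      then have "(f (x, z) \<otimes> f (x \<rhd> z, y \<rhd> z)) \<otimes> (f' (x, z) \<otimes> f' (x \<rhd> z, y \<rhd> z)) =
        (f (x, y) \<otimes> f (x \<rhd> y, z)) \<otimes> (f' (x, y) \<otimes> f' (x \<rhd> y, z))" by simp
      then show ?thesis using that v by (simp add: A.m_ac)
    qed
    moreover have "f \<otimes>\<^bsub>MQ\<^esub> f' \<in> carrier MQ" using M.m_closed[OF fM] .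
    ultimately show "f \<otimes>\<^bsub>MQ\<^esub> f' \<in> ZQ" using f unfolding cocycle_iff by auto
  qed
qed

lemma cobound_closed: "g \<in> carrier (map_group (carrier X) A) \<Longrightarrow> cobound g \<in> carrier MQ"
proof -
  assume "g \<in> carrier (map_group (carrier X) A)"
  then have "g x \<in> carrier A" if "x \<in> carrier X" for x using that by auto
  then show ?thesis by (auto simp: cobound_def)
qed

lemma cobound_hom: "cobound \<in> hom (map_group (carrier X) A) MQ"
proof (rule homI)
  fix g g' assume g: "g \<in> carrier (map_group (carrier X) A)" "g' \<in> carrier (map_group (carrier X) A)"
  then have v: "g x \<in> carrier A" "g' x \<in> carrier A" if "x \<in> carrier X" for x using that by auto
  show "cobound (g \<otimes>\<^bsub>map_group (carrier X) A\<^esub> g') = cobound g \<otimes>\<^bsub>MQ\<^esub> cobound g'"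
    using v by (auto simp: cobound_def A.inv_mult A.m_ac intro!: restrict_ext)
qed (rule cobound_closed)

lemma cobound_cocycle:
  assumes "g \<in> carrier (map_group (carrier X) A)"
  shows "cobound g \<in> ZQ"
proof -
  have v: "g x \<in> carrier A" if "x \<in> carrier X" for x using assms that by auto
  have s: "(p \<otimes> inv q) \<otimes> (q \<otimes> r) = p \<otimes> r"
    if "p \<in> carrier A" "q \<in> carrier A" "r \<in> carrier A" for p q r
    using that by (simp add: A.m_assoc) (simp add: A.m_assoc[symmetric])
  show ?thesis unfolding cocycle_iff
    using cobound_closed[OF assms] v
    by (auto simp: cobound_def idem s distrib[symmetric])
qed

sublocale HQ: subquotient MQ ZQ BQ
proof (intro subquotient.intro subquotient_axioms.intro A.map_group_comm_group subgroup_ZQ)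
  interpret c: group_hom "map_group (carrier X) A" MQ cobound
    using cobound_hom comm_group.axioms(2)[OF A.map_group_comm_group[of "carrier X"]]
      comm_group.axioms(2)[OF A.map_group_comm_group[of "carrier X \<times> carrier X"]]
    by (simp add: group_hom_iff)
  show "subgroup BQ MQ" unfolding BQ_eq by (rule c.img_is_subgroup)
  show "BQ \<subseteq> ZQ" unfolding BQ_eq using cobound_cocycle by blast
qed

lemma quandle_cohomology2_eq: "quandle_cohomology2 X A = HQ.Q"
  by (simp add: quandle_cohomology2_def)

text \<open>A coboundary is a difference of potentials, so along a word it telescopes to the two end
  points. On loops at \<open>x0\<close> it is therefore trivial.\<close>

lemma EV_cobound:
  assumes g: "g \<in> carrier (map_group (carrier X) A)" and "a \<in> carrier X" "h \<in> carrier (As X)"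
  shows "EV (cobound g) a h = g a \<otimes> inv g (psi X h a)"
proof (rule crossed_unique[OF EV_crossed[OF cobound_cocycle[OF g]] _ _ assms(2,3)])
  have v: "g x \<in> carrier A" if "x \<in> carrier X" for x using g that by auto
  have s: "(p \<otimes> inv q) \<otimes> (q \<otimes> r) = p \<otimes> r"
    if "p \<in> carrier A" "q \<in> carrier A" "r \<in> carrier A" for p q r
    using that by (simp add: A.m_assoc) (simp add: A.m_assoc[symmetric])
  show "crossed (\<lambda>a h. g a \<otimes> inv g (psi X h a))"
    unfolding crossed_def using v by (simp add: s)
  show "EV (cobound g) a (e y) = g a \<otimes> inv g (psi X (e y) a)" if "a \<in> carrier X" "y \<in> carrier X" for a y
    unfolding EV_gen[OF cobound_cocycle[OF g] that] using that by (simp add: cobound_def)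
qed

lemma EV_coboundary_AS:
  assumes "b \<in> BQ" "h \<in> AS"
  shows "EV b x0 h = \<one>"
proof -
  obtain g where g: "g \<in> carrier (map_group (carrier X) A)" "b = cobound g" using assms(1) by (auto simp: BQ_eq)
  then have "g x0 \<in> carrier A" by auto
  then show ?thesis using EV_cobound[OF g(1) base, of h] assms(2) g(2) by simp
qed

text \<open>\<open>EV f x0\<close> is a homomorphism into a commutative group, so it factors through
  the abelianization, and it is trivial on \<open>e x0\<close> because \<open>f (x0, x0)\<close> is.
  Hence composing with \<open>proj_P\<close> changes nothing, and \<open>P_star\<close> is
  evaluation restricted to the stabilizer.\<close>

lemma P_star_cls:
  assumes f: "f \<in> ZQ"
  shows "P_star X A x0 (BQ #>\<^bsub>MQ\<^esub> f) = (\<lambda>h\<in>AS. EV f x0 h)"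
proof -
  interpret AG: group AG by (rule group_AG)
  let ?D = "derived AG (carrier AG)"
  interpret D: normal ?D AG by (rule AG.derived_self_is_normal)
  let ?H1 = "abelianization AG"
  interpret ab: group_hom AG ?H1 "ab_class AG"
    using D.r_coset_hom_Mod D.factorgroup_is_group AG.is_group
    by (simp add: group_hom_iff abelianization_def ab_class_def[abs_def])
  have eval: "eisermann_eval X A x0 f (proj_P X x0 (ab_class AG h)) = EV f x0 h"
    if f: "f \<in> ZQ" and h: "h \<in> AS" for f h
  proof -
    interpret EV: group_hom AG A "EV f x0"
      using crossed_hom[OF EV_crossed[OF f]] AG.is_group A.is_group
      by (simp add: group_hom_iff)
    have hG: "h \<in> carrier AG" and eG: "e x0 \<in> carrier AG" using h base_AS by simp_all
    \<comment> \<open>The exponent prescribed by \<open>eps\<close> may stay unspecified: any power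
      of \<open>e x0\<close> evaluates trivially.\<close>
    obtain n :: int where "proj_P X x0 (ab_class AG h) =
        ab_class AG h \<otimes>\<^bsub>?H1\<^esub> ab_class AG (e x0) [^]\<^bsub>?H1\<^esub> n"
      by (simp add: proj_P_def Let_def)
    also have "\<dots> = ab_class AG (h \<otimes>\<^bsub>AG\<^esub> e x0 [^]\<^bsub>AG\<^esub> n)"
      by (simp only: ab.hom_mult[OF hG AG.int_pow_closed[OF eG]] ab.hom_int_pow[OF eG])
    finally have P: "proj_P X x0 (ab_class AG h) = ab_class AG (h \<otimes>\<^bsub>AG\<^esub> e x0 [^]\<^bsub>AG\<^esub> n)" .
    have k: "h \<otimes>\<^bsub>AG\<^esub> e x0 [^]\<^bsub>AG\<^esub> n \<in> carrier AG"
      by (rule AG.m_closed[OF hG AG.int_pow_closed[OF eG]])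
    have "eisermann_eval X A x0 f (ab_class AG (h \<otimes>\<^bsub>AG\<^esub> e x0 [^]\<^bsub>AG\<^esub> n)) =
        EV f x0 (h \<otimes>\<^bsub>AG\<^esub> e x0 [^]\<^bsub>AG\<^esub> n)"
      unfolding eisermann_eval_def ab_class_def EV_def[symmetric]
    proof (rule AG.class_map_rcos[OF D.subgroup_axioms k])
      fix d assume d: "d \<in> ?D"
      have "EV f x0 d = \<one>"
        by (rule hom_into_comm_group_derived[OF AG.is_group A.comm_group_axioms EV.homh d])
      then show "EV f x0 (d \<otimes>\<^bsub>AG\<^esub> (h \<otimes>\<^bsub>AG\<^esub> e x0 [^]\<^bsub>AG\<^esub> n)) = EV f x0 (h \<otimes>\<^bsub>AG\<^esub> e x0 [^]\<^bsub>AG\<^esub> n)"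
        using EV.hom_mult[OF D.mem_carrier[OF d] k] EV.hom_closed[OF k] by simp
    qed
    also have "\<dots> = EV f x0 h \<otimes> EV f x0 (e x0) [^] n"
      by (simp only: EV.hom_mult[OF hG AG.int_pow_closed[OF eG]] EV.hom_int_pow[OF eG])
    also have "EV f x0 (e x0) = \<one>" using EV_gen[OF f base base] f by (simp add: cocycle_iff)
    also have "EV f x0 h \<otimes> \<one> [^] n = EV f x0 h" using EV.hom_closed[of h] h by simp
    finally show ?thesis using P by simp
  qed
  show ?thesis unfolding P_star_def
  proof (subst HQ.class_map_cls[OF f])
    show "(\<lambda>h\<in>carrier AG. eisermann_eval X A x0 f (proj_P X x0 (ab_class AG h))) = (\<lambda>h\<in>AS. EV f x0 h)"
      using eval[OF f] by (auto intro!: restrict_ext)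
    fix b assume b: "b \<in> BQ"
    then have bZ: "b \<in> ZQ" using HQ.NK by blast
    have bf: "b \<otimes>\<^bsub>MQ\<^esub> f \<in> ZQ" using subgroup.m_closed[OF subgroup_ZQ bZ f] .
    have "EV (b \<otimes>\<^bsub>MQ\<^esub> f) x0 h = EV f x0 h" if h: "h \<in> AS" for h
      using EV_mult[OF bZ f bf base, of h] EV_coboundary_AS[OF b h] h crossed_closed[OF EV_crossed[OF f] base, of h] by simp
    then show "(\<lambda>h\<in>carrier AG. eisermann_eval X A x0 (b \<otimes>\<^bsub>MQ\<^esub> f) (proj_P X x0 (ab_class AG h))) =
        (\<lambda>h\<in>carrier AG. eisermann_eval X A x0 f (proj_P X x0 (ab_class AG h)))"
      using eval[OF f] eval[OF bf] by (auto intro!: restrict_ext simp del: mult_map_group)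
  qed
qed

section \<open>Transport to the base point: cocycles against homomorphisms on the stabilizer\<close>

definition \<gamma> :: "'a \<Rightarrow> 'a word set" where
  "\<gamma> x = (SOME g. g \<in> carrier (As X) \<and> psi X g x0 = x)"

lemma
  assumes "x \<in> carrier X"
  shows \<gamma>_closed [simp]: "\<gamma> x \<in> carrier (As X)" and \<gamma>_apply [simp]: "psi X (\<gamma> x) x0 = x"
proof -
  obtain \<sigma> where "\<sigma> \<in> carrier (Inn X)" "\<sigma> x0 = x" using transitive[OF base assms] by blast
  then obtain g where "g \<in> carrier (As X) \<and> psi X g x0 = x" using psi_surj by (metis imageE)
  from someI[of "\<lambda>g. g \<in> carrier (As X) \<and> psi X g x0 = x", OF this]
  show "\<gamma> x \<in> carrier (As X)" "psi X (\<gamma> x) x0 = x" by (simp_all add: \<gamma>_def)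
qed

lemma transport_AS:
  assumes "a \<in> carrier X" "h \<in> carrier (As X)"
  shows "\<gamma> a \<star> h \<star> inv\<^bsub>As X\<^esub> \<gamma> (psi X h a) \<in> AS"
proof -
  have c: "psi X h a \<in> carrier X" using assms by simp
  have "psi X (inv\<^bsub>As X\<^esub> \<gamma> (psi X h a)) (psi X h a) = x0"
    using Inn_inv_apply(1)[of "psi X (\<gamma> (psi X h a))" x0] c by simp
  then show ?thesis using assms c by simp
qed

text \<open>Triviality on loops at \<open>x0\<close> makes the value of \<open>f\<close> along a
  path from \<open>x0\<close> depend on its end point only. The inverse of the value along the
  chosen path \<open>\<gamma> x\<close> is then a potential for \<open>f\<close>.\<close>

lemma coboundary_if_EV_trivial:
  assumes f: "f \<in> ZQ" and triv: "\<And>h. h \<in> AS \<Longrightarrow> EV f x0 h = \<one>"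
  shows "f \<in> BQ"
proof -
  have fM: "f \<in> carrier MQ" using f by (simp add: cocycle_iff)
  note E = EV_crossed[OF f]
  let ?g = "\<lambda>x\<in>carrier X. inv EV f x0 (\<gamma> x)"
  have g: "?g \<in> carrier (map_group (carrier X) A)" using crossed_closed[OF E base] by auto
  have "f (x, y) = inv EV f x0 (\<gamma> x) \<otimes> inv (inv EV f x0 (\<gamma> (x \<rhd> y)))"
    if xy: "x \<in> carrier X" "y \<in> carrier X" for x y
  proof -
    \<comment> \<open>The loop from \<open>x0\<close> to \<open>x\<close>, along \<open>e y\<close>
      to \<open>x \<rhd> y\<close>, and back along the chosen path.\<close>
    let ?h = "\<gamma> x \<star> e y \<star> inv\<^bsub>As X\<^esub> \<gamma> (x \<rhd> y)"
    have h: "?h \<in> AS" using transport_AS[OF xy(1) As_gen_closed[OF xy(2)]] xy by simp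
    have "EV f x0 (?h \<star> \<gamma> (x \<rhd> y)) = EV f x0 (\<gamma> (x \<rhd> y))"
      using crossed_mult[OF E base, of ?h "\<gamma> (x \<rhd> y)"] h triv[OF h] xy crossed_closed[OF E base, of "\<gamma> (x \<rhd> y)"]
      by auto
    moreover have "?h \<star> \<gamma> (x \<rhd> y) = \<gamma> x \<star> e y" using xy by (simp add: As.m_assoc)
    moreover have "EV f x0 (\<gamma> x \<star> e y) = EV f x0 (\<gamma> x) \<otimes> f (x, y)"
      using crossed_mult[OF E base, of "\<gamma> x" "e y"] EV_gen[OF f xy] xy by simp
    ultimately have "EV f x0 (\<gamma> x) \<otimes> f (x, y) = EV f x0 (\<gamma> (x \<rhd> y))" by simp
    then have "f (x, y) = inv EV f x0 (\<gamma> x) \<otimes> EV f x0 (\<gamma> (x \<rhd> y))"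
      using A.inv_solve_left[of "f (x, y)" "EV f x0 (\<gamma> x)" "EV f x0 (\<gamma> (x \<rhd> y))"] MQ_value[OF fM xy]
        crossed_closed[OF E base] xy by simp
    then show ?thesis using crossed_closed[OF E base] xy by simp
  qed
  then have "f = cobound ?g"
    using fM cobound_closed[OF g]
    by (intro PiE_ext[of f "carrier X \<times> carrier X" "\<lambda>_. carrier A"]) (auto simp: cobound_def)
  then show ?thesis unfolding BQ_eq using g by blast
qed

text \<open>Closing up arrows by the paths \<open>\<gamma>\<close> extends \<open>F\<close> from
  loops at \<open>x0\<close> to the whole groupoid; the cocycle is the value of this extension on
  generators. Evaluating both sides of the relation of \<open>As X\<close> gives the cocycle
  equation.\<close>

lemma cocycle_of_hom:
  assumes F: "F \<in> hom AG A" and F0: "F (e x0) = \<one>"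
  obtains f where "f \<in> ZQ" "\<And>h. h \<in> AS \<Longrightarrow> EV f x0 h = F h"
proof -
  interpret F: group_hom AG A F
    using F group_AG A.is_group by (simp add: group_hom_iff)
  have Fm: "F (g \<star> h) = F g \<otimes> F h" if "g \<in> AS" "h \<in> AS" for g h
    using F.hom_mult[of g h] that by simp
  have Fc: "F g \<in> carrier A" if "g \<in> AS" for g using F.hom_closed[of g] that by simp
  let ?t = "\<lambda>a h. \<gamma> a \<star> h \<star> inv\<^bsub>As X\<^esub> \<gamma> (psi X h a)"
  let ?\<Phi> = "\<lambda>a h. F (?t a h)"
  have tm: "?t a (g \<star> h) = ?t a g \<star> ?t (psi X g a) h"
    if "a \<in> carrier X" "g \<in> carrier (As X)" "h \<in> carrier (As X)" for a g h
  proof -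
    have c: "psi X g a \<in> carrier X" "psi X h (psi X g a) \<in> carrier X" using that by simp_all
    have "?t a g \<star> ?t (psi X g a) h = \<gamma> a \<star> g \<star>
       (inv\<^bsub>As X\<^esub> \<gamma> (psi X g a) \<star> \<gamma> (psi X g a)) \<star> h \<star> inv\<^bsub>As X\<^esub> \<gamma> (psi X h (psi X g a))"
      using that c by (simp add: As.m_assoc del: As.l_inv As.Units_l_inv)
    then show ?thesis using that c by (simp add: As.m_assoc)
  qed
  have \<Phi>: "crossed ?\<Phi>"
    unfolding crossed_def
  proof (intro ballI conjI)
    fix a g assume ag: "a \<in> carrier X" "g \<in> carrier (As X)"
    show "?\<Phi> a g \<in> carrier A" by (rule Fc[OF transport_AS[OF ag]])
    fix h assume h: "h \<in> carrier (As X)"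
    have c: "psi X g a \<in> carrier X" using ag by simp
    show "?\<Phi> a (g \<star> h) = ?\<Phi> a g \<otimes> ?\<Phi> (psi X g a) h"
      unfolding tm[OF ag h] by (rule Fm[OF transport_AS[OF ag] transport_AS[OF c h]])
  qed
  define f where "f = (\<lambda>(x, y)\<in>carrier X \<times> carrier X. ?\<Phi> x (e y))"
  have fv: "f (x, y) = ?\<Phi> x (e y)" if "x \<in> carrier X" "y \<in> carrier X" for x y using that by (simp add: f_def)
  have f: "f \<in> ZQ" unfolding cocycle_iff
  proof (intro conjI ballI)
    have "?\<Phi> x (e y) \<in> carrier A" if "x \<in> carrier X" "y \<in> carrier X" for x y
      by (rule crossed_closed[OF \<Phi>]) (use that in simp_all)
    then show "f \<in> carrier MQ" by (auto simp: f_def simp del: psi_gen)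
  next
    fix a assume a: "a \<in> carrier X"
    \<comment> \<open>By \<open>As_gen_conj\<close> the loop \<open>e a\<close> at \<open>a\<close>
      is transported to \<open>e x0\<close>, so triviality of \<open>F\<close> there is exactly the
      condition on the diagonal.\<close>
    have "?t a (e a) = \<gamma> a \<star> e (psi X (\<gamma> a) x0) \<star> inv\<^bsub>As X\<^esub> \<gamma> a" using a by (simp add: idem)
    also have "\<dots> = e x0 \<star> \<gamma> a \<star> inv\<^bsub>As X\<^esub> \<gamma> a" using As_gen_conj[of "\<gamma> a" x0] a by simp
    also have "\<dots> = e x0" using a by (simp add: As.m_assoc)
    finally show "f (a, a) = \<one>" using fv[OF a a] F0 by simp
  next
    fix x y z assume xyz: "x \<in> carrier X" "y \<in> carrier X" "z \<in> carrier X"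
    have "f (x, z) \<otimes> f (x \<rhd> z, y \<rhd> z) = ?\<Phi> x (e z \<star> e (y \<rhd> z))"
      unfolding fv[OF xyz(1,3)] fv[OF qop_closed[OF xyz(1,3)] qop_closed[OF xyz(2,3)]]
      using crossed_mult[OF \<Phi> xyz(1), of "e z" "e (y \<rhd> z)"] xyz by simp
    also have "e z \<star> e (y \<rhd> z) = e y \<star> e z" using As_gen_relation[OF xyz(2,3)] by simp
    also have "?\<Phi> x (e y \<star> e z) = f (x, y) \<otimes> f (x \<rhd> y, z)"
      unfolding fv[OF xyz(1,2)] fv[OF qop_closed[OF xyz(1,2)] xyz(3)]
      using crossed_mult[OF \<Phi> xyz(1), of "e y" "e z"] xyz by simp
    finally show "f (x, z) \<otimes> f (x \<rhd> z, y \<rhd> z) = f (x, y) \<otimes> f (x \<rhd> y, z)" .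
  qed
  have "EV f x0 h = F h" if h: "h \<in> AS" for h
  proof -
    have hc: "h \<in> carrier (As X)" "psi X h x0 = x0" using h by auto
    \<comment> \<open>The chosen \<open>\<gamma> x0\<close> need not be the identity, but it is a
      loop, and conjugation by it is invisible in the commutative group \<open>A\<close>.\<close>
    have g0: "\<gamma> x0 \<in> AS" by simp
    have "EV f x0 h = ?\<Phi> x0 h"
      by (rule crossed_unique[OF EV_crossed[OF f] \<Phi> _ base hc(1)]) (simp only: EV_gen[OF f] fv)
    also have "\<dots> = F (\<gamma> x0) \<otimes> F h \<otimes> F (inv\<^bsub>As X\<^esub> \<gamma> x0)"
      unfolding hc(2) using Fm[OF subgroup.m_closed[OF subgroup_AS g0 h] subgroup.m_inv_closed[OF subgroup_AS g0]] Fm[OF g0 h]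
      by simp
    also have "\<dots> = F h \<otimes> F (\<gamma> x0 \<star> inv\<^bsub>As X\<^esub> \<gamma> x0)"
      using Fm[OF g0 subgroup.m_inv_closed[OF subgroup_AS g0]] Fc[OF g0] Fc[OF h]
        Fc[OF subgroup.m_inv_closed[OF subgroup_AS g0]] by (simp add: A.m_ac)
    also have "\<dots> = F h" using F.hom_one Fc[OF h] by (simp add: As_Stab_group_def)
    finally show ?thesis .
  qed
  then show ?thesis using that f by blast
qed

end

section \<open>Central extensions from 2-cocycles\<close>

text \<open>Here \<open>z\<close> is a commutator of \<open>t\<close> and \<open>u\<close> that
  commutes with both, so moving \<open>u\<close> past each of the \<open>n\<close> factors
  \<open>t\<close> costs one factor \<open>z\<close>.\<close>

lemma (in group) commutator_power:
  assumes "t \<in> carrier G" "u \<in> carrier G" "z \<in> carrier G" "z \<otimes> t = t \<otimes> z" "z \<otimes> u = u \<otimes> z"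
    and "t \<otimes> u = z \<otimes> (u \<otimes> t)"
  shows "t [^] (n::nat) \<otimes> u = z [^] n \<otimes> (u \<otimes> t [^] n)"
proof (induction n)
  case (Suc n)
  have z: "t [^] n \<otimes> z = z \<otimes> t [^] n"
    using group_commutes_pow[of t z n] assms(1,3,4) by simp
  have "t [^] Suc n \<otimes> u = t [^] n \<otimes> (t \<otimes> u)" using assms(1,2) by (simp add: m_assoc)
  also have "\<dots> = (t [^] n \<otimes> z) \<otimes> u \<otimes> t" unfolding assms(6) using assms(1-3) by (simp add: m_assoc)
  also have "\<dots> = z \<otimes> (t [^] n \<otimes> u) \<otimes> t" unfolding z using assms(1-3) by (simp add: m_assoc)
  also have "\<dots> = (z \<otimes> z [^] n) \<otimes> (u \<otimes> (t [^] n \<otimes> t))"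
    unfolding Suc using assms(1-3) by (simp add: m_assoc)
  also have "z \<otimes> z [^] n = z [^] Suc n" using group_commutes_pow[of z z n] assms(3) by simp
  finally show ?case by simp
qed (use assms(1-3,6) in simp)

locale cocycle_extension = A: comm_group A + Q: group Q
  for A :: "('b, 'm) monoid_scheme" (structure) and Q :: "('q, 'k) monoid_scheme" +
  fixes H :: "'q \<Rightarrow> 'q \<Rightarrow> 'b"
  assumes H_closed [simp]: "a \<in> carrier Q \<Longrightarrow> b \<in> carrier Q \<Longrightarrow> H a b \<in> carrier A"
    and H_cocycle: "a \<in> carrier Q \<Longrightarrow> b \<in> carrier Q \<Longrightarrow> c \<in> carrier Q \<Longrightarrow>
      H b c \<otimes> H a (b \<otimes>\<^bsub>Q\<^esub> c) = H (a \<otimes>\<^bsub>Q\<^esub> b) c \<otimes> H a b"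
begin

text \<open>The standard central extension of \<open>Q\<close> by \<open>A\<close> attached to a
  2-cocycle. The cocycle is not assumed normalized, whence the correction by
  \<open>H \<one> \<one>\<close> in the neutral element.\<close>

definition ext :: "('b \<times> 'q) monoid" where
  "ext = \<lparr>carrier = carrier A \<times> carrier Q,
    monoid.mult = (\<lambda>(a, x) (b, y). (a \<otimes> b \<otimes> H x y, x \<otimes>\<^bsub>Q\<^esub> y)),
    one = (inv H \<one>\<^bsub>Q\<^esub> \<one>\<^bsub>Q\<^esub>, \<one>\<^bsub>Q\<^esub>)\<rparr>"

lemma carrier_ext [simp]: "carrier ext = carrier A \<times> carrier Q"
  by (simp add: ext_def)

lemma mult_ext [simp]: "(a, x) \<otimes>\<^bsub>ext\<^esub> (b, y) = (a \<otimes> b \<otimes> H x y, x \<otimes>\<^bsub>Q\<^esub> y)"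
  by (simp add: ext_def)

lemma one_ext: "\<one>\<^bsub>ext\<^esub> = (inv H \<one>\<^bsub>Q\<^esub> \<one>\<^bsub>Q\<^esub>, \<one>\<^bsub>Q\<^esub>)"
  by (simp add: ext_def)

lemma H_one_left: "x \<in> carrier Q \<Longrightarrow> H \<one>\<^bsub>Q\<^esub> x = H \<one>\<^bsub>Q\<^esub> \<one>\<^bsub>Q\<^esub>"
  using H_cocycle[of "\<one>\<^bsub>Q\<^esub>" "\<one>\<^bsub>Q\<^esub>" x] by simp

lemma H_one_right: "x \<in> carrier Q \<Longrightarrow> H x \<one>\<^bsub>Q\<^esub> = H \<one>\<^bsub>Q\<^esub> \<one>\<^bsub>Q\<^esub>"
  using H_cocycle[of x "\<one>\<^bsub>Q\<^esub>" "\<one>\<^bsub>Q\<^esub>"] by simp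

lemma group_ext: "group ext"
proof (rule groupI)
  fix p assume "p \<in> carrier ext"
  then obtain a x where p: "p = (a, x)" "a \<in> carrier A" "x \<in> carrier Q" by auto
  have "inv H \<one>\<^bsub>Q\<^esub> \<one>\<^bsub>Q\<^esub> \<otimes> a \<otimes> H \<one>\<^bsub>Q\<^esub> \<one>\<^bsub>Q\<^esub> = a \<otimes> (inv H \<one>\<^bsub>Q\<^esub> \<one>\<^bsub>Q\<^esub> \<otimes> H \<one>\<^bsub>Q\<^esub> \<one>\<^bsub>Q\<^esub>)"
    using p by (simp add: A.m_ac del: A.l_inv A.r_inv A.Units_l_inv A.Units_r_inv)
  also have "\<dots> = a" using p by simp
  finally show "\<one>\<^bsub>ext\<^esub> \<otimes>\<^bsub>ext\<^esub> p = p" using p H_one_left[of x] by (simp add: one_ext)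
  let ?b = "inv a \<otimes> inv H (inv\<^bsub>Q\<^esub> x) x \<otimes> inv H \<one>\<^bsub>Q\<^esub> \<one>\<^bsub>Q\<^esub>"
  have "?b \<otimes> a \<otimes> H (inv\<^bsub>Q\<^esub> x) x = (inv a \<otimes> a) \<otimes> (inv H (inv\<^bsub>Q\<^esub> x) x \<otimes> H (inv\<^bsub>Q\<^esub> x) x) \<otimes> inv H \<one>\<^bsub>Q\<^esub> \<one>\<^bsub>Q\<^esub>"
    using p by (simp add: A.m_ac del: A.l_inv A.r_inv A.Units_l_inv A.Units_r_inv)
  also have "\<dots> = inv H \<one>\<^bsub>Q\<^esub> \<one>\<^bsub>Q\<^esub>" using p by simp
  finally show "\<exists>q\<in>carrier ext. q \<otimes>\<^bsub>ext\<^esub> p = \<one>\<^bsub>ext\<^esub>"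
    using p by (intro bexI[of _ "(?b, inv\<^bsub>Q\<^esub> x)"]) (auto simp: one_ext)
next
  fix p q r assume "p \<in> carrier ext" "q \<in> carrier ext" "r \<in> carrier ext"
  then obtain a x b y c z where *: "p = (a, x)" "a \<in> carrier A" "x \<in> carrier Q"
    "q = (b, y)" "b \<in> carrier A" "y \<in> carrier Q" "r = (c, z)" "c \<in> carrier A" "z \<in> carrier Q" by auto
  have "(a \<otimes> b \<otimes> H x y) \<otimes> c \<otimes> H (x \<otimes>\<^bsub>Q\<^esub> y) z = a \<otimes> b \<otimes> c \<otimes> (H (x \<otimes>\<^bsub>Q\<^esub> y) z \<otimes> H x y)"
    using * by (simp add: A.m_ac)
  also have "\<dots> = a \<otimes> b \<otimes> c \<otimes> (H y z \<otimes> H x (y \<otimes>\<^bsub>Q\<^esub> z))" using * H_cocycle[of x y z] by simp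
  also have "\<dots> = a \<otimes> (b \<otimes> c \<otimes> H y z) \<otimes> H x (y \<otimes>\<^bsub>Q\<^esub> z)" using * by (simp add: A.m_ac)
  finally show "p \<otimes>\<^bsub>ext\<^esub> q \<otimes>\<^bsub>ext\<^esub> r = p \<otimes>\<^bsub>ext\<^esub> (q \<otimes>\<^bsub>ext\<^esub> r)" using * by (simp add: Q.m_assoc)
qed (auto simp: one_ext)

sublocale E: group ext by (rule group_ext)

lemma snd_hom: "snd \<in> hom ext Q"
  by (auto simp: hom_def)

sublocale snd: group_hom ext Q snd
  by (simp add: group_hom_iff snd_hom E.is_group Q.is_group)

text \<open>The embedding of \<open>A\<close>, with the same correction as the neutral element:
  multiplication by \<open>inc a\<close> then multiplies the first coordinate by \<open>a\<close>
  and nothing else.\<close>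

definition inc :: "'b \<Rightarrow> 'b \<times> 'q" where
  "inc a = (a \<otimes> inv H \<one>\<^bsub>Q\<^esub> \<one>\<^bsub>Q\<^esub>, \<one>\<^bsub>Q\<^esub>)"

lemma inc_mult: "a \<in> carrier A \<Longrightarrow> b \<in> carrier A \<Longrightarrow> x \<in> carrier Q \<Longrightarrow> inc a \<otimes>\<^bsub>ext\<^esub> (b, x) = (a \<otimes> b, x)"
proof -
  assume *: "a \<in> carrier A" "b \<in> carrier A" "x \<in> carrier Q"
  have "a \<otimes> inv H \<one>\<^bsub>Q\<^esub> \<one>\<^bsub>Q\<^esub> \<otimes> b \<otimes> H \<one>\<^bsub>Q\<^esub> \<one>\<^bsub>Q\<^esub> = a \<otimes> b \<otimes> (inv H \<one>\<^bsub>Q\<^esub> \<one>\<^bsub>Q\<^esub> \<otimes> H \<one>\<^bsub>Q\<^esub> \<one>\<^bsub>Q\<^esub>)"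
    using * by (simp add: A.m_ac del: A.l_inv A.r_inv A.Units_l_inv A.Units_r_inv)
  then show ?thesis using * H_one_left[of x] by (simp add: inc_def)
qed

lemma inc_closed [simp]: "a \<in> carrier A \<Longrightarrow> inc a \<in> carrier ext"
  by (simp add: inc_def)

lemma inc_hom: "inc \<in> hom A ext"
proof (rule homI)
  fix a b assume ab: "a \<in> carrier A" "b \<in> carrier A"
  let ?c = "inv H \<one>\<^bsub>Q\<^esub> \<one>\<^bsub>Q\<^esub>"
  have "inc a \<otimes>\<^bsub>ext\<^esub> inc b = (a \<otimes> (b \<otimes> ?c), \<one>\<^bsub>Q\<^esub>)"
    unfolding inc_def[of b] by (rule inc_mult) (use ab in auto)
  also have "\<dots> = inc (a \<otimes> b)" using ab by (simp add: inc_def A.m_assoc)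
  finally show "inc (a \<otimes> b) = inc a \<otimes>\<^bsub>ext\<^esub> inc b" by simp
qed (rule inc_closed)

lemma inc_eq_one: "a \<in> carrier A \<Longrightarrow> inc a = \<one>\<^bsub>ext\<^esub> \<Longrightarrow> a = \<one>"
  unfolding inc_def one_ext prod.inject
  by (metis A.inv_closed A.l_one A.one_closed A.right_cancel H_closed Q.one_closed)

text \<open>The cocycle identity makes \<open>H \<one> x\<close> and \<open>H x \<one>\<close> one
  and the same constant, so the two products have equal first coordinates.\<close>

lemma one_snd_central:
  assumes "p \<in> carrier ext" "snd p = \<one>\<^bsub>Q\<^esub>" "q \<in> carrier ext"
  shows "p \<otimes>\<^bsub>ext\<^esub> q = q \<otimes>\<^bsub>ext\<^esub> p"
proof -
  obtain a b x where "p = (a, \<one>\<^bsub>Q\<^esub>)" "q = (b, x)" "a \<in> carrier A" "b \<in> carrier A" "x \<in> carrier Q"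
    using assms by (cases p; cases q) auto
  then show ?thesis using H_one_left[of x] H_one_right[of x] by (simp add: A.m_comm)
qed

end

section \<open>The map to relative group cohomology\<close>

context pointed_quandle
begin

section \<open>The relative class attached to a quandle cocycle\<close>

abbreviation "sec \<equiv> inv_into (carrier (As X)) (psi X)"

lemma sec_closed [simp]: "\<sigma> \<in> carrier (Inn X) \<Longrightarrow> sec \<sigma> \<in> carrier (As X)"
  using inv_into_into[of \<sigma> "psi X" "carrier (As X)"] psi_surj by simp

lemma psi_sec [simp]: "\<sigma> \<in> carrier (Inn X) \<Longrightarrow> psi X (sec \<sigma>) = \<sigma>"
  using f_inv_into_f[of \<sigma> "psi X" "carrier (As X)"] psi_surj by simp

abbreviation "KP \<equiv> kernel (As X) (Inn X) (psi X)"

lemma KP_closed: "k \<in> KP \<Longrightarrow> k \<in> carrier (As X)"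
  by (simp add: kernel_def)

text \<open>The factor set of the central extension \<open>psi X\<close> for the section
  \<open>sec\<close>.\<close>

definition \<kappa> :: "('a \<Rightarrow> 'a) \<Rightarrow> ('a \<Rightarrow> 'a) \<Rightarrow> 'a word set" where
  "\<kappa> \<sigma> \<tau> = sec \<sigma> \<star> sec \<tau> \<star> inv\<^bsub>As X\<^esub> sec (\<sigma> \<bullet> \<tau>)"

lemma \<kappa>_kernel: "\<sigma> \<in> carrier (Inn X) \<Longrightarrow> \<tau> \<in> carrier (Inn X) \<Longrightarrow> \<kappa> \<sigma> \<tau> \<in> KP"
  by (simp add: \<kappa>_def kernel_def)

lemma \<kappa>_mult:
  assumes "\<sigma> \<in> carrier (Inn X)" "\<tau> \<in> carrier (Inn X)"
  shows "\<kappa> \<sigma> \<tau> \<star> sec (\<sigma> \<bullet> \<tau>) = sec \<sigma> \<star> sec \<tau>"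
  using assms by (simp add: \<kappa>_def As.m_assoc)

text \<open>Both sides compare the product of \<open>sec a\<close>, \<open>sec b\<close> and
  \<open>sec c\<close> with \<open>sec\<close> of the product. Centrality of the kernel lets
  \<open>\<kappa> b c\<close> move past \<open>sec a\<close>.\<close>

lemma \<kappa>_cocycle:
  assumes "a \<in> carrier (Inn X)" "b \<in> carrier (Inn X)" "c \<in> carrier (Inn X)"
  shows "\<kappa> b c \<star> \<kappa> a (b \<bullet> c) = \<kappa> (a \<bullet> b) c \<star> \<kappa> a b"
proof -
  let ?ab = "a \<bullet> b" and ?bc = "b \<bullet> c"
  have k: "\<kappa> a b \<in> KP" "\<kappa> b c \<in> KP" "\<kappa> a ?bc \<in> KP" "\<kappa> ?ab c \<in> KP" using assms by (auto intro!: \<kappa>_kernel)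
  note kc = k[THEN KP_closed]
  let ?s = "sec (?ab \<bullet> c)"
  have sc: "?s \<in> carrier (As X)" using assms by simp
  have "(\<kappa> b c \<star> \<kappa> a ?bc) \<star> ?s = \<kappa> b c \<star> (\<kappa> a ?bc \<star> sec (a \<bullet> ?bc))"
    using assms kc by (simp add: As.m_assoc Inn.m_assoc)
  also have "\<dots> = (\<kappa> b c \<star> sec a) \<star> sec ?bc"
    using assms kc \<kappa>_mult[of a ?bc] by (simp add: As.m_assoc)
  also have "\<dots> = sec a \<star> (\<kappa> b c \<star> sec ?bc)"
    using kernel_psi_central[OF k(2), of "sec a"] assms kc by (simp add: As.m_assoc)
  also have "\<dots> = (sec a \<star> sec b) \<star> sec c" using assms \<kappa>_mult[of b c] by (simp add: As.m_assoc)
  also have "\<dots> = \<kappa> a b \<star> (sec ?ab \<star> sec c)"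
    using assms \<kappa>_mult[of a b, symmetric] kc by (simp add: As.m_assoc)
  also have "\<dots> = \<kappa> a b \<star> (\<kappa> ?ab c \<star> ?s)" using assms \<kappa>_mult[of ?ab c] by simp
  also have "\<dots> = (\<kappa> ?ab c \<star> \<kappa> a b) \<star> ?s"
    using kernel_psi_central[OF k(1) kc(4)] kc sc As.m_assoc[of "\<kappa> a b" "\<kappa> ?ab c" ?s] by simp
  finally show ?thesis using kc sc As.right_cancel[of ?s "\<kappa> b c \<star> \<kappa> a ?bc"] by simp
qed

lemma EV_AS_mult:
  "f \<in> ZQ \<Longrightarrow> g \<in> AS \<Longrightarrow> h \<in> carrier (As X) \<Longrightarrow> EV f x0 (g \<star> h) = EV f x0 g \<otimes> EV f x0 h"
  using crossed_mult[OF EV_crossed base, of f g h] by simp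

lemma EV_closed: "f \<in> ZQ \<Longrightarrow> h \<in> carrier (As X) \<Longrightarrow> EV f x0 h \<in> carrier A"
  using crossed_closed[OF EV_crossed base] .

definition cF :: "('a \<times> 'a \<Rightarrow> 'b) \<Rightarrow> ('a \<Rightarrow> 'a) list \<Rightarrow> 'b" where
  "cF f = (\<lambda>a\<in>tuples (carrier (Inn X)) 2. EV f x0 (\<kappa> (a ! 0) (a ! 1)))"

text \<open>\<open>EV f x0\<close> is a homomorphism on the whole stabilizer in \<open>As X\<close>,
  which contains the lifts \<open>sec \<sigma>\<close> of stabilizing \<open>\<sigma>\<close>. Its
  values there trivialize \<open>cF f\<close> over the stabilizer and lift the transgression to a
  relative class.\<close>

definition kF :: "('a \<times> 'a \<Rightarrow> 'b) \<Rightarrow> ('a \<Rightarrow> 'a) list \<Rightarrow> 'b" where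
  "kF f = (\<lambda>b\<in>tuples (Stab X x0) 1. EV f x0 (sec (b ! 0)))"

lemma cF_apply: "a \<in> carrier (Inn X) \<Longrightarrow> b \<in> carrier (Inn X) \<Longrightarrow> cF f [a, b] = EV f x0 (\<kappa> a b)"
  by (simp add: cF_def numeral_2_eq_2)

lemma Stab_carrier: "a \<in> Stab X x0 \<Longrightarrow> a \<in> carrier (Inn X)"
  unfolding Stab_def by blast

lemma sec_AS: "a \<in> Stab X x0 \<Longrightarrow> sec a \<in> AS"
  unfolding AS_Stab using sec_closed[OF Stab_carrier] psi_sec[OF Stab_carrier, of a] by (simp only:)

text \<open>Applying \<open>EV f x0\<close> to \<open>\<kappa>_cocycle\<close> gives the cocycle
  identity for \<open>cF f\<close>, and applying it to \<open>\<kappa>_mult\<close> gives the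
  relative condition.\<close>

lemma cF_kF_cocycle:
  assumes f: "f \<in> ZQ"
  shows "(cF f, kF f) \<in> GP.RZ2"
  unfolding GP.RZ2_iff
proof (intro conjI ballI)
  note kAS = kernel_psi_AS[OF \<kappa>_kernel]
  have cl: "EV f x0 (\<kappa> a b) \<in> carrier A" if "a \<in> carrier (Inn X)" "b \<in> carrier (Inn X)" for a b
    using EV_closed[OF f] kAS[OF that] by blast
  have "cF f \<in> carrier (GP.C 2)"
    unfolding GP.carrier_C cF_def numeral_2_eq_2 using cl by (auto elim!: tuples_2E)
  moreover have "cF f [b, c] \<otimes> cF f [a, b \<bullet> c] = cF f [a \<bullet> b, c] \<otimes> cF f [a, b]"
    if abc: "a \<in> carrier (Inn X)" "b \<in> carrier (Inn X)" "c \<in> carrier (Inn X)" for a b c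
  proof -
    note k = kAS[OF abc(2,3)] kAS[OF abc(1) Inn.m_closed[OF abc(2,3)]] kAS[OF Inn.m_closed[OF abc(1,2)] abc(3)] kAS[OF abc(1,2)]
    have "EV f x0 (\<kappa> b c \<star> \<kappa> a (b \<bullet> c)) = EV f x0 (\<kappa> (a \<bullet> b) c \<star> \<kappa> a b)"
      using \<kappa>_cocycle[OF abc] by simp
    moreover have "EV f x0 (\<kappa> b c \<star> \<kappa> a (b \<bullet> c)) = EV f x0 (\<kappa> b c) \<otimes> EV f x0 (\<kappa> a (b \<bullet> c))"
      by (rule EV_AS_mult[OF f k(1)]) (use k(2) in blast)
    moreover have "EV f x0 (\<kappa> (a \<bullet> b) c \<star> \<kappa> a b) = EV f x0 (\<kappa> (a \<bullet> b) c) \<otimes> EV f x0 (\<kappa> a b)"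
      by (rule EV_AS_mult[OF f k(3)]) (use k(4) in blast)
    ultimately show ?thesis using abc by (simp only: cF_apply Inn.m_closed)
  qed
  ultimately show "cF f \<in> GP.Z2" unfolding GP.Z2_iff by blast
  show "kF f \<in> (\<Pi>\<^sub>E x\<in>tuples (Stab X x0) 1. carrier A)"
    unfolding kF_def One_nat_def using EV_closed[OF f sec_closed[OF Stab_carrier]] by (auto elim!: tuples_1E)
  fix a b assume ab: "a \<in> Stab X x0" "b \<in> Stab X x0"
  note ab' = ab[THEN Stab_carrier]
  have ab2: "a \<bullet> b \<in> Stab X x0" using subgroup.m_closed[OF subgroup_Stab ab] .
  have "EV f x0 (\<kappa> a b) \<otimes> EV f x0 (sec (a \<bullet> b)) = EV f x0 (\<kappa> a b \<star> sec (a \<bullet> b))"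
    using EV_AS_mult[OF f kAS[OF ab'], of "sec (a \<bullet> b)"] ab' by simp
  also have "\<dots> = EV f x0 (sec a \<star> sec b)" using \<kappa>_mult[OF ab'] by simp
  also have "\<dots> = EV f x0 (sec a) \<otimes> EV f x0 (sec b)" using EV_AS_mult[OF f sec_AS[OF ab(1)]] ab' by simp
  finally show "cF f [a, b] \<otimes> kF f [a \<bullet> b] = kF f [a] \<otimes> kF f [b]"
    using ab ab2 cF_apply[OF ab'] by (simp add: kF_def)
qed

lemma cF_Z2: "f \<in> ZQ \<Longrightarrow> cF f \<in> GP.Z2"
  using cF_kF_cocycle by (simp add: GP.RZ2_iff)

lemma cF_kF_mult:
  assumes f: "f \<in> ZQ" and f': "f' \<in> ZQ"
  shows "(cF (f \<otimes>\<^bsub>MQ\<^esub> f'), kF (f \<otimes>\<^bsub>MQ\<^esub> f')) = (cF f, kF f) \<otimes>\<^bsub>GP.RC 2\<^esub> (cF f', kF f')"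
proof -
  have ff: "f \<otimes>\<^bsub>MQ\<^esub> f' \<in> ZQ" using subgroup.m_closed[OF subgroup_ZQ f f'] .
  note E = EV_mult[OF f f' ff base]
  have "cF (f \<otimes>\<^bsub>MQ\<^esub> f') = (\<lambda>a\<in>tuples (carrier (Inn X)) 2. cF f a \<otimes> cF f' a)"
  proof -
    have "EV (f \<otimes>\<^bsub>MQ\<^esub> f') x0 (\<kappa> (a ! 0) (a ! 1)) = cF f a \<otimes> cF f' a" if "a \<in> tuples (carrier (Inn X)) 2" for a
    proof -
      from that obtain \<sigma> \<tau> where *: "a = [\<sigma>, \<tau>]" "\<sigma> \<in> carrier (Inn X)" "\<tau> \<in> carrier (Inn X)"
        unfolding numeral_2_eq_2 by (elim tuples_2E)
      show ?thesis using E[OF KP_closed[OF \<kappa>_kernel[OF *(2,3)]]] cF_apply[OF *(2,3)] unfolding *(1) by simp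
    qed
    then show ?thesis unfolding cF_def[of "f \<otimes>\<^bsub>MQ\<^esub> f'"] by (rule restrict_ext)
  qed
  moreover have "kF (f \<otimes>\<^bsub>MQ\<^esub> f') = (\<lambda>a\<in>tuples (Stab X x0) 1. kF f a \<otimes> kF f' a)"
  proof -
    have "EV (f \<otimes>\<^bsub>MQ\<^esub> f') x0 (sec (a ! 0)) = kF f a \<otimes> kF f' a" if "a \<in> tuples (Stab X x0) 1" for a
    proof -
      from that obtain \<sigma> where *: "a = [\<sigma>]" "\<sigma> \<in> Stab X x0" unfolding One_nat_def by (elim tuples_1E)
      show ?thesis using E[OF sec_closed[OF Stab_carrier[OF *(2)]]] *(2) unfolding *(1) by (simp add: kF_def)
    qed
    then show ?thesis unfolding kF_def[of "f \<otimes>\<^bsub>MQ\<^esub> f'"] by (rule restrict_ext)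
  qed
  ultimately show ?thesis
    by (simp add: rel_cochains_def bar_cochains_def pred_tuples_def numeral_2_eq_2)
qed

abbreviation "rF f \<equiv> GP.RB2 #>\<^bsub>GP.RC 2\<^esub> (cF f, kF f)"

lemma rF_closed: "f \<in> ZQ \<Longrightarrow> rF f \<in> carrier GP.R2.Q"
  using GP.R2.cls_closed[OF cF_kF_cocycle] .

text \<open>\<open>transgression\<close> chooses its section by the same \<open>inv_into\<close> as
  \<open>sec\<close>, so the two cocycles agree as functions and no change of section
  intervenes.\<close>

lemma transgression_cls:
  assumes f: "f \<in> ZQ"
  shows "transgression (As X) (Inn X) (psi X) A (restrict (P_star X A x0 (BQ #>\<^bsub>MQ\<^esub> f)) KP) = GP.B2 #>\<^bsub>GP.C 2\<^esub> cF f"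
proof -
  have "restrict (\<lambda>h\<in>AS. EV f x0 h) KP (\<kappa> (a ! 0) (a ! 1)) = EV f x0 (\<kappa> (a ! 0) (a ! 1))"
    if "a \<in> tuples (carrier (Inn X)) 2" for a
  proof -
    from that obtain \<sigma> \<tau> where *: "a = [\<sigma>, \<tau>]" "\<sigma> \<in> carrier (Inn X)" "\<tau> \<in> carrier (Inn X)"
      unfolding numeral_2_eq_2 by (elim tuples_2E)
    show ?thesis using \<kappa>_kernel[OF *(2,3)] kernel_psi_AS[OF \<kappa>_kernel[OF *(2,3)]] unfolding *(1) by simp
  qed
  then have "(\<lambda>a\<in>tuples (carrier (Inn X)) 2. restrict (\<lambda>h\<in>AS. EV f x0 h) KP (\<kappa> (a ! 0) (a ! 1))) = cF f"
    unfolding cF_def by (rule restrict_ext)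
  then show ?thesis
    unfolding transgression_def P_star_cls[OF f] \<kappa>_def[symmetric] Let_def cohomology_class_def GP.B2_def[symmetric]
    by (simp only:)
qed

sublocale p: group_hom GP.R2.Q GP.H2.Q "rel_to_abs (Inn X) A 2"
  by (simp add: group_hom_iff GP.rel_to_abs_hom GP.R2.Q.is_group GP.H2.Q.is_group)

section \<open>The map T on classes\<close>

abbreviation "CI \<equiv> connecting_image X A x0"

lemma CI_kernel: "CI = kernel GP.R2.Q GP.H2.Q (rel_to_abs (Inn X) A 2)"
  unfolding connecting_image_def Stab_group_def by (rule GP.CI_kernel)

lemma subgroup_CI: "subgroup CI GP.R2.Q"
  unfolding CI_kernel by (rule p.subgroup_kernel)

lemma T_target_eq: "T_target X A x0 = GP.R2.Q Mod CI"
  by (simp add: T_target_def GP.rel_cohomology_2)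

lemma T_target_comm_group: "comm_group (T_target X A x0)"
  unfolding T_target_eq by (rule GP.R2.Q.abelian_FactGroup[OF subgroup_CI])

lemma rel_to_abs_eq_iff:
  assumes z: "z \<in> carrier GP.R2.Q" and w: "w \<in> carrier GP.R2.Q"
  shows "rel_to_abs (Inn X) A 2 z = rel_to_abs (Inn X) A 2 w \<longleftrightarrow> z \<otimes>\<^bsub>GP.R2.Q\<^esub> inv\<^bsub>GP.R2.Q\<^esub> w \<in> CI"
proof -
  note iw = GP.R2.Q.inv_closed[OF w]
  have "z \<otimes>\<^bsub>GP.R2.Q\<^esub> inv\<^bsub>GP.R2.Q\<^esub> w \<in> CI \<longleftrightarrow>
      rel_to_abs (Inn X) A 2 (z \<otimes>\<^bsub>GP.R2.Q\<^esub> inv\<^bsub>GP.R2.Q\<^esub> w) = \<one>\<^bsub>GP.H2.Q\<^esub>"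
    unfolding CI_kernel kernel_def using GP.R2.Q.m_closed[OF z iw] by blast
  then show ?thesis
    using GP.H2.Q.mult_inv_eq_one_iff[OF p.hom_closed[OF z] p.hom_closed[OF w]]
    by (simp only: p.hom_mult[OF z iw] p.hom_inv[OF w])
qed

text \<open>\<open>rF f\<close> is an explicit preimage of the transgressed class, and the full
  preimage is its coset modulo the kernel of \<open>rel_to_abs\<close>, which is the connecting
  image by exactness. This also shows that \<open>map_T\<close> takes values in
  \<open>T_target\<close>.\<close>

lemma map_T_cls:
  assumes f: "f \<in> ZQ"
  shows "map_T X A x0 (BQ #>\<^bsub>MQ\<^esub> f) = CI #>\<^bsub>GP.R2.Q\<^esub> rF f"
proof -
  let ?p = "rel_to_abs (Inn X) A 2"
  have "map_T X A x0 (BQ #>\<^bsub>MQ\<^esub> f) = {z \<in> carrier GP.R2.Q. ?p z = ?p (rF f)}"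
    unfolding map_T_def transgression_cls[OF f] GP.rel_to_abs_cls[OF cF_kF_cocycle[OF f]] GP.rel_cohomology_2 ..
  also have "\<dots> = CI #>\<^bsub>GP.R2.Q\<^esub> rF f"
    using rel_to_abs_eq_iff[OF _ rF_closed[OF f]] subgroup.rcos_module[OF subgroup_CI GP.R2.Q.is_group rF_closed[OF f]]
      GP.R2.Q.r_coset_subset_G[OF subgroup.subset[OF subgroup_CI] rF_closed[OF f]] by blast
  finally show ?thesis .
qed

lemma map_T_hom: "map_T X A x0 \<in> hom HQ.Q (T_target X A x0)"
proof (rule homI)
  fix \<phi> assume "\<phi> \<in> carrier HQ.Q"
  then obtain f where f: "f \<in> ZQ" "\<phi> = BQ #>\<^bsub>MQ\<^esub> f" by (auto simp: HQ.carrier_Q)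
  show "map_T X A x0 \<phi> \<in> carrier (T_target X A x0)"
    unfolding f(2) map_T_cls[OF f(1)] T_target_eq
    by (rule hom_in_carrier[OF GP.R2.Q.rcos_hom[OF subgroup_CI] rF_closed[OF f(1)]])
  fix \<phi>' assume "\<phi>' \<in> carrier HQ.Q"
  then obtain f' where f': "f' \<in> ZQ" "\<phi>' = BQ #>\<^bsub>MQ\<^esub> f'" by (auto simp: HQ.carrier_Q)
  have ff: "f \<otimes>\<^bsub>MQ\<^esub> f' \<in> ZQ" using subgroup.m_closed[OF subgroup_ZQ f(1) f'(1)] .
  have "rF (f \<otimes>\<^bsub>MQ\<^esub> f') = rF f \<otimes>\<^bsub>GP.R2.Q\<^esub> rF f'"
    unfolding cF_kF_mult[OF f(1) f'(1)] by (rule GP.R2.cls_mult[OF cF_kF_cocycle[OF f(1)] cF_kF_cocycle[OF f'(1)], symmetric])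
  then show "map_T X A x0 (\<phi> \<otimes>\<^bsub>HQ.Q\<^esub> \<phi>') = map_T X A x0 \<phi> \<otimes>\<^bsub>T_target X A x0\<^esub> map_T X A x0 \<phi>'"
    unfolding f(2) f'(2) HQ.cls_mult[OF f(1) f'(1)] map_T_cls[OF f(1)] map_T_cls[OF f'(1)] map_T_cls[OF ff] T_target_eq
      GP.R2.Q.rcos_mult[OF subgroup_CI rF_closed[OF f(1)] rF_closed[OF f'(1)]] by simp
qed


section \<open>The kernel of T is torsion\<close>

lemma EV_hom_ZQ:
  assumes "h \<in> carrier (As X)"
  shows "(\<lambda>f. EV f x0 h) \<in> hom (MQ\<lparr>carrier := ZQ\<rparr>) A"
proof (rule homI)
  fix f f' assume f: "f \<in> carrier (MQ\<lparr>carrier := ZQ\<rparr>)" "f' \<in> carrier (MQ\<lparr>carrier := ZQ\<rparr>)"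
  then have f': "f \<in> ZQ" "f' \<in> ZQ" by simp_all
  show "EV f x0 h \<in> carrier A" by (rule EV_closed[OF f'(1) assms])
  show "EV (f \<otimes>\<^bsub>MQ\<lparr>carrier := ZQ\<rparr>\<^esub> f') x0 h = EV f x0 h \<otimes> EV f' x0 h"
    using EV_mult[OF f' subgroup.m_closed[OF subgroup_ZQ f'] base assms] by simp
qed

lemma EV_int_pow:
  assumes "f \<in> ZQ" "h \<in> carrier (As X)"
  shows "EV (f [^]\<^bsub>MQ\<^esub> (k::int)) x0 h = EV f x0 h [^] k"
  using hom_int_pow[OF EV_hom_ZQ[OF assms(2)], of f k] assms(1) comm_group.axioms(2)[OF HQ.comm_group_K] A.is_group
    HQ.int_pow_consistent[OF subgroup_ZQ assms(1), of k] by simp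

text \<open>Injectivity of \<open>P_star\<close> in the form needed for torsion: the
  \<open>k\<close>-th power of \<open>f\<close> evaluates trivially on all loops at
  \<open>x0\<close>, hence is a coboundary.\<close>

lemma cls_pow_trivial:
  assumes f: "f \<in> ZQ" and "\<And>h. h \<in> AS \<Longrightarrow> EV f x0 h [^] (k::int) = \<one>"
  shows "(BQ #>\<^bsub>MQ\<^esub> f) [^]\<^bsub>HQ.Q\<^esub> k = \<one>\<^bsub>HQ.Q\<^esub>"
proof -
  have fk: "f [^]\<^bsub>MQ\<^esub> k \<in> ZQ" using HQ.subgroup_int_pow_closed[OF subgroup_ZQ f] .
  have "f [^]\<^bsub>MQ\<^esub> k \<in> BQ"
    by (rule coboundary_if_EV_trivial[OF fk]) (use EV_int_pow[OF f] assms(2) in simp)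
  then show ?thesis using HQ.cls_pow[OF f, of k] HQ.cls_eq_one_iff[OF fk] by simp
qed

lemma KP_factor:
  assumes "g \<in> carrier (As X)"
  shows "g \<star> inv\<^bsub>As X\<^esub> sec (psi X g) \<in> KP"
  using assms by (simp add: kernel_def)

lemma EV_KP_torsion:
  assumes f: "f \<in> ZQ" and B: "cF f \<in> GP.B2"
    and n: "translation X x0 [^]\<^bsub>Inn X\<^esub> (n::nat) = \<one>\<^bsub>Inn X\<^esub>" and k: "k \<in> KP"
  shows "EV f x0 k [^] n = \<one>"
proof -
  obtain v where v: "v \<in> carrier (GP.C 1)" "cF f = GP.\<delta> 1 v" using B by (auto simp: GP.B2_eq)
  note vc = GP.C1_value[OF v(1)]
  define q where "q g = g \<star> inv\<^bsub>As X\<^esub> sec (psi X g)" for g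
  \<comment> \<open>On products, \<open>q\<close> deviates from a homomorphism by
    \<open>\<kappa>\<close>, and on \<open>\<kappa>\<close> the map \<open>EV f x0\<close> is the
    coboundary of \<open>v\<close>. The factor \<open>v [psi X g]\<close> compensates for this, so
    \<open>E\<close> is a homomorphism on all of \<open>As X\<close>.\<close>
  define E where "E g = EV f x0 (q g) \<otimes> v [psi X g]" for g
  have qK: "q g \<in> KP" if "g \<in> carrier (As X)" for g using KP_factor[OF that] by (simp add: q_def)
  have qs: "q g \<star> sec (psi X g) = g" if "g \<in> carrier (As X)" for g
    using that by (simp add: q_def As.m_assoc)
  have EVK: "EV f x0 (a \<star> b) = EV f x0 a \<otimes> EV f x0 b" if "a \<in> KP" "b \<in> carrier (As X)" for a b
    by (rule EV_AS_mult[OF f kernel_psi_AS[OF that(1)] that(2)])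
  have EVc: "EV f x0 a \<in> carrier A" if "a \<in> KP" for a by (rule EV_closed[OF f KP_closed[OF that]])
  have qm: "q (g \<star> h) = q g \<star> (q h \<star> \<kappa> (psi X g) (psi X h))"
    if gh: "g \<in> carrier (As X)" "h \<in> carrier (As X)" for g h
  proof -
    let ?\<sigma> = "psi X g" and ?\<tau> = "psi X h"
    note c = KP_closed[OF qK[OF gh(1)]] KP_closed[OF qK[OF gh(2)]]
    have st: "?\<sigma> \<in> carrier (Inn X)" "?\<tau> \<in> carrier (Inn X)" using gh by simp_all
    note sc = sec_closed[OF st(1)] sec_closed[OF st(2)] sec_closed[OF Inn.m_closed[OF st]]
    have "g \<star> h = (q g \<star> sec ?\<sigma>) \<star> (q h \<star> sec ?\<tau>)" using qs gh by simp
    also have "\<dots> = q g \<star> (sec ?\<sigma> \<star> q h) \<star> sec ?\<tau>" using c sc by (simp add: As.m_assoc)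
    also have "sec ?\<sigma> \<star> q h = q h \<star> sec ?\<sigma>"
      using kernel_psi_central[OF qK[OF gh(2)] sc(1)] by simp
    finally have "g \<star> h = q g \<star> (q h \<star> (sec ?\<sigma> \<star> sec ?\<tau>))"
      using c sc by (simp add: As.m_assoc)
    moreover have "q (g \<star> h) = g \<star> h \<star> inv\<^bsub>As X\<^esub> sec (?\<sigma> \<bullet> ?\<tau>)"
      using gh by (simp add: q_def)
    ultimately show ?thesis using c sc by (simp add: \<kappa>_def As.m_assoc)
  qed
  have E_hom: "E \<in> hom (As X) A"
  proof (rule homI)
    fix g h assume gh: "g \<in> carrier (As X)" "h \<in> carrier (As X)"
    let ?\<sigma> = "psi X g" and ?\<tau> = "psi X h"
    have st: "?\<sigma> \<in> carrier (Inn X)" "?\<tau> \<in> carrier (Inn X)" using gh by simp_all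
    note kk = \<kappa>_kernel[OF st]
    note c = EVc[OF qK[OF gh(1)]] EVc[OF qK[OF gh(2)]] vc[OF st(1)] vc[OF st(2)] vc[OF Inn.m_closed[OF st]]
    show "E g \<in> carrier A" using c by (simp add: E_def)
    have "EV f x0 (q (g \<star> h)) = EV f x0 (q g) \<otimes> (EV f x0 (q h) \<otimes> EV f x0 (\<kappa> ?\<sigma> ?\<tau>))"
      unfolding qm[OF gh] using EVK[OF qK[OF gh(1)], of "q h \<star> \<kappa> ?\<sigma> ?\<tau>"] EVK[OF qK[OF gh(2)], of "\<kappa> ?\<sigma> ?\<tau>"]
        KP_closed[OF qK[OF gh(2)]] KP_closed[OF kk] by simp
    also have "EV f x0 (\<kappa> ?\<sigma> ?\<tau>) = v [?\<tau>] \<otimes> inv v [?\<sigma> \<bullet> ?\<tau>] \<otimes> v [?\<sigma>]"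
      using cF_apply[OF st, of f] GP.\<delta>1_apply[OF v(1) st] v(2) by simp
    finally have "E (g \<star> h) = EV f x0 (q g) \<otimes> (EV f x0 (q h) \<otimes>
        (v [?\<tau>] \<otimes> inv v [?\<sigma> \<bullet> ?\<tau>] \<otimes> v [?\<sigma>])) \<otimes> v [?\<sigma> \<bullet> ?\<tau>]"
      unfolding E_def using gh by simp
    also have "\<dots> = E g \<otimes> E h \<otimes> (inv v [?\<sigma> \<bullet> ?\<tau>] \<otimes> v [?\<sigma> \<bullet> ?\<tau>])"
      unfolding E_def using c by (simp add: A.m_ac del: A.l_inv A.r_inv A.Units_l_inv A.Units_r_inv)
    also have "\<dots> = E g \<otimes> E h" unfolding E_def using c by simp
    finally show "E (g \<star> h) = E g \<otimes> E h" .
  qed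
  interpret E: group_hom "As X" A E
    using E_hom by (simp add: group_hom_iff As.is_group A.is_group)
  have EK: "E g = EV f x0 g" if g: "g \<in> KP" for g
  proof -
    \<comment> \<open>\<open>sec\<close> need not preserve the identity. The surplus factor in
      \<open>E g\<close> is the value of \<open>E\<close> at the identity and is therefore
      trivial.\<close>
    have s1: "inv\<^bsub>As X\<^esub> sec \<one>\<^bsub>Inn X\<^esub> \<in> KP" by (simp add: kernel_def)
    have p1: "psi X g = \<one>\<^bsub>Inn X\<^esub>" "g \<in> carrier (As X)" using g by (simp_all add: kernel_def)
    have c: "EV f x0 (inv\<^bsub>As X\<^esub> sec \<one>\<^bsub>Inn X\<^esub>) \<in> carrier A" "v [\<one>\<^bsub>Inn X\<^esub>] \<in> carrier A" using EVc[OF s1] vc by simp_all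
    have "E g = EV f x0 g \<otimes> (EV f x0 (inv\<^bsub>As X\<^esub> sec \<one>\<^bsub>Inn X\<^esub>) \<otimes> v [\<one>\<^bsub>Inn X\<^esub>])"
      unfolding E_def q_def p1(1) using EVK[OF g KP_closed[OF s1]] EVc[OF g] c by (simp add: A.m_assoc)
    also have "EV f x0 (inv\<^bsub>As X\<^esub> sec \<one>\<^bsub>Inn X\<^esub>) \<otimes> v [\<one>\<^bsub>Inn X\<^esub>] = E \<one>\<^bsub>As X\<^esub>"
      unfolding E_def q_def by simp
    finally show ?thesis using EVc[OF g] by simp
  qed
  \<comment> \<open>The power acts trivially by the choice of \<open>n\<close>, so \<open>E\<close>
    and \<open>EV f x0\<close> agree on it, and the latter is trivial on \<open>e x0\<close> because
    \<open>f (x0, x0)\<close> is.\<close>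
  have e0: "e x0 [^]\<^bsub>As X\<^esub> n \<in> KP" using n by (simp add: kernel_def psi.hom_nat_pow)
  have "EV f x0 (e x0 [^]\<^bsub>As X\<^esub> n) = \<one>"
  proof -
    interpret EV: group_hom AG A "EV f x0"
      using crossed_hom[OF EV_crossed[OF f]] group_AG A.is_group by (simp add: group_hom_iff)
    have "e x0 [^]\<^bsub>As X\<^esub> n = e x0 [^]\<^bsub>AG\<^esub> n"
      unfolding As_Stab_group_def by (rule As.nat_pow_consistent)
    moreover have "EV f x0 (e x0) = \<one>" using EV_gen[OF f base base] f by (simp add: cocycle_iff)
    ultimately show ?thesis using EV.hom_nat_pow[of "e x0" n] base_AS by simp
  qed
  then have E0: "E (e x0) [^] n = \<one>" using EK[OF e0] E.hom_nat_pow[of "e x0" n] by simp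
  \<comment> \<open>\<open>\<gamma> x\<close> conjugates \<open>e x0\<close> to \<open>e x\<close>,
    and a homomorphism into a commutative group does not see conjugation.\<close>
  have Ex: "E (e x) = E (e x0)" if x: "x \<in> carrier X" for x
  proof -
    have "E (e x0) \<otimes> E (\<gamma> x) = E (\<gamma> x) \<otimes> E (e x)"
      using As_gen_conj[OF \<gamma>_closed[OF x] base] x E.hom_mult[of "e x0" "\<gamma> x"] E.hom_mult[of "\<gamma> x" "e x"] by simp
    then have "E (e x) \<otimes> E (\<gamma> x) = E (e x0) \<otimes> E (\<gamma> x)" using x by (simp add: A.m_comm)
    then show ?thesis using x by simp
  qed
  have "E k [^] n = \<one>"
    using KP_closed[OF k]
  proof (induction k rule: As_induct)
    case (gen x)
    then show ?case using E0 by (simp only: Ex)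
  qed (simp_all add: A.nat_pow_inv A.nat_pow_distrib)
  then show ?thesis using EK[OF k] by simp
qed

text \<open>The \<open>n\<close>-th power of \<open>EV f x0\<close> is trivial on the kernel of
  \<open>psi X\<close>, so on the lifts \<open>sec \<sigma>\<close> it defines a homomorphism on the
  stabilizer in \<open>Inn X\<close>, and \<open>H1\<close> provides an exponent \<open>m\<close>
  for it. The predicate \<open>P\<close> will be instantiated with indivisibility by
  \<open>l\<close>.\<close>

lemma EV_torsion:
  assumes f: "f \<in> ZQ" and KP: "\<And>k. k \<in> KP \<Longrightarrow> EV f x0 k [^] (n::nat) = \<one>"
    and H1: "\<And>k. k \<in> GP.homs1 \<Longrightarrow> \<exists>m. P m \<and> (\<forall>a\<in>Stab X x0. k [a] [^] (m::int) = \<one>)"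
  shows "\<exists>m. P m \<and> (\<forall>h\<in>AS. EV f x0 h [^] (int n * m) = \<one>)"
proof -
  let ?k = "\<lambda>b\<in>tuples (Stab X x0) 1. EV f x0 (sec (b ! 0)) [^] n"
  have sc: "EV f x0 (sec a) \<in> carrier A" if "a \<in> Stab X x0" for a
    using EV_closed[OF f sec_closed[OF Stab_carrier[OF that]]] .
  have "EV f x0 (sec (a \<bullet> b)) [^] n = EV f x0 (sec a) [^] n \<otimes> EV f x0 (sec b) [^] n"
    if ab: "a \<in> Stab X x0" "b \<in> Stab X x0" for a b
  proof -
    note ab' = ab[THEN Stab_carrier]
    have ab2: "a \<bullet> b \<in> Stab X x0" using subgroup.m_closed[OF subgroup_Stab ab] .
    have kc: "EV f x0 (\<kappa> a b) \<in> carrier A" by (rule EV_closed[OF f KP_closed[OF \<kappa>_kernel[OF ab']]])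
    have "EV f x0 (\<kappa> a b) \<otimes> EV f x0 (sec (a \<bullet> b)) = EV f x0 (sec a) \<otimes> EV f x0 (sec b)"
      using EV_AS_mult[OF f kernel_psi_AS[OF \<kappa>_kernel[OF ab']] sec_closed[OF Stab_carrier[OF ab2]]]
        EV_AS_mult[OF f sec_AS[OF ab(1)] sec_closed[OF ab'(2)]] \<kappa>_mult[OF ab'] by simp
    then have "(EV f x0 (\<kappa> a b) \<otimes> EV f x0 (sec (a \<bullet> b))) [^] n = (EV f x0 (sec a) \<otimes> EV f x0 (sec b)) [^] n"
      by simp
    then show ?thesis using kc sc[OF ab2] sc[OF ab(1)] sc[OF ab(2)] KP[OF \<kappa>_kernel[OF ab']]
      by (simp add: A.nat_pow_distrib)
  qed
  moreover have "?k [a] = EV f x0 (sec a) [^] n" if "a \<in> Stab X x0" for a using that by simp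
  moreover have "?k \<in> (\<Pi>\<^sub>E x\<in>tuples (Stab X x0) 1. carrier A)"
    unfolding One_nat_def using sc by (auto elim!: tuples_1E)
  ultimately have "?k \<in> GP.homs1"
    unfolding GP.homs1_def using subgroup.m_closed[OF subgroup_Stab] by simp
  then obtain m where m: "P m" "\<And>a. a \<in> Stab X x0 \<Longrightarrow> (EV f x0 (sec a) [^] n) [^] m = \<one>"
    using H1[of ?k] by auto
  have "EV f x0 h [^] (int n * m) = \<one>" if h: "h \<in> AS" for h
  proof -
    have hc: "h \<in> carrier (As X)" "psi X h \<in> Stab X x0" using h unfolding AS_Stab by auto
    let ?q = "h \<star> inv\<^bsub>As X\<^esub> sec (psi X h)"
    have q: "?q \<in> KP" by (rule KP_factor[OF hc(1)])
    have "h = ?q \<star> sec (psi X h)" using hc(1) by (simp add: As.m_assoc)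
    then have "EV f x0 h = EV f x0 ?q \<otimes> EV f x0 (sec (psi X h))"
      using EV_AS_mult[OF f kernel_psi_AS[OF q] sec_closed[OF Stab_carrier[OF hc(2)]]] by simp
    then have "EV f x0 h [^] n = EV f x0 (sec (psi X h)) [^] n"
      using KP[OF q] EV_closed[OF f KP_closed[OF q]] sc[OF hc(2)] by (simp add: A.nat_pow_distrib)
    then have "(EV f x0 h [^] n) [^] m = \<one>" using m(2)[OF hc(2)] by simp
    then show ?thesis
      using A.int_pow_pow[OF EV_closed[OF f hc(1)], of "int n" m] by (simp add: int_pow_int)
  qed
  then show ?thesis using m(1) by blast
qed

section \<open>Multiples of relative classes lie in the image of T\<close>

lemma translation_base_commute:
  assumes "\<sigma> \<in> Stab X x0"
  shows "translation X x0 \<bullet> \<sigma> = \<sigma> \<bullet> translation X x0"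
proof -
  have s: "sec \<sigma> \<in> carrier (As X)" "psi X (sec \<sigma>) = \<sigma>" "\<sigma> x0 = x0"
    using Stab_carrier[OF assms] assms unfolding Stab_def by simp_all
  \<comment> \<open>Since \<open>\<sigma>\<close> fixes \<open>x0\<close>, the conjugation rule
    makes \<open>e x0\<close> commute with a lift of \<open>\<sigma>\<close>.\<close>
  have "psi X (e x0 \<star> sec \<sigma>) = psi X (sec \<sigma> \<star> e x0)"
    using As_gen_conj[OF s(1) base] s by simp
  then show ?thesis using s by simp
qed

text \<open>In the extension given by \<open>h\<close>, the \<open>n\<close>-th power of a lift of \<open>translation X x0\<close> lies over
  \<open>\<one>\<close>, hence is central; so the commutator of this lift with a lift of \<open>\<sigma>\<close>, which is central as
  well, has trivial \<open>n\<close>-th power.\<close>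

lemma cocycle_commutator_torsion:
  assumes h: "h \<in> GP.Z2" and n: "translation X x0 [^]\<^bsub>Inn X\<^esub> (n::nat) = \<one>\<^bsub>Inn X\<^esub>" and \<sigma>: "\<sigma> \<in> Stab X x0"
  shows "h [translation X x0, \<sigma>] [^] n = h [\<sigma>, translation X x0] [^] n"
proof -
  note hc = GP.C2_value[OF GP.H2.K_carrier[OF h]]
  interpret E: cocycle_extension A "Inn X" "\<lambda>a b. h [a, b]"
  proof
    fix a b c assume "a \<in> carrier (Inn X)" "b \<in> carrier (Inn X)" "c \<in> carrier (Inn X)"
    then show "h [a, b] \<in> carrier A" "h [b, c] \<otimes> h [a, b \<bullet> c] = h [a \<bullet> b, c] \<otimes> h [a, b]"
      using h hc unfolding GP.Z2_iff by blast+
  qed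
  let ?\<tau> = "translation X x0"
  have \<tau>c: "?\<tau> \<in> carrier (Inn X)" by simp
  have \<sigma>c: "\<sigma> \<in> carrier (Inn X)" by (rule Stab_carrier[OF \<sigma>])
  note \<tau>comm = translation_base_commute[OF \<sigma>]
  let ?t = "(\<one>, ?\<tau>)" and ?u = "(\<one>, \<sigma>)"
  \<comment> \<open>\<open>\<sigma>\<close> commutes with the translation, so the two products of
    the lifts lie over the same element and differ by \<open>?c\<close>; thus \<open>?z\<close> is
    the commutator of the lifts.\<close>
  let ?c = "h [?\<tau>, \<sigma>] \<otimes> inv h [\<sigma>, ?\<tau>]"
  let ?z = "E.inc ?c"
  have cA: "?c \<in> carrier A" using hc[OF \<tau>c \<sigma>c] hc[OF \<sigma>c \<tau>c] by simp
  have z: "?z \<in> carrier E.ext" by (rule E.inc_closed[OF cA])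
  have tu: "?t \<in> carrier E.ext" "?u \<in> carrier E.ext" using \<tau>c \<sigma>c by simp_all
  have zs: "snd ?z = \<one>\<^bsub>Inn X\<^esub>" by (simp add: E.inc_def)
  have "?z \<otimes>\<^bsub>E.ext\<^esub> (?u \<otimes>\<^bsub>E.ext\<^esub> ?t) = (?c \<otimes> h [\<sigma>, ?\<tau>], \<sigma> \<bullet> ?\<tau>)"
    using E.inc_mult[OF cA, of "h [\<sigma>, ?\<tau>]" "\<sigma> \<bullet> ?\<tau>"] \<sigma>c \<tau>c hc[OF \<sigma>c \<tau>c] by simp
  also have "\<dots> = ?t \<otimes>\<^bsub>E.ext\<^esub> ?u"
    using hc[OF \<tau>c \<sigma>c] hc[OF \<sigma>c \<tau>c] \<tau>comm by (simp add: A.m_assoc)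
  finally have eq: "?t \<otimes>\<^bsub>E.ext\<^esub> ?u = ?z \<otimes>\<^bsub>E.ext\<^esub> (?u \<otimes>\<^bsub>E.ext\<^esub> ?t)" ..
  let ?tn = "?t [^]\<^bsub>E.ext\<^esub> n"
  have "?tn \<otimes>\<^bsub>E.ext\<^esub> ?u = ?z [^]\<^bsub>E.ext\<^esub> n \<otimes>\<^bsub>E.ext\<^esub> (?u \<otimes>\<^bsub>E.ext\<^esub> ?tn)"
    by (rule E.E.commutator_power[OF tu z E.one_snd_central[OF z zs tu(1)] E.one_snd_central[OF z zs tu(2)] eq])
  moreover have "?tn \<otimes>\<^bsub>E.ext\<^esub> ?u = ?u \<otimes>\<^bsub>E.ext\<^esub> ?tn"
    using E.snd.hom_nat_pow[OF tu(1), of n] n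
    by (intro E.one_snd_central E.E.nat_pow_closed tu) simp
  ultimately have "?z [^]\<^bsub>E.ext\<^esub> n \<otimes>\<^bsub>E.ext\<^esub> (?u \<otimes>\<^bsub>E.ext\<^esub> ?tn) = ?u \<otimes>\<^bsub>E.ext\<^esub> ?tn" by (simp only:)
  then have "?z [^]\<^bsub>E.ext\<^esub> n = \<one>\<^bsub>E.ext\<^esub>"
    using E.E.r_cancel_one[OF E.E.m_closed[OF tu(2) E.E.nat_pow_closed[OF tu(1)]] E.E.nat_pow_closed[OF z]]
    by blast
  moreover have "E.inc (?c [^] n) = ?z [^]\<^bsub>E.ext\<^esub> n"
  proof -
    interpret i: group_hom A E.ext E.inc
      by (simp add: group_hom_iff E.inc_hom A.is_group E.E.is_group)
    show ?thesis by (rule i.hom_nat_pow[OF cA])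
  qed
  ultimately have "?c [^] n = \<one>" using E.inc_eq_one[OF A.nat_pow_closed[OF cA]] by simp
  then show ?thesis
    using hc[OF \<tau>c \<sigma>c] hc[OF \<sigma>c \<tau>c] by (simp add: A.nat_pow_distrib A.nat_pow_inv A.mult_inv_eq_one_iff)
qed

text \<open>Since \<open>c\<close> commutes with everything over the stabilizer of \<open>x0\<close>, its conjugate by an element over
  \<open>\<sigma>\<close> depends only on \<open>\<sigma> x0\<close>; these conjugates are the images of the generators.\<close>

lemma As_lift:
  fixes E :: "('e, 'f) monoid_scheme"
  assumes pr: "group_hom E (Inn X) pr" and surj: "carrier (Inn X) \<subseteq> pr ` carrier E"
    and c: "c \<in> carrier E" "pr c = translation X x0"
    and comm: "\<And>p. p \<in> carrier E \<Longrightarrow> pr p \<in> Stab X x0 \<Longrightarrow> c \<otimes>\<^bsub>E\<^esub> p = p \<otimes>\<^bsub>E\<^esub> c"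
  obtains \<Phi> where "\<Phi> \<in> hom (As X) E" "\<Phi> (e x0) = c" "\<And>g. g \<in> carrier (As X) \<Longrightarrow> pr (\<Phi> g) = psi X g"
proof -
  interpret pr: group_hom E "Inn X" pr by fact
  define gl where "gl x = inv_into (carrier E) pr (psi X (\<gamma> x))" for x
  have gl: "gl x \<in> carrier E" "pr (gl x) = psi X (\<gamma> x)" if "x \<in> carrier X" for x
  proof -
    have "psi X (\<gamma> x) \<in> pr ` carrier E" using surj that by auto
    then show "gl x \<in> carrier E" "pr (gl x) = psi X (\<gamma> x)"
      unfolding gl_def by (rule inv_into_into, rule f_inv_into_f)
  qed
  define \<epsilon> where "\<epsilon> x = inv\<^bsub>E\<^esub> gl x \<otimes>\<^bsub>E\<^esub> c \<otimes>\<^bsub>E\<^esub> gl x" for x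
  have \<epsilon>c: "\<epsilon> x \<in> carrier E" if "x \<in> carrier X" for x
    unfolding \<epsilon>_def using gl(1)[OF that] c(1) by simp
  have \<epsilon>eq: "gl x \<otimes>\<^bsub>E\<^esub> \<epsilon> x = c \<otimes>\<^bsub>E\<^esub> gl x" if "x \<in> carrier X" for x
    unfolding \<epsilon>_def using gl(1)[OF that] c(1) by (simp add: pr.G.m_assoc[symmetric])
  have \<epsilon>conj: "\<epsilon> x \<otimes>\<^bsub>E\<^esub> w = w \<otimes>\<^bsub>E\<^esub> \<epsilon> (pr w x)" if x: "x \<in> carrier X" and w: "w \<in> carrier E" for x w
  proof -
    let ?y = "pr w x"
    have y: "?y \<in> carrier X" using x w by simp
    \<comment> \<open>\<open>?p\<close> leads from \<open>x0\<close> to \<open>x\<close>, on to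
      \<open>?y\<close> and back to \<open>x0\<close>. It therefore lies over the stabilizer and
      commutes with \<open>c\<close>.\<close>
    let ?p = "gl x \<otimes>\<^bsub>E\<^esub> w \<otimes>\<^bsub>E\<^esub> inv\<^bsub>E\<^esub> gl ?y"
    note cl = gl(1)[OF x] gl(1)[OF y] w c(1) \<epsilon>c[OF x] \<epsilon>c[OF y]
    have p: "?p \<in> carrier E" using cl by simp
    have "pr ?p x0 = x0"
      using Inn_inv_apply(1)[of "psi X (\<gamma> ?y)" x0] x y cl by (simp add: gl(2))
    then have pS: "pr ?p \<in> Stab X x0" unfolding Stab_def using pr.hom_closed[OF p] by blast
    have pg: "?p \<otimes>\<^bsub>E\<^esub> gl ?y = gl x \<otimes>\<^bsub>E\<^esub> w" using cl by (simp add: pr.G.m_assoc)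
    have "gl x \<otimes>\<^bsub>E\<^esub> (\<epsilon> x \<otimes>\<^bsub>E\<^esub> w) = c \<otimes>\<^bsub>E\<^esub> (?p \<otimes>\<^bsub>E\<^esub> gl ?y)"
      unfolding pg using \<epsilon>eq[OF x] pr.G.m_assoc[OF cl(1,5,3)] pr.G.m_assoc[OF cl(4,1,3)] by simp
    also have "\<dots> = (?p \<otimes>\<^bsub>E\<^esub> c) \<otimes>\<^bsub>E\<^esub> gl ?y"
      using pr.G.m_assoc[OF cl(4) p cl(2)] comm[OF p pS] by simp
    also have "\<dots> = (?p \<otimes>\<^bsub>E\<^esub> gl ?y) \<otimes>\<^bsub>E\<^esub> \<epsilon> ?y"
      unfolding pr.G.m_assoc[OF p cl(4,2)] pr.G.m_assoc[OF p cl(2,6)] \<epsilon>eq[OF y] ..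
    also have "\<dots> = gl x \<otimes>\<^bsub>E\<^esub> (w \<otimes>\<^bsub>E\<^esub> \<epsilon> ?y)" unfolding pg by (rule pr.G.m_assoc[OF cl(1,3,6)])
    finally show ?thesis using pr.G.left_cancel cl by simp
  qed
  have pr_\<epsilon>: "pr (\<epsilon> y) = translation X y" if y: "y \<in> carrier X" for y
  proof -
    have "psi X (\<gamma> y) \<bullet> pr (\<epsilon> y) = translation X x0 \<bullet> psi X (\<gamma> y)"
      using arg_cong[OF \<epsilon>eq[OF y], of pr] pr.hom_mult[OF gl(1)[OF y] \<epsilon>c[OF y]] pr.hom_mult[OF c(1) gl(1)[OF y]]
      by (simp add: gl(2)[OF y] c(2))
    also have "\<dots> = psi X (e x0 \<star> \<gamma> y)" using y by simp
    also have "\<dots> = psi X (\<gamma> y) \<bullet> translation X y"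
      unfolding As_gen_conj[OF \<gamma>_closed[OF y] base] using y by simp
    finally show ?thesis
      using Inn.left_cancel[of "psi X (\<gamma> y)" "pr (\<epsilon> y)" "translation X y"] y \<epsilon>c[OF y] by simp
  qed
  \<comment> \<open>The conjugation rule for \<open>w = \<epsilon> y\<close>, which lies over the
    translation by \<open>y\<close>, is the relation of \<open>As X\<close>.\<close>
  have \<epsilon>rel: "\<epsilon> x \<otimes>\<^bsub>E\<^esub> \<epsilon> y = \<epsilon> y \<otimes>\<^bsub>E\<^esub> \<epsilon> (x \<rhd> y)" if "x \<in> carrier X" "y \<in> carrier X" for x y
    using \<epsilon>conj[OF that(1) \<epsilon>c[OF that(2)]] pr_\<epsilon>[OF that(2)] that(1) by simp
  have \<epsilon>fun: "\<epsilon> \<in> carrier X \<rightarrow> carrier E" using \<epsilon>c by blast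
  define \<Phi> where "\<Phi> = presented_hom E \<epsilon>"
  have \<Phi>hom: "\<Phi> \<in> hom (As X) E" and \<Phi>gen: "\<And>x. x \<in> carrier X \<Longrightarrow> \<Phi> (e x) = \<epsilon> x"
    unfolding \<Phi>_def using As_universal(1,2)[OF pr.G.is_group \<epsilon>fun \<epsilon>rel] by blast+
  interpret \<Phi>: group_hom "As X" E \<Phi> using \<Phi>hom by (simp add: group_hom_iff As.is_group pr.G.is_group)
  have pr_\<Phi>: "pr (\<Phi> g) = psi X g" if "g \<in> carrier (As X)" for g
    using that by (induction g rule: As_induct) (simp_all add: \<Phi>gen pr_\<epsilon>)
  \<comment> \<open>\<open>gl x0\<close> need not be neutral, but it lies over the stabilizer, so
    conjugation by it fixes \<open>c\<close>.\<close>
  have "psi X (\<gamma> x0) \<in> Stab X x0" unfolding Stab_def by simp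
  then have "gl x0 \<otimes>\<^bsub>E\<^esub> \<epsilon> x0 = gl x0 \<otimes>\<^bsub>E\<^esub> c"
    using \<epsilon>eq[OF base] comm[OF gl(1)[OF base]] gl(2)[OF base] by simp
  then have "\<epsilon> x0 = c" using pr.G.left_cancel[OF gl(1)[OF base] \<epsilon>c[OF base] c(1)] by blast
  then show ?thesis using that[OF \<Phi>hom _ pr_\<Phi>] \<Phi>gen[OF base] by simp
qed

text \<open>Over the stabilizer, sending \<open>\<sigma>\<close> to
  \<open>(inv (k [\<sigma>] [^] n), \<sigma>)\<close> is a homomorphic section of the extension
  given by the \<open>n\<close>-th power of \<open>h\<close>. The lift \<open>\<Phi>\<close> of
  \<open>psi X\<close> differs from it by the homomorphism \<open>F\<close> on the stabilizer in
  \<open>As X\<close>, and \<open>F\<close> yields the cocycle.\<close>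

lemma rel_cocycle_lift:
  assumes hk: "(h, k) \<in> GP.RZ2"
    and n: "translation X x0 [^]\<^bsub>Inn X\<^esub> (n::nat) = \<one>\<^bsub>Inn X\<^esub>"
  obtains f where "f \<in> ZQ" "GP.B2 #>\<^bsub>GP.C 2\<^esub> cF f = GP.B2 #>\<^bsub>GP.C 2\<^esub> (h [^]\<^bsub>GP.C 2\<^esub> int n)"
proof -
  have h: "h \<in> GP.Z2" and kc: "k [a] \<in> carrier A" if "a \<in> Stab X x0" for a
    using hk that by (auto simp: GP.RZ2_iff PiE_iff)
  have h: "h \<in> GP.Z2" using hk by (simp add: GP.RZ2_iff)
  have hkab: "h [a, b] \<otimes> k [a \<bullet> b] = k [a] \<otimes> k [b]" if "a \<in> Stab X x0" "b \<in> Stab X x0" for a b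
    using hk that unfolding GP.RZ2_iff by blast
  have hC: "h \<in> carrier (GP.C 2)" using h by (simp add: GP.Z2_iff)
  note hc = GP.C2_value[OF hC]
  have hcoc: "h [b, c] \<otimes> h [a, b \<bullet> c] = h [a \<bullet> b, c] \<otimes> h [a, b]"
    if "a \<in> carrier (Inn X)" "b \<in> carrier (Inn X)" "c \<in> carrier (Inn X)" for a b c
    using h that unfolding GP.Z2_iff by blast
  interpret E: cocycle_extension A "Inn X" "\<lambda>a b. h [a, b] [^] n"
  proof
    fix a b c assume abc: "a \<in> carrier (Inn X)" "b \<in> carrier (Inn X)" "c \<in> carrier (Inn X)"
    show "h [a, b] [^] n \<in> carrier A" using hc abc by simp
    show "h [b, c] [^] n \<otimes> h [a, b \<bullet> c] [^] n = h [a \<bullet> b, c] [^] n \<otimes> h [a, b] [^] n"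
      using hcoc[OF abc] hc abc by (simp flip: A.nat_pow_distrib)
  qed
  let ?\<tau> = "translation X x0"
  have \<tau>c: "?\<tau> \<in> carrier (Inn X)" by simp
  have \<tau>S: "?\<tau> \<in> Stab X x0" unfolding Stab_def by (simp add: idem)
  \<comment> \<open>The value of the section over the stabilizer at the translation by
    \<open>x0\<close>; with this choice \<open>F (e x0)\<close> is trivial.\<close>
  define \<epsilon>0 where "\<epsilon>0 = (inv (k [?\<tau>] [^] n), ?\<tau>)"
  have \<epsilon>0: "\<epsilon>0 \<in> carrier E.ext" "snd \<epsilon>0 = ?\<tau>" using kc[OF \<tau>S] by (simp_all add: \<epsilon>0_def)
  have comm0: "\<epsilon>0 \<otimes>\<^bsub>E.ext\<^esub> p = p \<otimes>\<^bsub>E.ext\<^esub> \<epsilon>0" if p: "p \<in> carrier E.ext" "snd p \<in> Stab X x0" for p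
  proof -
    obtain a \<sigma> where p': "p = (a, \<sigma>)" "a \<in> carrier A" "\<sigma> \<in> Stab X x0" using p by (cases p) auto
    then show ?thesis
      using cocycle_commutator_torsion[OF h n p'(3)] translation_base_commute[OF p'(3)] kc[OF \<tau>S]
      by (simp add: \<epsilon>0_def A.m_comm)
  qed
  have "carrier (Inn X) \<subseteq> snd ` carrier E.ext" by force
  then obtain \<Phi> where \<Phi>hom: "\<Phi> \<in> hom (As X) E.ext" and \<Phi>0: "\<Phi> (e x0) = \<epsilon>0"
    and snd_\<Phi>: "\<And>g. g \<in> carrier (As X) \<Longrightarrow> snd (\<Phi> g) = psi X g"
    using As_lift[OF E.snd.group_hom_axioms _ \<epsilon>0 comm0] by blast
  interpret \<Phi>: group_hom "As X" E.ext \<Phi> using \<Phi>hom by (simp add: group_hom_iff As.is_group E.group_ext)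
  define u where "u g = fst (\<Phi> g)" for g
  have \<Phi>eq: "\<Phi> g = (u g, psi X g)" if "g \<in> carrier (As X)" for g
    using snd_\<Phi>[OF that] by (simp add: u_def prod_eq_iff)
  have uc: "u g \<in> carrier A" if "g \<in> carrier (As X)" for g
    using \<Phi>.hom_closed[OF that] \<Phi>eq[OF that] by simp
  have um: "u (g \<star> g') = u g \<otimes> u g' \<otimes> h [psi X g, psi X g'] [^] n"
    if "g \<in> carrier (As X)" "g' \<in> carrier (As X)" for g g'
    using \<Phi>.hom_mult[OF that] \<Phi>eq[OF that(1)] \<Phi>eq[OF that(2)] \<Phi>eq[OF As.m_closed[OF that]] by simp
  have u0: "u (e x0) = inv (k [?\<tau>] [^] n)" using \<Phi>0 by (simp add: u_def \<epsilon>0_def)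
  define F where "F g = u g \<otimes> k [psi X g] [^] n" for g
  have F: "F \<in> hom AG A"
  proof (rule homI)
    fix g g' assume "g \<in> carrier AG" "g' \<in> carrier AG"
    then have g: "g \<in> carrier (As X)" "psi X g \<in> Stab X x0" "g' \<in> carrier (As X)" "psi X g' \<in> Stab X x0"
      unfolding carrier_AG AS_Stab by auto
    let ?\<sigma> = "psi X g" and ?\<tau>' = "psi X g'"
    note st = Stab_carrier[OF g(2)] Stab_carrier[OF g(4)]
    have k3: "k [?\<sigma> \<bullet> ?\<tau>'] \<in> carrier A" by (rule kc[OF subgroup.m_closed[OF subgroup_Stab g(2,4)]])
    show "F g \<in> carrier A" using uc[OF g(1)] kc[OF g(2)] by (simp add: F_def)
    have hn: "h [?\<sigma>, ?\<tau>'] [^] n \<otimes> k [?\<sigma> \<bullet> ?\<tau>'] [^] n = k [?\<sigma>] [^] n \<otimes> k [?\<tau>'] [^] n"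
      using hkab[OF g(2,4)] hc[OF st] k3 kc[OF g(2)] kc[OF g(4)] by (simp flip: A.nat_pow_distrib)
    have "F (g \<star> g') = u g \<otimes> u g' \<otimes> (h [?\<sigma>, ?\<tau>'] [^] n \<otimes> k [?\<sigma> \<bullet> ?\<tau>'] [^] n)"
      using um[OF g(1,3)] uc[OF g(1)] uc[OF g(3)] hc[OF st] k3 g by (simp add: F_def A.m_assoc)
    also have "\<dots> = F g \<otimes> F g'"
      unfolding hn F_def using uc[OF g(1)] uc[OF g(3)] kc[OF g(2)] kc[OF g(4)] by (simp add: A.m_ac)
    finally show "F (g \<otimes>\<^bsub>AG\<^esub> g') = F g \<otimes> F g'" by simp
  qed
  have F0: "F (e x0) = \<one>" using u0 kc[OF \<tau>S] by (simp add: F_def)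
  obtain f where f: "f \<in> ZQ" "\<And>g. g \<in> AS \<Longrightarrow> EV f x0 g = F g"
    by (rule cocycle_of_hom[OF F F0]) blast
  \<comment> \<open>The first coordinate of \<open>\<Phi>\<close> along \<open>sec\<close>. As a
    1-cochain it bounds the difference between \<open>cF f\<close> and the \<open>n\<close>-th power
    of \<open>h\<close>.\<close>
  define v where "v = (\<lambda>a\<in>tuples (carrier (Inn X)) 1. u (sec (a ! 0)))"
  have v: "v \<in> carrier (GP.C 1)"
    unfolding GP.carrier_C v_def One_nat_def using uc by (auto elim!: tuples_1E)
  have va: "v [\<sigma>] = u (sec \<sigma>)" if "\<sigma> \<in> carrier (Inn X)" for \<sigma> using that by (simp add: v_def)
  have hn: "h [^]\<^bsub>GP.C 2\<^esub> int n = (\<lambda>a\<in>tuples (carrier (Inn X)) 2. h a [^] n)"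
    using A.int_pow_map_group[of h "tuples (carrier (Inn X)) 2" "int n"] hC by (simp add: bar_cochains_def int_pow_int)
  have hnZ: "h [^]\<^bsub>GP.C 2\<^esub> int n \<in> GP.Z2" by (rule GP.H2.subgroup_int_pow_closed[OF GP.H2.K h])
  have "cF f [\<sigma>, \<tau>] = GP.\<delta> 1 v [\<sigma>, \<tau>] \<otimes> h [\<sigma>, \<tau>] [^] n" if st: "\<sigma> \<in> carrier (Inn X)" "\<tau> \<in> carrier (Inn X)" for \<sigma> \<tau>
  proof -
    let ?st = "\<sigma> \<bullet> \<tau>"
    have st3: "?st \<in> carrier (Inn X)" using st by simp
    note sc = sec_closed[OF st(1)] sec_closed[OF st(2)] sec_closed[OF st3]
    note uu = uc[OF sc(1)] uc[OF sc(2)] uc[OF sc(3)]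
    have kK: "\<kappa> \<sigma> \<tau> \<in> KP" by (rule \<kappa>_kernel[OF st])
    then have k1: "\<kappa> \<sigma> \<tau> \<in> carrier (As X)" "psi X (\<kappa> \<sigma> \<tau>) = \<one>\<^bsub>Inn X\<^esub>" by (simp_all add: kernel_def)
    have S1: "\<one>\<^bsub>Inn X\<^esub> \<in> Stab X x0" by (rule subgroup.one_closed[OF subgroup_Stab])
    \<comment> \<open>On the kernel, \<open>F\<close> differs from \<open>u\<close> by the constant
      \<open>k [\<one>] [^] n\<close>. The relative condition and the cocycle identity identify
      \<open>k [\<one>]\<close> with \<open>h [\<one>, ?st]\<close>, so this constant is the factor
      that \<open>um\<close> produces for the product of \<open>\<kappa> \<sigma> \<tau>\<close> and
      \<open>sec ?st\<close>.\<close>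
    have "h [\<one>\<^bsub>Inn X\<^esub>, \<one>\<^bsub>Inn X\<^esub>] = k [\<one>\<^bsub>Inn X\<^esub>]"
      using hkab[OF S1 S1] kc[OF S1] hc[of "\<one>\<^bsub>Inn X\<^esub>" "\<one>\<^bsub>Inn X\<^esub>"] by simp
    then have h1: "h [\<one>\<^bsub>Inn X\<^esub>, ?st] = k [\<one>\<^bsub>Inn X\<^esub>]" using hcoc[of "\<one>\<^bsub>Inn X\<^esub>" "\<one>\<^bsub>Inn X\<^esub>" ?st] hc[OF Inn.one_closed st3] kc[OF S1] st3 by simp
    have "F (\<kappa> \<sigma> \<tau>) \<otimes> u (sec ?st) = u (\<kappa> \<sigma> \<tau> \<star> sec ?st)"
      unfolding um[OF k1(1) sc(3)] F_def k1(2) psi_sec[OF st3] h1 using uu uc[OF k1(1)] kc[OF S1] by (simp add: A.m_ac)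
    also have "\<dots> = u (sec \<sigma>) \<otimes> u (sec \<tau>) \<otimes> h [\<sigma>, \<tau>] [^] n"
      unfolding \<kappa>_mult[OF st] using um[OF sc(1,2)] st by simp
    finally have "F (\<kappa> \<sigma> \<tau>) = u (sec \<sigma>) \<otimes> u (sec \<tau>) \<otimes> h [\<sigma>, \<tau>] [^] n \<otimes> inv u (sec ?st)"
      using A.inv_solve_right[of "F (\<kappa> \<sigma> \<tau>)" "u (sec \<sigma>) \<otimes> u (sec \<tau>) \<otimes> h [\<sigma>, \<tau>] [^] n" "u (sec ?st)"]
        uu hc[OF st] uc[OF k1(1)] kc[OF S1] by (simp add: F_def k1(2))
    then show ?thesis
      unfolding cF_apply[OF st] f(2)[OF kernel_psi_AS[OF kK]] GP.\<delta>1_apply[OF v st] va[OF st(1)] va[OF st(2)] va[OF st3]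
      using uu hc[OF st] by (simp add: A.m_ac)
  qed
  moreover have "GP.\<delta> 1 v \<otimes>\<^bsub>GP.C 2\<^esub> h [^]\<^bsub>GP.C 2\<^esub> int n \<in> carrier (GP.C 2)"
    using comm_group.axioms(2)[OF GP.C_comm_group] GP.\<delta>1_closed[OF v] GP.H2.K_carrier[OF hnZ] by (intro monoid.m_closed group.is_monoid)
  moreover have "(GP.\<delta> 1 v \<otimes>\<^bsub>GP.C 2\<^esub> h [^]\<^bsub>GP.C 2\<^esub> int n) [\<sigma>, \<tau>] = GP.\<delta> 1 v [\<sigma>, \<tau>] \<otimes> h [\<sigma>, \<tau>] [^] n"
    if "\<sigma> \<in> carrier (Inn X)" "\<tau> \<in> carrier (Inn X)" for \<sigma> \<tau>
    unfolding hn using that by (simp add: bar_cochains_def numeral_2_eq_2)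
  ultimately have "cF f = GP.\<delta> 1 v \<otimes>\<^bsub>GP.C 2\<^esub> h [^]\<^bsub>GP.C 2\<^esub> int n"
    using GP.H2.K_carrier[OF cF_Z2[OF f(1)]]
    by (intro GP.C2_eqI) simp_all
  moreover have "GP.\<delta> 1 v \<in> GP.B2" using v by (auto simp: GP.B2_eq)
  ultimately have "GP.B2 #>\<^bsub>GP.C 2\<^esub> cF f = GP.B2 #>\<^bsub>GP.C 2\<^esub> (h [^]\<^bsub>GP.C 2\<^esub> int n)"
    using GP.H2.cls_absorb[OF _ hnZ] by simp
  then show ?thesis using that f(1) by blast
qed

section \<open>Kernel and cokernel of T, and the localized isomorphism\<close>

lemma map_T_kernel_torsion:
  assumes n: "translation X x0 [^]\<^bsub>Inn X\<^esub> (n::nat) = \<one>\<^bsub>Inn X\<^esub>"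
    and H1: "\<And>k. k \<in> GP.homs1 \<Longrightarrow> \<exists>m. P m \<and> (\<forall>a\<in>Stab X x0. k [a] [^] (m::int) = \<one>)"
    and \<phi>: "\<phi> \<in> carrier HQ.Q" "map_T X A x0 \<phi> = \<one>\<^bsub>T_target X A x0\<^esub>"
  shows "\<exists>m. P m \<and> \<phi> [^]\<^bsub>HQ.Q\<^esub> (int n * m) = \<one>\<^bsub>HQ.Q\<^esub>"
proof -
  obtain f where f: "f \<in> ZQ" "\<phi> = BQ #>\<^bsub>MQ\<^esub> f" using \<phi>(1) by (auto simp: HQ.carrier_Q)
  have "CI #>\<^bsub>GP.R2.Q\<^esub> rF f = CI" using \<phi>(2) unfolding f(2) map_T_cls[OF f(1)] T_target_eq by simp
  then have "rF f \<in> CI" using GP.R2.Q.rcos_self[OF rF_closed[OF f(1)] subgroup_CI] by simp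
  then have "GP.B2 #>\<^bsub>GP.C 2\<^esub> cF f = \<one>\<^bsub>GP.H2.Q\<^esub>"
    unfolding CI_kernel kernel_def using GP.rel_to_abs_cls[OF cF_kF_cocycle[OF f(1)]] by simp
  then have "cF f \<in> GP.B2" using GP.H2.cls_eq_one_iff[OF cF_Z2[OF f(1)]] by blast
  then have "\<exists>m. P m \<and> (\<forall>h\<in>AS. EV f x0 h [^] (int n * m) = \<one>)"
    using EV_torsion[OF f(1) EV_KP_torsion[OF f(1) _ n] H1] by blast
  then show ?thesis unfolding f(2) using cls_pow_trivial[OF f(1)] by blast
qed

text \<open>The comparison takes place in the absolute \<open>H\<^sup>2\<close>, where
  \<open>rel_cocycle_lift\<close> gives equality. Relative classes with the same absolute image
  differ by an element of the connecting image, which \<open>T_target\<close> divides out.\<close>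

lemma map_T_cokernel_torsion:
  assumes n: "translation X x0 [^]\<^bsub>Inn X\<^esub> (n::nat) = \<one>\<^bsub>Inn X\<^esub>"
    and w: "w \<in> carrier (T_target X A x0)"
  shows "w [^]\<^bsub>T_target X A x0\<^esub> int n \<in> map_T X A x0 ` carrier HQ.Q"
proof -
  obtain z where z: "z \<in> carrier GP.R2.Q" "w = CI #>\<^bsub>GP.R2.Q\<^esub> z"
    using w unfolding T_target_eq carrier_FactGroup[of "GP.R2.Q"] by blast
  obtain h k where hk: "(h, k) \<in> GP.RZ2" "z = GP.RB2 #>\<^bsub>GP.RC 2\<^esub> (h, k)"
    using z(1) unfolding GP.R2.carrier_Q by auto
  have h: "h \<in> GP.Z2" using hk(1) by (simp add: GP.RZ2_iff)
  obtain f where f: "f \<in> ZQ" "GP.B2 #>\<^bsub>GP.C 2\<^esub> cF f = GP.B2 #>\<^bsub>GP.C 2\<^esub> (h [^]\<^bsub>GP.C 2\<^esub> int n)"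
    using rel_cocycle_lift[OF hk(1) n] .
  let ?p = "rel_to_abs (Inn X) A 2"
  let ?zn = "z [^]\<^bsub>GP.R2.Q\<^esub> int n"
  have zn: "?zn \<in> carrier GP.R2.Q" by (rule GP.R2.Q.int_pow_closed[OF z(1)])
  note rf = rF_closed[OF f(1)]
  have "?p ?zn = ?p z [^]\<^bsub>GP.H2.Q\<^esub> int n" by (rule p.hom_int_pow[OF z(1)])
  also have "\<dots> = ?p (rF f)"
    unfolding hk(2) GP.rel_to_abs_cls[OF hk(1)] GP.rel_to_abs_cls[OF cF_kF_cocycle[OF f(1)]] f(2)
    by (rule GP.H2.cls_pow[OF h])
  finally have "CI #>\<^bsub>GP.R2.Q\<^esub> rF f = CI #>\<^bsub>GP.R2.Q\<^esub> ?zn"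
    using GP.R2.Q.rcos_eq_iff[OF subgroup_CI rf zn] rel_to_abs_eq_iff[OF rf zn] by simp
  also have "\<dots> = w [^]\<^bsub>T_target X A x0\<^esub> int n"
    unfolding z(2) T_target_eq
    by (rule hom_int_pow[OF GP.R2.Q.rcos_hom[OF subgroup_CI] z(1) GP.R2.Q.is_group])
       (use comm_group.axioms(2)[OF T_target_comm_group] in \<open>simp only: T_target_eq\<close>)
  finally have "map_T X A x0 (BQ #>\<^bsub>MQ\<^esub> f) = w [^]\<^bsub>T_target X A x0\<^esub> int n" unfolding map_T_cls[OF f(1)] .
  then show ?thesis using HQ.cls_closed[OF f(1)] by (metis imageI)
qed

end

theorem theorem3p3:
  fixes X :: "('a, 'z) quandle_struct_scheme"
    and A :: "('b, 'm) monoid_scheme"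
    and x0 :: 'a
    and l :: nat
  assumes "connected_quandle X"
    and "comm_group A"
    and "x0 \<in> carrier X"
    and "prime l"
    and "\<exists>n. quandle_type X = enat n \<and> coprime l n"
    and "trivial_group (localization l (group_cohomology (Stab_group X x0) A 1))"
  shows "T_localized l X A x0 \<in>
    iso (localization l (quandle_cohomology2 X A))
        (localization l (rel_cohomology (Inn X) (Stab X x0) A 2))"
proof -
  interpret pointed_quandle X A x0
    using assms(1-3) by (simp add: pointed_quandle_def pointed_quandle_axioms_def connected_quandle_def)
  obtain n where n: "quandle_type X = enat n" "coprime l n" using assms(5) by blast
  have \<tau>: "translation X x0 [^]\<^bsub>Inn X\<^esub> n = \<one>\<^bsub>Inn X\<^esub>"
    using quandle_type_pow(2)[OF n(1) quandle_axioms base] .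
  have ln: "\<not> int l dvd int n"
    using n(2) assms(4) by (metis coprime_absorb_left int_dvd_int_iff not_prime_unit)
  let ?H1 = "group_cohomology (Stab_group X x0) A 1"
  have H1_eq: "?H1 = group_cohomology ((Inn X)\<lparr>carrier := Stab X x0\<rparr>) A 1" by (simp add: Stab_group_def)
  interpret S: group_pair "(Inn X)\<lparr>carrier := Stab X x0\<rparr>" A "Stab X x0" by (rule GP.group_pair_K)
  have H1_comm: "comm_group ?H1" unfolding H1_eq S.group_cohomology_1 by (rule S.H1.Q.comm_group_axioms)
  have H1: "\<exists>m. \<not> int l dvd m \<and> (\<forall>a\<in>Stab X x0. k [a] [^]\<^bsub>A\<^esub> m = \<one>\<^bsub>A\<^esub>)" if k: "k \<in> GP.homs1" for k
  proof -
    have "{k} \<in> carrier ?H1" unfolding H1_eq GP.carrier_H1_K using k by blast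
    then obtain m where m: "\<not> int l dvd m" "{k} [^]\<^bsub>?H1\<^esub> m = \<one>\<^bsub>?H1\<^esub>"
      using trivial_localization[OF H1_comm assms(4,6)] by blast
    then show ?thesis using GP.int_pow_H1_K[OF k] unfolding H1_eq by blast
  qed
  let ?q = "\<lambda>z. CI #>\<^bsub>GP.R2.Q\<^esub> z"
  have qhom: "?q \<in> hom GP.R2.Q (T_target X A x0)"
    unfolding T_target_eq by (rule GP.R2.Q.rcos_hom[OF subgroup_CI])
  \<comment> \<open>The quotient map becomes invertible after localization: its kernel is the image
    of \<open>H\<^sup>1\<close> of the stabilizer, which is torsion prime to
    \<open>l\<close>.\<close>
  have q: "localization_map l (T_target X A x0) ?q \<in> iso (localization l GP.R2.Q) (localization l (T_target X A x0))"
  proof (rule localization_map_iso[OF GP.R2.Q.comm_group_axioms T_target_comm_group assms(4) qhom])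
    fix z assume z: "z \<in> carrier GP.R2.Q" "?q z = \<one>\<^bsub>T_target X A x0\<^esub>"
    then have "z \<in> CI" using GP.R2.Q.rcos_self[OF z(1) subgroup_CI] by (simp add: T_target_eq)
    then obtain k where k: "k \<in> GP.homs1" "z = GP.RB2 #>\<^bsub>GP.RC 2\<^esub> (\<one>\<^bsub>GP.C 2\<^esub>, k)"
      unfolding connecting_image_def Stab_group_def GP.CI_eq by blast
    obtain m where m: "\<not> int l dvd m" "\<forall>a\<in>Stab X x0. k [a] [^]\<^bsub>A\<^esub> m = \<one>\<^bsub>A\<^esub>" using H1[OF k(1)] by blast
    have "z [^]\<^bsub>GP.R2.Q\<^esub> m = \<one>\<^bsub>GP.R2.Q\<^esub>"
      unfolding k(2) by (rule GP.connecting_pow_trivial[OF k(1)]) (use m(2) in blast)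
    then show "\<exists>m. \<not> int l dvd m \<and> z [^]\<^bsub>GP.R2.Q\<^esub> m = \<one>\<^bsub>GP.R2.Q\<^esub>" using m(1) by blast
  next
    fix w assume w: "w \<in> carrier (T_target X A x0)"
    then have "w \<in> ?q ` carrier GP.R2.Q" unfolding T_target_eq carrier_FactGroup[of "GP.R2.Q"] .
    \<comment> \<open>The quotient map is surjective, so the cokernel condition holds with exponent
      1.\<close>
    moreover have "w [^]\<^bsub>T_target X A x0\<^esub> (1::int) = w"
      using group.int_pow_1[OF comm_group.axioms(2)[OF T_target_comm_group] w] .
    moreover have "\<not> int l dvd 1" using assms(4) by auto
    ultimately show "\<exists>k. \<not> int l dvd k \<and> w [^]\<^bsub>T_target X A x0\<^esub> (k::int) \<in> ?q ` carrier GP.R2.Q" by metis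
  qed
  have T: "localization_map l (T_target X A x0) (map_T X A x0) \<in> iso (localization l HQ.Q) (localization l (T_target X A x0))"
  proof (rule localization_map_iso[OF HQ.Q.comm_group_axioms T_target_comm_group assms(4) map_T_hom])
    fix \<phi> assume "\<phi> \<in> carrier HQ.Q" "map_T X A x0 \<phi> = \<one>\<^bsub>T_target X A x0\<^esub>"
    from map_T_kernel_torsion[where P = "\<lambda>m. \<not> int l dvd m", OF \<tau> H1 this]
    obtain m where m: "\<not> int l dvd m" "\<phi> [^]\<^bsub>HQ.Q\<^esub> (int n * m) = \<one>\<^bsub>HQ.Q\<^esub>" by blast
    \<comment> \<open>The exponent combines the type \<open>n\<close> with the integer
      \<open>m\<close> coming from \<open>H\<^sup>1\<close>; the prime \<open>l\<close> divides
      neither factor.\<close>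
    moreover have "\<not> int l dvd int n * m" using m(1) ln assms(4) by (simp add: prime_dvd_mult_iff)
    ultimately show "\<exists>k. \<not> int l dvd k \<and> \<phi> [^]\<^bsub>HQ.Q\<^esub> k = \<one>\<^bsub>HQ.Q\<^esub>" by blast
  next
    fix w assume "w \<in> carrier (T_target X A x0)"
    then show "\<exists>k. \<not> int l dvd k \<and> w [^]\<^bsub>T_target X A x0\<^esub> k \<in> map_T X A x0 ` carrier HQ.Q"
      using map_T_cokernel_torsion[OF \<tau>] ln by blast
  qed
  have "group (localization l GP.R2.Q)"
  proof -
    interpret L: localized_group "GP.R2.Q" l
      using GP.R2.Q.comm_group_axioms assms(4) by (simp add: localized_group_def localized_group_axioms_def)
    show ?thesis unfolding localization_def by (rule L.P.T.is_group)
  qed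
  \<comment> \<open>\<open>T_localized\<close> is the localization of \<open>map_T\<close> followed
    by \<open>inv_into\<close> of the localized quotient map, which is the inverse isomorphism
    supplied by \<open>iso_set_sym\<close>.\<close>
  from iso_set_trans[OF T group.iso_set_sym[OF this q]]
  show ?thesis
    unfolding T_localized_def Let_def GP.rel_cohomology_2 quandle_cohomology2_eq .
qed

end
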